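(* A digraph $H$ is a hero in oriented complete multipartite graphs if and only if one of the following holds: $H=K_1$; or $H=H_1\Rightarrow H_2$ where $H_1$ and $H_2$ are heroes in oriented complete multipartite graphs; or $H=\vec{C}_3(1,1,H_1)$ where $H_1$ is a hero in oriented complete multipartite graphs.
   Context: An oriented complete multipartite graph is an orientation (each edge given exactly one direction) of a complete multipartite graph. The dichromatic number of a digraph is the least number of parts in a partition of its vertex set into sets inducing acyclic subdigraphs. A digraph $H$ is a hero in a class $\mathcal{C}$ if there is a constant $c$ such that every digraph in $\mathcal{C}$ with no induced subdigraph isomorphic to $H$ has dichromatic number at most $c$. $K_1$ is the one-vertex digraph. For digraphs $H_1,H_2$, $H_1\Rightarrow H_2$ is obtained from their disjoint union by adding all arcs from $H_1$ to $H_2$. For digraphs $D_1,D_2,D_3$, $\vec{C}_3(D_1,D_2,D_3)$ is obtained from their disjoint union by adding all arcs from $D_1$ to $D_2$, from $D_2$ to $D_3$ and from $D_3$ to $D_1$; the integer $1$ in this notation stands for $K_1$. *)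

theory Defs
  imports "Graph_Theory.Graph_Theory" "HOL-Library.Disjoint_Sets"
begin

text \<open>
  All digraphs are finite, without loops or parallel arcs, and have at least one vertex;
  arcs in both directions between two vertices are allowed.
\<close>
definition nonnull_digraph :: "'a pair_pre_digraph \<Rightarrow> bool" where
  "nonnull_digraph D \<longleftrightarrow> pair_digraph D \<and> pverts D \<noteq> {}"

text \<open>Two opposite arcs form a directed cycle of length 2 in the sense of \<open>cycle\<close>.\<close>
definition acyclic_digraph :: "('a, 'b) pre_digraph \<Rightarrow> bool" where
  "acyclic_digraph D \<longleftrightarrow> (\<nexists>p. pre_digraph.cycle D p)"

text \<open>Meaningful for finite loopless digraphs, where the partition into singletons qualifies.\<close>
definition dichromatic_number :: "('a, 'b) pre_digraph \<Rightarrow> nat" where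
  "dichromatic_number D =
     (LEAST k. \<exists>P. partition_on (verts D) P \<and> finite P \<and> card P = k \<and>
        (\<forall>X\<in>P. acyclic_digraph (D \<restriction> X)))"

definition contains_induced :: "'a pair_pre_digraph \<Rightarrow> 'b pair_pre_digraph \<Rightarrow> bool" where
  "contains_induced D H \<longleftrightarrow>
     (\<exists>K. induced_subgraph K (with_proj D) \<and> digraph_iso K (with_proj H))"

definition hero_in :: "'v pair_pre_digraph set \<Rightarrow> 'a pair_pre_digraph \<Rightarrow> bool" where
  "hero_in \<C> H \<longleftrightarrow> nonnull_digraph H \<and>
     (\<exists>c. \<forall>D\<in>\<C>. \<not> contains_induced D H \<longrightarrow> dichromatic_number (with_proj D) \<le> c)"

text \<open>Undirected graphs are symmetric digraphs, as in the locale \<open>pair_graph\<close>.\<close>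
definition complete_multipartite :: "'a pair_pre_digraph \<Rightarrow> bool" where
  "complete_multipartite G \<longleftrightarrow> pair_graph G \<and> pverts G \<noteq> {} \<and>
     (\<exists>P. partition_on (pverts G) P \<and>
        parcs G = {(u, v). \<exists>A\<in>P. \<exists>B\<in>P. A \<noteq> B \<and> u \<in> A \<and> v \<in> B})"

definition orientation_of :: "'a pair_pre_digraph \<Rightarrow> 'a pair_pre_digraph \<Rightarrow> bool" where
  "orientation_of D G \<longleftrightarrow> pverts D = pverts G \<and>
     parcs D \<union> (parcs D)\<inverse> = parcs G \<and> parcs D \<inter> (parcs D)\<inverse> = {}"

text \<open>
  Every finite digraph is isomorphic to one on a set of natural numbers, so using vertices
  of type \<^typ>\<open>nat\<close> covers the whole class up to isomorphism.
\<close>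
definition oriented_complete_multipartite_graphs :: "nat pair_pre_digraph set" where
  "oriented_complete_multipartite_graphs =
     {D. \<exists>G. complete_multipartite G \<and> orientation_of D G}"

definition K1 :: "unit pair_pre_digraph" where
  "K1 = \<lparr>pverts = {()}, parcs = {}\<rparr>"

definition disjoint_union ::
  "'a pair_pre_digraph \<Rightarrow> 'b pair_pre_digraph \<Rightarrow> ('a + 'b) pair_pre_digraph" where
  "disjoint_union D1 D2 =
     \<lparr>pverts = pverts D1 <+> pverts D2,
      parcs = map_prod Inl Inl ` parcs D1 \<union> map_prod Inr Inr ` parcs D2\<rparr>"

text \<open>\<open>H1 \<Rightarrow> H2\<close> in the literature.\<close>
definition dijoin ::
  "'a pair_pre_digraph \<Rightarrow> 'b pair_pre_digraph \<Rightarrow> ('a + 'b) pair_pre_digraph" where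
  "dijoin H1 H2 =
     \<lparr>pverts = pverts (disjoint_union H1 H2),
      parcs = parcs (disjoint_union H1 H2) \<union> Inl ` pverts H1 \<times> Inr ` pverts H2\<rparr>"

definition C3 ::
  "'a pair_pre_digraph \<Rightarrow> 'b pair_pre_digraph \<Rightarrow> 'c pair_pre_digraph
    \<Rightarrow> ('a + 'b + 'c) pair_pre_digraph" where
  "C3 D1 D2 D3 =
     (let U = disjoint_union D1 (disjoint_union D2 D3);
          V1 = Inl ` pverts D1; V2 = Inr ` Inl ` pverts D2; V3 = Inr ` Inr ` pverts D3
      in \<lparr>pverts = pverts U,
          parcs = parcs U \<union> V1 \<times> V2 \<union> V2 \<times> V3 \<union> V3 \<times> V1\<rparr>)"

end

theory Submission
  imports Defs "HOL-Library.Sublist" "HOL-Library.List_Lexorder" "HOL-Library.Nat_Bijection"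
begin

text \<open>
  The heart of the matter are bounded sets of large dichromatic number. If no bounded number of
  vertices dominates a digraph of the class (up to a bounded number of parts), then it contains such
  sets of any chromatic number \<open>k\<close>: for a minimal dominating set \<open>B\<close>, a subset \<open>W\<close> of it, a bounded
  \<open>k\<close>-chromatic set complete to \<open>W\<close>, and for every large \<open>S \<subseteq> W\<close> a bounded \<open>k\<close>-chromatic set
  among the vertices that only \<open>S\<close> dominates, any \<open>k\<close>-colouring of the union has a monochromatic
  triangle. Parts that cannot be dominated need a separate argument of the same kind. As a
  consequence, digraphs whose out-neighbourhoods have bounded dichromatic number have bounded
  dichromatic number.

  For \<open>H1 \<Rightarrow> H2\<close>, call an arc \<open>uv\<close> heavy if the set of all \<open>w\<close> with \<open>v \<rightarrow> w \<rightarrow> u\<close> contains a bounded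
  \<open>k\<close>-chromatic set. A large clique of heavy arcs yields a bounded set of chromatic number \<open>k + 1\<close>.
  Along a light arc \<open>uv\<close> the out-neighbourhood of \<open>v\<close> is almost contained in that of \<open>u\<close>; hence a
  vertex with large light in- and out-neighbourhoods lies between copies of \<open>H1\<close> and \<open>H2\<close>.
  For \<open>C3 1 1 H1\<close> all arcs are light. Either there are almost sources and almost sinks everywhere, or
  one can take a maximal chain of critical bounded sets; in both cases the position of a vertex with
  respect to a sequence of sets is a potential that drops by at most one along arcs and has level sets of
  bounded dichromatic number.

  Conversely, heroes embed into iterated \<open>C3\<close> tournaments, so it suffices that \<open>C3 1 2 2\<close> is not a hero.
  Take an ordered graph of large chromatic number whose vertices are the nodes of a tree in preorder,
  with edges between comparable nodes that do not cross along any branch. The double shift of this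
  graph, with the shift pairs as backward arcs and the middle entries as parts, has large dichromatic
  number, and a copy of \<open>C3 1 2 2\<close> in it would give a crossing.
\<close>

section \<open>Colourings with acyclic classes\<close>

text \<open>Lower bounds all come from one device: in a (\<open>k + 1\<close>)-colouring, a set that
  is not \<open>k\<close>-colourable contains every colour. So the corners of a directed triangle
  can be picked in one colour from suitable sets, and monochromatic triangles are the only cycles
  exhibited in the lower bounds. Upper bounds come from unions, from sharing a palette where arcs
  run one way only, and from potentials.

  The constants must not depend on the digraph. The sets found therefore have to be bounded in size
  as well as hard to colour: only then can one range over their vertices or subsets at a fixed cost
  in colours.

  The obstacle compared with tournaments is that a vertex not dominated by \<open>x\<close> need not
  dominate \<open>x\<close>, since it may lie in the part of \<open>x\<close>. Colouring a part
  costs a single colour, which explains most of the summands 1 in the bounds, but dominating a part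
  may take arbitrarily many vertices.\<close>

definition acy :: "('v \<Rightarrow> 'v \<Rightarrow> bool) \<Rightarrow> 'v set \<Rightarrow> bool" where
  "acy E X \<longleftrightarrow> acyclic {(x, y). x \<in> X \<and> y \<in> X \<and> E x y}"

definition is_colouring :: "('v \<Rightarrow> 'v \<Rightarrow> bool) \<Rightarrow> 'v set \<Rightarrow> nat \<Rightarrow> ('v \<Rightarrow> nat) \<Rightarrow> bool" where
  "is_colouring E V k f \<longleftrightarrow> (\<forall>v\<in>V. f v < k) \<and> (\<forall>i. acy E {v\<in>V. f v = i})"

definition col :: "('v \<Rightarrow> 'v \<Rightarrow> bool) \<Rightarrow> 'v set \<Rightarrow> nat \<Rightarrow> bool" where
  "col E V k \<longleftrightarrow> (\<exists>f. is_colouring E V k f)"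

definition nadj :: "('v \<Rightarrow> 'v \<Rightarrow> bool) \<Rightarrow> 'v \<Rightarrow> 'v \<Rightarrow> bool" where
  "nadj E x y \<longleftrightarrow> \<not> E x y \<and> \<not> E y x"

text \<open>\<open>E\<close> orients a complete multipartite graph on \<open>V\<close>; the parts are the classes of \<open>nadj E\<close>.\<close>
definition ocm :: "('v \<Rightarrow> 'v \<Rightarrow> bool) \<Rightarrow> 'v set \<Rightarrow> bool" where
  "ocm E V \<longleftrightarrow> finite V \<and> (\<forall>x\<in>V. \<forall>y\<in>V. E x y \<longrightarrow> \<not> E y x) \<and>
     (\<forall>x\<in>V. \<forall>y\<in>V. \<forall>z\<in>V. nadj E x y \<longrightarrow> nadj E y z \<longrightarrow> nadj E x z)"

lemma acy_subset: "acy E X \<Longrightarrow> Y \<subseteq> X \<Longrightarrow> acy E Y"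
  unfolding acy_def by (erule acyclic_subset) auto

lemma acy_cong: "(\<And>x y. x \<in> X \<Longrightarrow> y \<in> X \<Longrightarrow> E x y \<longleftrightarrow> F x y) \<Longrightarrow> acy E X \<longleftrightarrow> acy F X"
  unfolding acy_def by (rule arg_cong[where f = acyclic]) auto

text \<open>Along a closed walk \<open>\<phi>\<close> cannot increase strictly, so the walk stays in
  a single level.\<close>

lemma acyclic_by_levels:
  fixes \<phi> :: "'v \<Rightarrow> nat"
  assumes mono: "\<And>x y. (x, y) \<in> R \<Longrightarrow> \<phi> x \<le> \<phi> y"
    and lev: "\<And>l. acyclic {(x, y). (x, y) \<in> R \<and> \<phi> x = l \<and> \<phi> y = l}"
  shows "acyclic R"
proof (rule acyclicI, rule allI, rule notI)
  fix x assume "(x, x) \<in> R\<^sup>+"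
  have le: "\<phi> a \<le> \<phi> b" if "(a, b) \<in> R\<^sup>+" for a b
    using that by (induction rule: trancl_induct) (auto dest: mono)
  have "\<phi> a = \<phi> b \<Longrightarrow> (a, b) \<in> {(x, y). (x, y) \<in> R \<and> \<phi> x = \<phi> a \<and> \<phi> y = \<phi> a}\<^sup>+"
    if "(a, b) \<in> R\<^sup>+" for a b
    using that
  proof (induction rule: trancl_induct)
    case (step b c)
    from le[OF step.hyps(1)] mono[OF step.hyps(2)] step.prems have "\<phi> b = \<phi> a" by simp
    with step show ?case by (intro trancl_into_trancl[OF step.IH]) auto
  qed auto
  from this[OF \<open>(x, x) \<in> R\<^sup>+\<close>] lev[of "\<phi> x"] show False
    by (auto simp: acyclic_def)
qed

lemma acy_by_levels:
  fixes \<phi> :: "'v \<Rightarrow> nat"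
  assumes "\<And>x y. x \<in> X \<Longrightarrow> y \<in> X \<Longrightarrow> E x y \<Longrightarrow> \<phi> x \<le> \<phi> y"
    and "\<And>l. acy E {x\<in>X. \<phi> x = l}"
  shows "acy E X"
  unfolding acy_def
proof (rule acyclic_by_levels[where \<phi> = \<phi>])
  fix l
  have eq: "{(x, y). (x, y) \<in> {(x, y). x \<in> X \<and> y \<in> X \<and> E x y} \<and> \<phi> x = l \<and> \<phi> y = l} =
    {(x, y). x \<in> {x\<in>X. \<phi> x = l} \<and> y \<in> {x\<in>X. \<phi> x = l} \<and> E x y}" by auto
  show "acyclic {(x, y). (x, y) \<in> {(x, y). x \<in> X \<and> y \<in> X \<and> E x y} \<and> \<phi> x = l \<and> \<phi> y = l}"
    unfolding eq using assms(2)[of l] unfolding acy_def .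
qed (use assms in auto)

lemma acy_indep: "(\<And>x y. x \<in> X \<Longrightarrow> y \<in> X \<Longrightarrow> \<not> E x y) \<Longrightarrow> acy E X"
proof -
  assume a: "\<And>x y. x \<in> X \<Longrightarrow> y \<in> X \<Longrightarrow> \<not> E x y"
  then have "{(x, y). x \<in> X \<and> y \<in> X \<and> E x y} = {}" by auto
  then show ?thesis unfolding acy_def by (simp only: acyclic_def) simp
qed

lemma acy_empty [simp]: "acy E {}"
  by (rule acy_indep) auto

lemma acy_rev: "acy (\<lambda>x y. E y x) X \<longleftrightarrow> acy E X"
proof -
  have "{(x, y). x \<in> X \<and> y \<in> X \<and> E y x} = {(x, y). x \<in> X \<and> y \<in> X \<and> E x y}\<inverse>" by auto
  then show ?thesis unfolding acy_def by (simp only: acyclic_converse)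
qed

lemma is_colouring_no_triangle:
  assumes "is_colouring E V k f" "x \<in> V" "y \<in> V" "z \<in> V"
    and "f y = f x" "f z = f x" "E x y" "E y z" "E z x"
  shows False
proof -
  let ?R = "{(u, v). u \<in> {v\<in>V. f v = f x} \<and> v \<in> {v\<in>V. f v = f x} \<and> E u v}"
  have "(x, y) \<in> ?R" "(y, z) \<in> ?R" "(z, x) \<in> ?R" using assms by auto
  then have "(x, x) \<in> ?R\<^sup>+" by (meson trancl.intros)
  then show False using assms(1) unfolding is_colouring_def acy_def acyclic_def by blast
qed

section \<open>Operations on colourings\<close>

lemma is_colouring_subset:
  "is_colouring E V k f \<Longrightarrow> U \<subseteq> V \<Longrightarrow> is_colouring E U k f"
  unfolding is_colouring_def by (blast intro: acy_subset)

lemma col_mono: "col E V k \<Longrightarrow> U \<subseteq> V \<Longrightarrow> k \<le> m \<Longrightarrow> col E U m"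
  unfolding col_def
proof (elim exE, intro exI)
  fix f assume "is_colouring E V k f" "U \<subseteq> V" "k \<le> m"
  then show "is_colouring E U m f"
    by (drule_tac is_colouring_subset) (auto simp: is_colouring_def)
qed

lemma col_subset: "col E V k \<Longrightarrow> U \<subseteq> V \<Longrightarrow> col E U k"
  by (rule col_mono) auto

lemma col_0_iff [simp]: "col E V 0 \<longleftrightarrow> V = {}"
  unfolding col_def is_colouring_def by auto

lemma col_empty [simp]: "col E {} k"
  unfolding col_def is_colouring_def by auto

lemma col_acy: "acy E V \<Longrightarrow> col E V (Suc 0)"
  unfolding col_def is_colouring_def by (rule exI[of _ "\<lambda>_. 0"]) (auto intro: acy_subset)

lemma col_indep: "(\<And>x y. x \<in> V \<Longrightarrow> y \<in> V \<Longrightarrow> \<not> E x y) \<Longrightarrow> col E V (Suc 0)"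
  by (intro col_acy acy_indep) auto

lemma col_rev: "col (\<lambda>x y. E y x) V k \<longleftrightarrow> col E V k"
  unfolding col_def is_colouring_def acy_rev[of E] ..

lemma col_Un:
  assumes "col E A a" "col E B b" shows "col E (A \<union> B) (a + b)"
proof -
  obtain f g where f: "is_colouring E A a f" and g: "is_colouring E B b g"
    using assms unfolding col_def by blast
  define h where "h v = (if v \<in> A then f v else a + g v)" for v
  have "acy E {v\<in>A \<union> B. h v = i}" for i
  proof (cases "i < a")
    case True
    then have "{v\<in>A \<union> B. h v = i} \<subseteq> {v\<in>A. f v = i}"
      unfolding h_def by (auto split: if_splits)
    then show ?thesis using f unfolding is_colouring_def by (blast intro: acy_subset)
  next
    case False
    then have "{v\<in>A \<union> B. h v = i} \<subseteq> {v\<in>B. g v = i - a}"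
      using f unfolding h_def is_colouring_def by (auto split: if_splits)
    then show ?thesis using g unfolding is_colouring_def by (blast intro: acy_subset)
  qed
  moreover have "h v < a + b" if "v \<in> A \<union> B" for v
    using that f g unfolding h_def is_colouring_def by auto
  ultimately show ?thesis unfolding col_def is_colouring_def by blast
qed

lemma col_Un_le: "col E A a \<Longrightarrow> col E B b \<Longrightarrow> U \<subseteq> A \<union> B \<Longrightarrow> a + b \<le> c \<Longrightarrow> col E U c"
  using col_Un col_mono by metis

lemma col_UN:
  assumes "finite I" "\<And>i. i \<in> I \<Longrightarrow> col E (A i) k" shows "col E (\<Union>i\<in>I. A i) (card I * k)"
  using assms by (induction I) (auto intro: col_Un)

lemma col_UN_le:
  assumes "finite I" "card I \<le> n" "\<And>i. i \<in> I \<Longrightarrow> col E (A i) k"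
  shows "col E (\<Union>i\<in>I. A i) (n * k)"
  by (rule col_mono[OF col_UN[of I]]) (use assms in auto)

lemma col_image:
  assumes "inj_on h V" "\<And>x y. x \<in> V \<Longrightarrow> y \<in> V \<Longrightarrow> E x y \<Longrightarrow> F (h x) (h y)"
    and "col F (h ` V) k"
  shows "col E V k"
proof -
  obtain f where f: "is_colouring F (h ` V) k f" using assms(3) unfolding col_def by blast
  have "acy E {v\<in>V. f (h v) = i}" for i
  proof -
    let ?R = "{(x, y). x \<in> {v\<in>V. f (h v) = i} \<and> y \<in> {v\<in>V. f (h v) = i} \<and> E x y}"
    let ?S = "{(x, y). x \<in> {v\<in>h ` V. f v = i} \<and> y \<in> {v\<in>h ` V. f v = i} \<and> F x y}"
    have "(h x, h y) \<in> ?S\<^sup>+" if "(x, y) \<in> ?R\<^sup>+" for x y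
      using that
    proof (induction rule: trancl_induct)
      case (base y) then show ?case using assms(2) by (intro r_into_trancl) auto
    next
      case (step y z)
      have "(h y, h z) \<in> ?S" using step.hyps(2) assms(2) by auto
      with step.IH show ?case by (rule trancl_into_trancl)
    qed
    moreover have "acyclic ?S" using f unfolding is_colouring_def acy_def by blast
    ultimately show ?thesis unfolding acy_def acyclic_def by blast
  qed
  then show ?thesis using f unfolding col_def is_colouring_def by (intro exI[of _ "f \<circ> h"]) auto
qed

text \<open>A colouring of each level is combined with the parity of the level. Within a class no
  arc drops by exactly one level, so none drops at all and \<open>acy_by_levels\<close> applies. The
  number of levels does not enter the bound.\<close>

lemma col_levels:
  fixes \<phi> :: "'v \<Rightarrow> nat"
  assumes step: "\<And>x y. x \<in> V \<Longrightarrow> y \<in> V \<Longrightarrow> E x y \<Longrightarrow> \<phi> x \<le> Suc (\<phi> y)"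
    and lev: "\<And>l. col E {x\<in>V. \<phi> x = l} m"
  shows "col E V (2 * m)"
proof -
  from lev obtain g where g: "\<And>l. is_colouring E {x\<in>V. \<phi> x = l} m (g l)"
    unfolding col_def by metis
  define f where "f x = 2 * g (\<phi> x) x + \<phi> x mod 2" for x
  have "acy E {x\<in>V. f x = i}" for i
  proof (rule acy_by_levels[where \<phi> = \<phi>])
    fix x y assume xy: "x \<in> {x\<in>V. f x = i}" "y \<in> {x\<in>V. f x = i}" "E x y"
    then have "f x mod 2 = f y mod 2" "\<phi> x \<le> Suc (\<phi> y)" using step by auto
    then show "\<phi> x \<le> \<phi> y" unfolding f_def by (auto simp: le_Suc_eq) presburger
  next
    fix l
    have "{x \<in> {x \<in> V. f x = i}. \<phi> x = l} \<subseteq> {x \<in> {x\<in>V. \<phi> x = l}. g l x = i div 2}"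
      unfolding f_def by auto
    then show "acy E {x \<in> {x \<in> V. f x = i}. \<phi> x = l}"
      using g[of l] unfolding is_colouring_def by (blast intro: acy_subset)
  qed
  moreover have "f x < 2 * m" if "x \<in> V" for x
  proof -
    have "g (\<phi> x) x < m" using that g[of "\<phi> x"] unfolding is_colouring_def by auto
    then show ?thesis unfolding f_def by linarith
  qed
  ultimately show ?thesis unfolding col_def is_colouring_def by blast
qed

text \<open>Both sides share one palette: a cycle meeting both would need an arc from
  \<open>B\<close> back to \<open>A\<close>.\<close>

lemma col_dijoin:
  assumes "col E A k" "col E B k" "A \<inter> B = {}" "\<And>x y. x \<in> A \<Longrightarrow> y \<in> B \<Longrightarrow> \<not> E y x"
  shows "col E (A \<union> B) k"
proof -
  obtain f g where f: "is_colouring E A k f" and g: "is_colouring E B k g"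
    using assms unfolding col_def by blast
  define h where "h v = (if v \<in> A then f v else g v)" for v
  have "acy E {v\<in>A \<union> B. h v = i}" for i
  proof (rule acy_by_levels[where \<phi> = "\<lambda>v. if v \<in> A then 0 else 1::nat"])
    fix l
    have "{x \<in> {v \<in> A \<union> B. h v = i}. (if x \<in> A then 0 else 1::nat) = l} \<subseteq> {v\<in>A. f v = i} \<or>
      {x \<in> {v \<in> A \<union> B. h v = i}. (if x \<in> A then 0 else 1::nat) = l} \<subseteq> {v\<in>B. g v = i}"
      unfolding h_def by (cases "l = 0") (auto split: if_splits)
    then show "acy E {x \<in> {v \<in> A \<union> B. h v = i}. (if x \<in> A then 0 else 1::nat) = l}"
      using f g unfolding is_colouring_def by (blast intro: acy_subset)
  qed (use assms(4) in auto)
  moreover have "h v < k" if "v \<in> A \<union> B" for v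
    using that f g unfolding h_def is_colouring_def by auto
  ultimately show ?thesis unfolding col_def is_colouring_def by blast
qed

text \<open>If \<open>a\<close> were missing on \<open>A\<close>, it could take over the class of
  the last colour \<open>k\<close>, and \<open>k\<close> colours would do. This finds the corners of
  the monochromatic triangles below.\<close>

lemma colour_used:
  assumes f: "is_colouring E A (Suc k) f" and "\<not> col E A k" and "a < Suc k"
  shows "\<exists>z\<in>A. f z = a"
proof (rule ccontr)
  assume no: "\<not> ?thesis"
  define g where "g v = (if f v = k then a else f v)" for v
  have "acy E {v\<in>A. g v = i}" for i
  proof -
    have "{v\<in>A. g v = i} \<subseteq> {v\<in>A. f v = i} \<or> {v\<in>A. g v = i} \<subseteq> {v\<in>A. f v = k}"
      using no unfolding g_def by (cases "i = a") (auto split: if_splits)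
    then show ?thesis using f unfolding is_colouring_def by (blast intro: acy_subset)
  qed
  moreover have "g v < k" if "v \<in> A" for v
    using that f no assms(3) unfolding g_def is_colouring_def by (auto simp: less_Suc_eq)
  ultimately have "col E A k" unfolding col_def is_colouring_def by blast
  with assms(2) show False ..
qed

lemma majority_class:
  assumes "finite W" "\<And>w. w \<in> W \<Longrightarrow> f w < k" "k * s \<le> card W" "0 < s" "0 < k"
  shows "\<exists>a<k. s \<le> card {w\<in>W. f w = (a::nat)}"
proof (rule ccontr)
  assume "\<not> ?thesis"
  then have lt: "card {w\<in>W. f w = a} \<le> s - 1" if "a < k" for a using that by fastforce
  have "card W = card (\<Union>a\<in>{..<k}. {w\<in>W. f w = a})"
    by (rule arg_cong[where f = card]) (use assms(2) in auto)
  also have "\<dots> \<le> (\<Sum>a<k. card {w\<in>W. f w = a})" by (rule card_UN_le) auto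
  also have "\<dots> \<le> (\<Sum>a<k. s - 1)" by (rule sum_mono) (use lt in auto)
  also have "\<dots> = k * (s - 1)" by simp
  also have "\<dots> < k * s" using assms(4,5) by auto
  finally show False using assms(3) by simp
qed

section \<open>Parts, subsets and reversal of oriented complete multipartite graphs\<close>

lemma ocm_finite: "ocm E V \<Longrightarrow> finite V" by (simp add: ocm_def)

lemma ocm_asym: "ocm E V \<Longrightarrow> x \<in> V \<Longrightarrow> y \<in> V \<Longrightarrow> E x y \<Longrightarrow> \<not> E y x"
  unfolding ocm_def by blast

lemma ocm_irrefl: "ocm E V \<Longrightarrow> x \<in> V \<Longrightarrow> \<not> E x x"
  using ocm_asym by metis

lemma ocm_trans:
  "ocm E V \<Longrightarrow> x \<in> V \<Longrightarrow> y \<in> V \<Longrightarrow> z \<in> V \<Longrightarrow> nadj E x y \<Longrightarrow> nadj E y z \<Longrightarrow> nadj E x z"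
  unfolding ocm_def by blast

lemma nadj_sym: "nadj E x y \<Longrightarrow> nadj E y x" by (auto simp: nadj_def)

lemma nadj_refl: "ocm E V \<Longrightarrow> x \<in> V \<Longrightarrow> nadj E x x" by (simp add: nadj_def ocm_irrefl)

lemma nadj_rev: "nadj (\<lambda>x y. E y x) x y \<longleftrightarrow> nadj E x y" by (auto simp: nadj_def)

lemma ocm_subset: "ocm E V \<Longrightarrow> U \<subseteq> V \<Longrightarrow> ocm E U"
  unfolding ocm_def by (meson finite_subset subsetD)

lemma ocm_rev: "ocm E V \<Longrightarrow> ocm (\<lambda>x y. E y x) V"
  unfolding ocm_def nadj_rev[of E] by blast

lemma col_part:
  assumes "ocm E V" "x \<in> V" "U \<subseteq> V" shows "col E {y\<in>U. nadj E x y} (Suc 0)"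
proof (rule col_indep)
  fix a b assume "a \<in> {y\<in>U. nadj E x y}" "b \<in> {y\<in>U. nadj E x y}"
  then have "nadj E a x" "nadj E x b" "a \<in> V" "b \<in> V" using assms by (auto intro: nadj_sym)
  then show "\<not> E a b" using ocm_trans[OF assms(1), of a x b] assms(2) by (simp add: nadj_def)
qed

section \<open>Domination and bounded sets of large chromatic number\<close>

lemma card_UN_bound:
  assumes "finite I" "\<And>i. i \<in> I \<Longrightarrow> card (A i) \<le> b" "card I \<le> n"
  shows "card (\<Union>i\<in>I. A i) \<le> n * b"
proof -
  have "card (\<Union>i\<in>I. A i) \<le> (\<Sum>i\<in>I. card (A i))" by (rule card_UN_le[OF assms(1)])
  also have "\<dots> \<le> card I * b" using sum_bounded_above[of I "\<lambda>i. card (A i)" b] assms(2) by simp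
  also have "\<dots> \<le> n * b" using assms(3) by simp
  finally show ?thesis .
qed

lemma minimal_card:
  assumes "P (B0 :: 'v set)"
  obtains B where "P B" "\<And>B'. P B' \<Longrightarrow> card B \<le> card B'"
  using ex_has_least_nat[of P B0 card] assms by blast

text \<open>The members play the role of subsets of distinct parts. Indexing them lets an induction
  shrink each member and drop indices.\<close>

definition mp_family :: "('v \<Rightarrow> 'v \<Rightarrow> bool) \<Rightarrow> ('i \<Rightarrow> 'v set) \<Rightarrow> 'i set \<Rightarrow> bool" where
  "mp_family E Q I \<longleftrightarrow> finite I \<and> (\<forall>i\<in>I. finite (Q i)) \<and>
     (\<forall>i\<in>I. \<forall>j\<in>I. i \<noteq> j \<longrightarrow> Q i \<inter> Q j = {} \<and> (\<forall>x\<in>Q i. \<forall>y\<in>Q j. E x y \<or> E y x))"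

definition undominated :: "('v \<Rightarrow> 'v \<Rightarrow> bool) \<Rightarrow> 'v set \<Rightarrow> nat \<Rightarrow> 'v set \<Rightarrow> bool" where
  "undominated E V y P \<longleftrightarrow> (\<forall>Y\<subseteq>V. card Y \<le> y \<longrightarrow> (\<exists>z\<in>P. \<forall>w\<in>Y. \<not> E w z))"

lemma mp_family_subset:
  assumes "mp_family E Q I" "J \<subseteq> I" "\<And>i. i \<in> J \<Longrightarrow> Q' i \<subseteq> Q i"
  shows "mp_family E Q' J"
  unfolding mp_family_def
proof (intro conjI ballI impI)
  have "finite I" using assms(1) unfolding mp_family_def by blast
  then show "finite J" using assms(2) finite_subset by blast
  show "finite (Q' i)" if "i \<in> J" for i
  proof -
    have "finite (Q i)" using that assms(1,2) unfolding mp_family_def by blast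
    then show ?thesis using assms(3)[OF that] finite_subset by blast
  qed
  show "Q' i \<inter> Q' j = {}" if "i \<in> J" "j \<in> J" "i \<noteq> j" for i j
    using that assms unfolding mp_family_def by blast
  show "E x y \<or> E y x" if "i \<in> J" "j \<in> J" "i \<noteq> j" "x \<in> Q' i" "y \<in> Q' j" for i j x y
    using that assms unfolding mp_family_def by blast
qed

text \<open>Each of \<open>N\<close> parts gets its own minimum dominating set \<open>B i\<close>
  and its own \<open>W i\<close>, because the induction hypothesis yields nothing from a single
  part: it needs \<open>n\<close> parts whose private vertices are singled out by one and the same
  colour. The hypothesis is applied twice, to the parts that miss \<open>W i\<close> and to the
  private vertices \<open>P i S\<close>.\<close>

lemma undominated_parts:
  "\<exists>n y l. \<forall>(E :: 'v \<Rightarrow> 'v \<Rightarrow> bool) (Q :: 'i \<Rightarrow> 'v set) I.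
     mp_family E Q I \<longrightarrow> n \<le> card I \<longrightarrow> (\<forall>i\<in>I. undominated E (\<Union>(Q ` I)) y (Q i)) \<longrightarrow>
     (\<exists>A\<subseteq>\<Union>(Q ` I). card A \<le> l \<and> \<not> col E A k)"
proof (induction k)
  case 0
  have base: "\<exists>A\<subseteq>\<Union>(Q ` I). card A \<le> 1 \<and> \<not> col E A 0"
    if I: "1 \<le> card I" and u: "\<forall>i\<in>I. undominated E (\<Union>(Q ` I)) 0 (Q i)"
    for E :: "'v \<Rightarrow> 'v \<Rightarrow> bool" and Q :: "'i \<Rightarrow> 'v set" and I
  proof -
    from I obtain i where i: "i \<in> I" by fastforce
    with u have "\<exists>z\<in>Q i. \<forall>w\<in>{}. \<not> E w z" unfolding undominated_def by (metis card.empty empty_subsetI le0)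
    then obtain z where "z \<in> Q i" by blast
    with i show ?thesis by (intro exI[of _ "{z}"]) auto
  qed
  show ?case by (rule exI[of _ 1], rule exI[of _ 0], rule exI[of _ 1], intro allI impI, rule base)
next
  case (Suc k)
  then obtain n y l where IH: "\<And>(E :: 'v \<Rightarrow> 'v \<Rightarrow> bool) (Q :: 'i \<Rightarrow> 'v set) I.
     mp_family E Q I \<Longrightarrow> n \<le> card I \<Longrightarrow> (\<And>i. i \<in> I \<Longrightarrow> undominated E (\<Union>(Q ` I)) y (Q i)) \<Longrightarrow>
     (\<exists>A\<subseteq>\<Union>(Q ` I). card A \<le> l \<and> \<not> col E A k)" by metis
  \<comment> \<open>Giving up \<open>s\<close> vertices of a minimum dominating set and adding at
    most \<open>l + y\<close> others would make it smaller. With \<open>Suc k\<close> colours,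
    \<open>s\<close> of \<open>w\<close> vertices and \<open>n\<close> of \<open>N\<close> parts
    agree in colour, whence \<open>w\<close> and \<open>N\<close>.\<close>
  define s where "s = l + y + 1"
  define w where "w = Suc k * s"
  define N where "N = Suc k * n"
  define y' where "y' = w + y + 1"
  \<comment> \<open>The last summand pays for the sets \<open>F J' T\<close>, one for each pair of a
    subset of \<open>J\<close> and a subset of the union of the \<open>W i\<close>.\<close>
  define L where "L = N * (w + l) + (2 ^ N * 2 ^ (N * w)) * l"
  have step: "\<exists>A\<subseteq>\<Union>(Q ` I). card A \<le> L \<and> \<not> col E A (Suc k)"
    if mp: "mp_family E Q I" and cI: "N + w + n + 2 \<le> card I"
      and und: "\<forall>i\<in>I. undominated E (\<Union>(Q ` I)) y' (Q i)"
    for E :: "'v \<Rightarrow> 'v \<Rightarrow> bool" and Q :: "'i \<Rightarrow> 'v set" and I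
  proof -
    define V where "V = \<Union>(Q ` I)"
    have finI: "finite I" and finQ: "\<And>i. i \<in> I \<Longrightarrow> finite (Q i)"
      and adj: "\<And>i j x y. i \<in> I \<Longrightarrow> j \<in> I \<Longrightarrow> i \<noteq> j \<Longrightarrow> x \<in> Q i \<Longrightarrow> y \<in> Q j \<Longrightarrow> E x y \<or> E y x"
      and disj: "\<And>i j. i \<in> I \<Longrightarrow> j \<in> I \<Longrightarrow> i \<noteq> j \<Longrightarrow> Q i \<inter> Q j = {}"
      using mp unfolding mp_family_def by blast+
    have finV: "finite V" using finI finQ unfolding V_def by blast
    have und': "\<exists>z\<in>Q i. \<forall>w\<in>Y. \<not> E w z" if "i \<in> I" "Y \<subseteq> V" "card Y \<le> y'" for i Y
      using und that unfolding undominated_def V_def by blast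
    obtain J where J: "J \<subseteq> I" "card J = N"
      using cI by (metis add_leD1 obtain_subset_with_card_n)
    have finJ: "finite J" using J(1) finI finite_subset by blast
    define dom where "dom i Y \<longleftrightarrow> Y \<subseteq> V \<and> (\<forall>z\<in>Q i. \<exists>w\<in>Y. E w z)" for i Y
    define good where "good i B W A0 \<longleftrightarrow> dom i B \<and> (\<forall>B'. dom i B' \<longrightarrow> card B \<le> card B') \<and> W \<subseteq> B \<and> card W = w \<and>
        A0 \<subseteq> \<Union>(Q ` (I - {i})) \<and> card A0 \<le> l \<and> \<not> col E A0 k \<and> (\<forall>a\<in>A0. \<forall>v\<in>W. E a v)" for i B W A0
    have "\<exists>B W A0. good i B W A0"
      if i: "i \<in> I" for i
    proof -
      have "2 \<le> card I" using cI by simp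
      then have "\<not> I \<subseteq> {i}" using card_mono[of "{i}" I] by auto
      then obtain j where j: "j \<in> I" "j \<noteq> i" by blast
      \<comment> \<open>A single vertex \<open>z\<close> of \<open>Q i\<close> does not dominate
        \<open>Q j\<close>; a vertex of \<open>Q j\<close> that it misses is an in-neighbour of
        \<open>z\<close>.\<close>
      have "dom i V" unfolding dom_def
      proof (intro conjI ballI)
        fix z assume z: "z \<in> Q i"
        then have "{z} \<subseteq> V" using i unfolding V_def by blast
        then obtain z' where "z' \<in> Q j" "\<not> E z z'" using und'[OF j(1), of "{z}"] unfolding y'_def by auto
        then show "\<exists>w\<in>V. E w z" using adj[OF i j(1) _ z] j unfolding V_def by blast
      qed simp
      then obtain B where B: "dom i B" "\<And>B'. dom i B' \<Longrightarrow> card B \<le> card B'"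
        using minimal_card[of "dom i" V] by blast
      have "y' < card B"
      proof (rule ccontr)
        assume "\<not> ?thesis"
        then obtain z where "z \<in> Q i" "\<forall>w\<in>B. \<not> E w z"
          using und'[OF i, of B] B(1) unfolding dom_def by auto
        with B(1) show False unfolding dom_def by blast
      qed
      then obtain W where W: "W \<subseteq> B" "card W = w"
        by (metis add_leD1 less_imp_le obtain_subset_with_card_n y'_def)
      have WV: "W \<subseteq> V" using W(1) B(1) unfolding dom_def by blast
      have finW: "finite W" using WV finV finite_subset by blast
      \<comment> \<open>\<open>W\<close> meets at most \<open>w\<close> parts, counted through the
        injection \<open>m\<close>, so at least \<open>n\<close> parts remain for the induction
        hypothesis.\<close>
      define I' where "I' = {j\<in>I. j \<noteq> i \<and> Q j \<inter> W = {}}"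
      define m where "m j = (SOME v. v \<in> Q j \<inter> W)" for j
      have m: "m j \<in> Q j \<inter> W" if "j \<in> I - I'" "j \<noteq> i" for j
        using that someI_ex[of "\<lambda>v. v \<in> Q j \<inter> W"] unfolding I'_def m_def by blast
      have "inj_on m (I - I' - {i})"
      proof (rule inj_onI)
        fix a b assume ab: "a \<in> I - I' - {i}" "b \<in> I - I' - {i}" "m a = m b"
        then have "m a \<in> Q a \<inter> Q b" using m[of a] m[of b] by auto
        then show "a = b" using disj ab by blast
      qed
      then have "card (I - I' - {i}) \<le> w"
        using card_inj_on_le[of m "I - I' - {i}" W] m finW W(2) by blast
      moreover have "card I \<le> card (I - I' - {i}) + card I' + 1"
      proof -
        have "I \<subseteq> (I - I' - {i}) \<union> I' \<union> {i}" by blast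
        then have "card I \<le> card ((I - I' - {i}) \<union> I' \<union> {i})"
          by (rule card_mono[rotated]) (use finI in \<open>auto simp: I'_def\<close>)
        also have "\<dots> \<le> card ((I - I' - {i}) \<union> I') + card {i}" by (rule card_Un_le)
        also have "\<dots> \<le> card (I - I' - {i}) + card I' + card {i}" using card_Un_le by auto
        finally show ?thesis by simp
      qed
      ultimately have cI': "n \<le> card I'" using cI by linarith
      \<comment> \<open>What \<open>W\<close> does not dominate in a part that misses
        \<open>W\<close> is complete to \<open>W\<close>. It stays undominated by \<open>y\<close>
        vertices, since these together with \<open>W\<close> are at most \<open>y'\<close>.\<close>
      define Q' where "Q' j = {z\<in>Q j. \<forall>v\<in>W. \<not> E v z}" for j
      have I'I: "I' \<subseteq> I" unfolding I'_def by blast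
      have "\<exists>A\<subseteq>\<Union>(Q' ` I'). card A \<le> l \<and> \<not> col E A k"
      proof (rule IH[OF _ cI'])
        show "mp_family E Q' I'"
          by (rule mp_family_subset[OF mp I'I]) (auto simp: Q'_def)
        fix j assume j: "j \<in> I'"
        show "undominated E (\<Union> (Q' ` I')) y (Q' j)"
          unfolding undominated_def
        proof (intro allI impI)
          fix Y assume Y: "Y \<subseteq> \<Union> (Q' ` I')" "card Y \<le> y"
          have "card (W \<union> Y) \<le> y'" using card_Un_le[of W Y] W(2) Y(2) unfolding y'_def by linarith
          moreover have "W \<union> Y \<subseteq> V" using WV Y(1) I'I unfolding V_def Q'_def by blast
          ultimately obtain z where "z \<in> Q j" "\<forall>v\<in>W \<union> Y. \<not> E v z" using und'[of j] j I'I by blast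
          then show "\<exists>z\<in>Q' j. \<forall>w\<in>Y. \<not> E w z" unfolding Q'_def by blast
        qed
      qed
      then obtain A0 where A0: "A0 \<subseteq> \<Union>(Q' ` I')" "card A0 \<le> l" "\<not> col E A0 k" by blast
      have "E a v" if av: "a \<in> A0" "v \<in> W" for a v
      proof -
        from av A0(1) obtain j where j: "j \<in> I'" "a \<in> Q' j" by blast
        then have "v \<notin> Q j" using av unfolding I'_def by blast
        moreover obtain j' where "j' \<in> I" "v \<in> Q j'" using av WV unfolding V_def by blast
        ultimately have "E a v \<or> E v a" using adj[of j j' a v] j I'I unfolding Q'_def by blast
        then show ?thesis using j av unfolding Q'_def by blast
      qed
      moreover have "A0 \<subseteq> \<Union>(Q ` (I - {i}))" using A0(1) unfolding I'_def Q'_def by blast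
      ultimately show ?thesis using B W A0 unfolding good_def by blast
    qed
    then obtain B W A0 where "\<And>i. i \<in> I \<Longrightarrow> good i (B i) (W i) (A0 i)" by metis
    then have
      B: "\<And>i. i \<in> I \<Longrightarrow> dom i (B i)" "\<And>i B'. i \<in> I \<Longrightarrow> dom i B' \<Longrightarrow> card (B i) \<le> card B'"
      and W: "\<And>i. i \<in> I \<Longrightarrow> W i \<subseteq> B i" "\<And>i. i \<in> I \<Longrightarrow> card (W i) = w"
      and A0: "\<And>i. i \<in> I \<Longrightarrow> A0 i \<subseteq> \<Union>(Q ` (I - {i}))" "\<And>i. i \<in> I \<Longrightarrow> card (A0 i) \<le> l"
        "\<And>i. i \<in> I \<Longrightarrow> \<not> col E (A0 i) k" "\<And>i a v. i \<in> I \<Longrightarrow> a \<in> A0 i \<Longrightarrow> v \<in> W i \<Longrightarrow> E a v"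
      unfolding good_def by blast+
    \<comment> \<open>Private vertices: their in-neighbours in \<open>B i\<close> all lie in
      \<open>S\<close>. As \<open>A0 i\<close> lies in other parts and does not dominate them, they
      are complete to \<open>A0 i\<close>.\<close>
    define P where "P i S = {z\<in>Q i. (\<forall>b\<in>B i - S. \<not> E b z) \<and> (\<forall>a\<in>A0 i. \<not> E a z)}" for i S
    have BV: "B i \<subseteq> V" if "i \<in> I" for i using B(1)[OF that] unfolding dom_def by blast
    have A0V: "A0 i \<subseteq> V" if "i \<in> I" for i using A0(1)[OF that] unfolding V_def by blast
    have P_in: "\<exists>b\<in>S. E b z" and P_out: "\<And>a. a \<in> A0 i \<Longrightarrow> E z a"
      if "i \<in> I" "z \<in> P i S" for i S z
    proof -
      show "\<exists>b\<in>S. E b z" using B(1)[OF that(1)] that(2) unfolding dom_def P_def by blast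
      fix a assume a: "a \<in> A0 i"
      with A0(1)[OF that(1)] obtain j where "j \<in> I" "j \<noteq> i" "a \<in> Q j" by blast
      then show "E z a" using adj[of i j z a] that a unfolding P_def by blast
    qed
    \<comment> \<open>\<open>T\<close> will be the set of all vertices of one colour in the union of
      the \<open>W i\<close>, and \<open>J'\<close> a set of \<open>n\<close> indices where this
      colour is frequent.\<close>
    define ok where "ok J' T \<longleftrightarrow> J' \<subseteq> J \<and> card J' = n \<and> T \<subseteq> (\<Union>i\<in>J. W i) \<and> (\<forall>i\<in>J'. s \<le> card (T \<inter> W i))" for J' T
    define fine where "fine J' T A \<longleftrightarrow> A \<subseteq> (\<Union>i\<in>J'. P i (T \<inter> W i)) \<and> card A \<le> l \<and> \<not> col E A k" for J' T A
    have "\<exists>A. fine J' T A" if ok: "ok J' T" for J' T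
      unfolding fine_def
    proof (rule IH)
      have J': "J' \<subseteq> I" using ok J(1) unfolding ok_def by blast
      show "mp_family E (\<lambda>i. P i (T \<inter> W i)) J'"
        by (rule mp_family_subset[OF mp J']) (auto simp: P_def)
      show "n \<le> card J'" using ok unfolding ok_def by blast
      fix i assume i: "i \<in> J'"
      then have iI: "i \<in> I" using J' by blast
      show "undominated E (\<Union>i\<in>J'. P i (T \<inter> W i)) y (P i (T \<inter> W i))"
        unfolding undominated_def
      proof (intro allI impI)
        fix Y assume Y: "Y \<subseteq> (\<Union>i\<in>J'. P i (T \<inter> W i))" "card Y \<le> y"
        have YV: "Y \<subseteq> V" using Y(1) J' unfolding P_def V_def by blast
        let ?S = "T \<inter> W i" and ?B' = "(B i - T \<inter> W i) \<union> A0 i \<union> Y"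
        have finB: "finite (B i)" using BV[OF iI] finV finite_subset by blast
        have sub: "?S \<subseteq> B i" using W(1)[OF iI] by blast
        have "card ?B' \<le> card (B i - ?S) + card (A0 i) + card Y"
          by (meson add_le_mono card_Un_le le_refl order_trans)
        also have "card (B i - ?S) = card (B i) - card ?S"
          using sub finB finite_subset by (intro card_Diff_subset) blast+
        also have "card (B i) - card ?S + card (A0 i) + card Y < card (B i)"
        proof -
          have "card ?S \<le> card (B i)" using sub finB card_mono by blast
          moreover have "l + y + 1 \<le> card ?S" using ok i unfolding ok_def s_def by blast
          ultimately show ?thesis using A0(2)[OF iI] Y(2) by linarith
        qed
        finally have "\<not> dom i ?B'" using B(2)[OF iI, of ?B'] by linarith
        moreover have "?B' \<subseteq> V" using BV[OF iI] A0V[OF iI] YV by blast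
        ultimately obtain z where "z \<in> Q i" "\<forall>b\<in>?B'. \<not> E b z" unfolding dom_def by blast
        then show "\<exists>z\<in>P i (T \<inter> W i). \<forall>w\<in>Y. \<not> E w z" unfolding P_def by blast
      qed
    qed
    then obtain F where "\<And>J' T. ok J' T \<Longrightarrow> fine J' T (F J' T)" by metis
    then have F: "\<And>J' T. ok J' T \<Longrightarrow> F J' T \<subseteq> (\<Union>i\<in>J'. P i (T \<inter> W i))"
      "\<And>J' T. ok J' T \<Longrightarrow> card (F J' T) \<le> l" "\<And>J' T. ok J' T \<Longrightarrow> \<not> col E (F J' T) k"
      unfolding fine_def by blast+
    define X where "X = {(J', T). ok J' T}"
    define A where "A = (\<Union>i\<in>J. W i \<union> A0 i) \<union> (\<Union>p\<in>X. F (fst p) (snd p))"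
    have WV: "W i \<subseteq> V" if "i \<in> I" for i using W(1) BV that by blast
    have AV: "A \<subseteq> V"
    proof -
      have "F (fst p) (snd p) \<subseteq> V" if "p \<in> X" for p
      proof -
        have ok: "ok (fst p) (snd p)" using that unfolding X_def by (simp add: case_prod_beta)
        then have "fst p \<subseteq> I" using J(1) unfolding ok_def by blast
        moreover have "P i S \<subseteq> V" if "i \<in> I" for i S using that unfolding P_def V_def by blast
        ultimately show ?thesis using F(1)[OF ok] by blast
      qed
      then show ?thesis using WV A0V J(1) unfolding A_def by blast
    qed
    let ?WW = "\<Union>i\<in>J. W i"
    have cWW: "card ?WW \<le> N * w" by (rule card_UN_bound[OF finJ]) (use W(2) J in auto)
    have finWW: "finite ?WW" using WV J(1) finV finite_subset[of ?WW V] by blast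
    have XS: "X \<subseteq> Pow J \<times> Pow ?WW" unfolding X_def ok_def by auto
    have finX: "finite X" using XS finJ finWW finite_subset by blast
    have "card X \<le> card (Pow J \<times> Pow ?WW)" using XS finJ finWW by (intro card_mono) auto
    also have "\<dots> = 2 ^ N * 2 ^ card ?WW" using finJ finWW J(2) by (simp add: card_cartesian_product card_Pow)
    also have "\<dots> \<le> 2 ^ N * 2 ^ (N * w)" using cWW by simp
    finally have cX: "card X \<le> 2 ^ N * 2 ^ (N * w)" .
    have "card A \<le> L"
    proof -
      have "card (\<Union>i\<in>J. W i \<union> A0 i) \<le> N * (w + l)"
      proof (rule card_UN_bound[OF finJ])
        fix i assume "i \<in> J"
        then show "card (W i \<union> A0 i) \<le> w + l" using card_Un_le[of "W i" "A0 i"] W(2)[of i] A0(2)[of i] J(1) by fastforce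
      qed (use J in auto)
      moreover have "card (\<Union>p\<in>X. F (fst p) (snd p)) \<le> (2 ^ N * 2 ^ (N * w)) * l"
        by (rule card_UN_bound[OF finX _ cX]) (simp add: X_def case_prod_beta F(2))
      ultimately show ?thesis unfolding A_def L_def
        by (meson add_le_mono card_Un_le order_trans)
    qed
    moreover have "\<not> col E A (Suc k)"
    proof
      assume "col E A (Suc k)"
      then obtain f where f: "is_colouring E A (Suc k) f" unfolding col_def by blast
      have fA: "f v < Suc k" if "v \<in> A" for v using f that unfolding is_colouring_def by blast
      have "\<exists>a<Suc k. s \<le> card {v\<in>W i. f v = a}" if i: "i \<in> J" for i
      proof (rule majority_class)
        show "finite (W i)" using WV J(1) i finV finite_subset by blast
        show "f v < Suc k" if "v \<in> W i" for v using fA that i unfolding A_def by blast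
        show "Suc k * s \<le> card (W i)" using W(2) i J(1) unfolding w_def by fastforce
      qed (auto simp: s_def)
      then obtain c where c: "\<And>i. i \<in> J \<Longrightarrow> c i < Suc k" "\<And>i. i \<in> J \<Longrightarrow> s \<le> card {v\<in>W i. f v = c i}"
        by metis
      obtain a J' where a: "a < Suc k" "J' \<subseteq> J" "card J' = n" "\<And>i. i \<in> J' \<Longrightarrow> c i = a"
      proof (cases "n = 0")
        case True
        then show ?thesis using that[of 0 "{}"] by auto
      next
        case False
        then obtain a where "a < Suc k" "n \<le> card {i\<in>J. c i = a}"
          using majority_class[of J c "Suc k" n] finJ c(1) J(2) unfolding N_def by auto
        moreover then obtain J' where "J' \<subseteq> {i\<in>J. c i = a}" "card J' = n"
          using obtain_subset_with_card_n by metis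
        ultimately show ?thesis using that[of a J'] by auto
      qed
      define T where "T = {v\<in>?WW. f v = a}"
      have "s \<le> card (T \<inter> W i)" if "i \<in> J'" for i
      proof -
        have i: "i \<in> J" "c i = a" using that a(2,4) by auto
        then have "T \<inter> W i = {v\<in>W i. f v = c i}" unfolding T_def by auto
        then show ?thesis using c(2)[OF i(1)] by simp
      qed
      then have ok: "ok J' T" using a unfolding ok_def T_def by blast
      have "(J', T) \<in> X" using ok unfolding X_def by simp
      then have FA: "F J' T \<subseteq> A" unfolding A_def by force
      obtain z where z: "z \<in> F J' T" "f z = a"
        using colour_used[OF is_colouring_subset[OF f FA] F(3)[OF ok] a(1)] by blast
      then obtain i where i: "i \<in> J'" "z \<in> P i (T \<inter> W i)" using F(1)[OF ok] by blast
      have iJ: "i \<in> J" "i \<in> I" using i(1) a(2) J(1) by blast+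
      obtain b where b: "b \<in> T \<inter> W i" "E b z" using P_in[OF iJ(2) i(2)] by blast
      have A0A: "A0 i \<subseteq> A" using iJ unfolding A_def by blast
      obtain d where d: "d \<in> A0 i" "f d = a"
        using colour_used[OF is_colouring_subset[OF f A0A] A0(3)[OF iJ(2)] a(1)] by blast
      show False
      proof (rule is_colouring_no_triangle[OF f])
        show "b \<in> A" using b iJ unfolding A_def by blast
        show "z \<in> A" using z FA by blast
        show "d \<in> A" using d A0A by blast
        show "f z = f b" "f d = f b" using z d b unfolding T_def by auto
        show "E b z" by fact
        show "E z d" using P_out[OF iJ(2) i(2) d(1)] .
        show "E d b" using A0(4)[OF iJ(2) d(1)] b by blast
      qed
    qed
    ultimately show ?thesis using AV unfolding V_def by blast
  qed
  show ?case
    by (rule exI[of _ "N + w + n + 2"], rule exI[of _ y'], rule exI[of _ L], intro allI impI, rule step)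
qed

text \<open>The set \<open>Q\<close> stands for the parts of its elements.\<close>
definition covered :: "('v \<Rightarrow> 'v \<Rightarrow> bool) \<Rightarrow> 'v set \<Rightarrow> nat \<Rightarrow> bool" where
  "covered E V m \<longleftrightarrow> (\<exists>B Q. B \<subseteq> V \<and> Q \<subseteq> V \<and> card B + card Q \<le> m \<and>
     (\<forall>x\<in>V. (\<exists>b\<in>B. E b x) \<or> (\<exists>q\<in>Q. nadj E q x)))"

lemma undominated_subset: "undominated E V y P \<Longrightarrow> U \<subseteq> V \<Longrightarrow> undominated E U y P"
  unfolding undominated_def by (meson order_trans)

text \<open>By \<open>parts\<close> and \<open>none\<close>, fewer than \<open>n\<close> parts
  resist domination by \<open>y\<close> vertices. They are set aside through representatives
  \<open>R\<close>; in the rest \<open>V1\<close> the part of \<open>x\<close> is dominated by the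
  small set \<open>D x\<close>. These sets stand in for parts whenever a dominating set of
  \<open>V1\<close> has to be built.\<close>

lemma uncovered_imp_step:
  fixes E :: "'v \<Rightarrow> 'v \<Rightarrow> bool"
  assumes parts: "\<And>(Q :: 'v \<Rightarrow> 'v set) I. mp_family E Q I \<Longrightarrow> n \<le> card I \<Longrightarrow>
       (\<And>i. i \<in> I \<Longrightarrow> undominated E (\<Union>(Q ` I)) y (Q i)) \<Longrightarrow>
       (\<exists>A\<subseteq>\<Union>(Q ` I). card A \<le> l0 \<and> \<not> col E A k)"
    and none: "\<not> (\<exists>A\<subseteq>V. card A \<le> l0 \<and> \<not> col E A k)"
    and IH: "\<And>U. U \<subseteq> V \<Longrightarrow> \<not> covered E U K \<Longrightarrow> \<exists>A\<subseteq>U. card A \<le> l \<and> \<not> col E A j"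
    and s: "s = l + K + y * (K + l) + 1" and w: "w = Suc j * s"
    and V: "ocm E V" and unc: "\<not> covered E V (K + 2 * w + n)"
  shows "\<exists>A\<subseteq>V. card A \<le> w + l + 2 ^ w * l \<and> \<not> col E A (Suc j)"
proof -
  have finV: "finite V" using V by (rule ocm_finite)
  define part where "part x = {z\<in>V. nadj E x z}" for x
  define bad where "bad x \<longleftrightarrow> x \<in> V \<and> undominated E V y (part x)" for x
  define indp where "indp R \<longleftrightarrow> R \<subseteq> Collect bad \<and> (\<forall>a\<in>R. \<forall>b\<in>R. a \<noteq> b \<longrightarrow> \<not> nadj E a b)" for R
  have "indp {}" unfolding indp_def by simp
  moreover have "card R < Suc (card V)" if "indp R" for R
    using that finV card_mono[of V R] unfolding indp_def bad_def by force
  ultimately obtain R where R: "indp R" "\<And>R'. indp R' \<Longrightarrow> card R' \<le> card R"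
    using ex_has_greatest_nat[of indp "{}" card "Suc (card V)"] by (metis less_imp_le)
  have RV: "R \<subseteq> V" using R(1) unfolding indp_def bad_def by blast
  have finR: "finite R" using finite_subset[OF RV finV] .
  have cR: "card R < n"
  proof (rule ccontr)
    assume "\<not> ?thesis"
    then have n: "n \<le> card R" by simp
    have "\<exists>A\<subseteq>\<Union>(part ` R). card A \<le> l0 \<and> \<not> col E A k"
    proof (rule parts[OF _ n])
      show "mp_family E part R"
        unfolding mp_family_def
      proof (intro conjI ballI impI)
        show "finite R" by fact
        show "finite (part i)" for i unfolding part_def using finV by simp
        fix a b assume ab: "a \<in> R" "b \<in> R" "a \<noteq> b"
        have no: "\<not> nadj E x z" if "x \<in> part a" "z \<in> part b" for x z
        proof
          assume "nadj E x z"
          then have "nadj E a z" using ocm_trans[OF V, of a x z] that ab RV unfolding part_def by blast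
          then have "nadj E a b" using ocm_trans[OF V, of a z b] nadj_sym[of E b z] that ab RV unfolding part_def by blast
          then show False using R(1) ab unfolding indp_def by blast
        qed
        show "part a \<inter> part b = {}" using no nadj_refl[OF V] unfolding part_def by blast
        show "E x z \<or> E z x" if "x \<in> part a" "z \<in> part b" for x z
          using no[OF that] unfolding nadj_def by blast
      qed
      fix i assume "i \<in> R"
      then have "undominated E V y (part i)" using R(1) unfolding indp_def bad_def by blast
      then show "undominated E (\<Union>(part ` R)) y (part i)"
        by (rule undominated_subset) (auto simp: part_def)
    qed
    moreover have "\<Union>(part ` R) \<subseteq> V" unfolding part_def by blast
    ultimately show False using none by blast
  qed
  define V1 where "V1 = {x\<in>V. \<forall>r\<in>R. \<not> nadj E r x}"
  have "\<exists>Y\<subseteq>V. card Y \<le> y \<and> (\<forall>z\<in>part x. \<exists>v\<in>Y. E v z)" if x: "x \<in> V1" for x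
  proof -
    have "\<not> bad x"
    proof
      assume b: "bad x"
      have "indp (insert x R)" unfolding indp_def
        using b R(1) x nadj_sym[of E x] unfolding indp_def V1_def by auto
      moreover have "x \<notin> R" using x nadj_refl[OF V, of x] unfolding V1_def by blast
      ultimately show False using R(2)[of "insert x R"] finR by simp
    qed
    then have "\<not> undominated E V y (part x)" using x unfolding bad_def V1_def by simp
    then obtain Y where "Y \<subseteq> V" "card Y \<le> y" "\<forall>z\<in>part x. \<exists>v\<in>Y. E v z"
      unfolding undominated_def by auto
    then show ?thesis by blast
  qed
  then obtain D where D: "\<And>x. x \<in> V1 \<Longrightarrow> D x \<subseteq> V" "\<And>x. x \<in> V1 \<Longrightarrow> card (D x) \<le> y"
    "\<And>x z. x \<in> V1 \<Longrightarrow> z \<in> part x \<Longrightarrow> \<exists>v\<in>D x. E v z" by metis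
  define dom where "dom B \<longleftrightarrow> B \<subseteq> V \<and> (\<forall>x\<in>V1. \<exists>b\<in>B. E b x)" for B
  have "dom V" unfolding dom_def
  proof (intro conjI ballI)
    fix x assume x: "x \<in> V1"
    then have "x \<in> part x" unfolding part_def V1_def using nadj_refl[OF V] by blast
    then show "\<exists>b\<in>V. E b x" using D(1,3)[OF x] by blast
  qed simp
  then obtain B where B: "dom B" "\<And>B'. dom B' \<Longrightarrow> card B \<le> card B'"
    using minimal_card[of dom V] by blast
  have BV: "B \<subseteq> V" using B(1) unfolding dom_def by blast
  have finB: "finite B" using finite_subset[OF BV finV] .
  have "w \<le> card B"
  proof (rule ccontr)
    assume "\<not> ?thesis"
    then have "card B + card R \<le> K + 2 * w + n" using cR by simp
    moreover have "\<forall>x\<in>V. (\<exists>b\<in>B. E b x) \<or> (\<exists>q\<in>R. nadj E q x)"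
      using B(1) unfolding dom_def V1_def by blast
    ultimately have "covered E V (K + 2 * w + n)" using BV RV unfolding covered_def by metis
    with unc show False ..
  qed
  then obtain W where W: "W \<subseteq> B" "card W = w" by (meson obtain_subset_with_card_n)
  have WV: "W \<subseteq> V" using W BV by blast
  have finW: "finite W" using finite_subset[OF W(1) finB] .
  define U0 where "U0 = {x\<in>V. \<forall>v\<in>W. E x v}"
  \<comment> \<open>A vertex outside \<open>U0\<close> has an in-neighbour or a non-neighbour in
    \<open>W\<close>. So \<open>W\<close> is charged twice, as dominators and as representatives of
    parts, which explains \<open>2 * w\<close>.\<close>
  have "\<not> covered E U0 K"
  proof
    assume "covered E U0 K"
    then obtain B' Q' where BQ: "B' \<subseteq> U0" "Q' \<subseteq> U0" "card B' + card Q' \<le> K"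
      "\<forall>x\<in>U0. (\<exists>b\<in>B'. E b x) \<or> (\<exists>q\<in>Q'. nadj E q x)" unfolding covered_def by blast
    have "card (B' \<union> W) + card (Q' \<union> W) \<le> K + 2 * w + n"
      using card_Un_le[of B' W] card_Un_le[of Q' W] W(2) BQ(3) by linarith
    moreover have "\<forall>x\<in>V. (\<exists>b\<in>B' \<union> W. E b x) \<or> (\<exists>q\<in>Q' \<union> W. nadj E q x)"
      using BQ(4) unfolding U0_def nadj_def by blast
    moreover have "B' \<union> W \<subseteq> V" "Q' \<union> W \<subseteq> V" using BQ(1,2) WV unfolding U0_def by blast+
    ultimately have "covered E V (K + 2 * w + n)" unfolding covered_def by metis
    with unc show False ..
  qed
  then obtain A0 where A0: "A0 \<subseteq> U0" "card A0 \<le> l" "\<not> col E A0 j"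
    using IH[of U0] unfolding U0_def by blast
  have A0V: "A0 \<subseteq> V" using A0(1) unfolding U0_def by blast
  have finA0: "finite A0" using finite_subset[OF A0V finV] .
  define X where "X T = {x\<in>V1. (\<forall>b\<in>B - T. \<not> E b x) \<and> (\<forall>a\<in>A0. E x a)}" for T
  have XV: "X T \<subseteq> V1" "X T \<subseteq> V" for T unfolding X_def V1_def by blast+
  have "\<exists>A\<subseteq>X T. card A \<le> l \<and> \<not> col E A j" if T: "T \<subseteq> W" "s \<le> card T" for T
  proof (rule IH[OF XV(2)], rule notI)
    assume "covered E (X T) K"
    then obtain B' Q' where BQ: "B' \<subseteq> X T" "Q' \<subseteq> X T" "card B' + card Q' \<le> K"
      "\<forall>x\<in>X T. (\<exists>b\<in>B'. E b x) \<or> (\<exists>q\<in>Q'. nadj E q x)" unfolding covered_def by blast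
    have QV1: "Q' \<subseteq> V1" using BQ(2) XV by blast
    have finQ: "finite Q'" using finite_subset[OF subset_trans[OF BQ(2) XV(2)] finV] .
    \<comment> \<open>This would replace \<open>B\<close>: the vertices of \<open>T\<close> are
      traded for \<open>A0\<close>, \<open>B'\<close> and at most \<open>y\<close> vertices for each
      part met by \<open>Q'\<close> or by \<open>A0 \<inter> V1\<close>. The constant
      \<open>s\<close> exceeds that price.\<close>
    let ?C = "(B - T) \<union> A0 \<union> B' \<union> (\<Union>q\<in>Q'. D q) \<union> (\<Union>a\<in>A0 \<inter> V1. D a)"
    have "dom ?C" unfolding dom_def
    proof (intro conjI ballI)
      show "?C \<subseteq> V" using BV A0V BQ(1) XV(2) D(1) QV1 by blast
      fix x assume x: "x \<in> V1"
      then have xV: "x \<in> V" unfolding V1_def by blast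
      consider "\<exists>b\<in>B - T. E b x" | a where "a \<in> A0" "\<not> E x a" | "x \<in> X T"
        using x unfolding X_def by blast
      then show "\<exists>b\<in>?C. E b x"
      proof cases
        case 1 then show ?thesis by blast
      next
        case (2 a)
        show ?thesis
        proof (cases "E a x")
          case True then show ?thesis using 2 by blast
        next
          case False
          with 2 have na: "nadj E a x" unfolding nadj_def by blast
          have aV: "a \<in> V" using 2 A0V by blast
          have "\<not> nadj E r a" if "r \<in> R" for r
            using ocm_trans[OF V, of r a x] that RV aV xV na x unfolding V1_def by blast
          then have a1: "a \<in> V1" using aV unfolding V1_def by blast
          moreover have "x \<in> part a" using na xV unfolding part_def by blast
          ultimately obtain v where "v \<in> D a" "E v x" using D(3) by blast
          then show ?thesis using 2 a1 by blast
        qed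
      next
        case 3
        with BQ(4) consider "\<exists>b\<in>B'. E b x" | q where "q \<in> Q'" "nadj E q x" by blast
        then show ?thesis
        proof cases
          case (2 q)
          then have "x \<in> part q" using xV unfolding part_def by blast
          then obtain v where "v \<in> D q" "E v x" using D(3) QV1 2 by blast
          then show ?thesis using 2 by blast
        qed blast
      qed
    qed
    then have "card B \<le> card ?C" using B(2) by blast
    also have "card ?C \<le> card (B - T) + card A0 + card B' + card (\<Union>q\<in>Q'. D q) + card (\<Union>a\<in>A0 \<inter> V1. D a)"
      by (meson add_le_mono card_Un_le le_refl order_trans)
    also have "card (\<Union>q\<in>Q'. D q) \<le> K * y"
      by (rule card_UN_bound[OF finQ]) (use D(2) QV1 BQ(3) in auto)
    also have "card (\<Union>a\<in>A0 \<inter> V1. D a) \<le> l * y"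
    proof (rule card_UN_bound)
      show "card (A0 \<inter> V1) \<le> l" using card_mono[of A0 "A0 \<inter> V1"] finA0 A0(2) by auto
    qed (use D(2) finA0 in auto)
    also have "card (B - T) = card B - card T"
      using T(1) W(1) finB by (intro card_Diff_subset) (auto intro: finite_subset)
    finally have "card B \<le> card B - card T + card A0 + card B' + K * y + l * y" by simp
    moreover have "card T \<le> card B" using T(1) W(1) finB by (intro card_mono) auto
    ultimately have "card T \<le> l + K + K * y + l * y" using A0(2) BQ(3) by linarith
    then show False using T(2) s by (simp add: algebra_simps)
  qed
  then obtain F where F: "\<And>T. T \<subseteq> W \<Longrightarrow> s \<le> card T \<Longrightarrow> F T \<subseteq> X T"
    "\<And>T. T \<subseteq> W \<Longrightarrow> s \<le> card T \<Longrightarrow> card (F T) \<le> l"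
    "\<And>T. T \<subseteq> W \<Longrightarrow> s \<le> card T \<Longrightarrow> \<not> col E (F T) j" by metis
  have FV: "F T \<subseteq> V" if "T \<subseteq> W" "s \<le> card T" for T using F(1)[OF that] XV(2) by (rule subset_trans)
  define TT where "TT = {T\<in>Pow W. s \<le> card T}"
  define A where "A = W \<union> A0 \<union> (\<Union>T\<in>TT. F T)"
  have finTT: "finite TT" unfolding TT_def using finW by simp
  have AV: "A \<subseteq> V" using WV A0V FV unfolding A_def TT_def by auto
  moreover have "card A \<le> w + l + 2 ^ w * l"
  proof -
    have "card TT \<le> card (Pow W)" unfolding TT_def using finW by (intro card_mono) auto
    then have "card TT \<le> 2 ^ w" using finW W(2) by (simp add: card_Pow)
    then have "card (\<Union>T\<in>TT. F T) \<le> 2 ^ w * l"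
      by (intro card_UN_bound finTT) (use F(2) in \<open>auto simp: TT_def\<close>)
    moreover have "card A \<le> card W + card A0 + card (\<Union>T\<in>TT. F T)"
      unfolding A_def by (meson add_le_mono card_Un_le le_refl order_trans)
    ultimately show ?thesis using W(2) A0(2) by linarith
  qed
  moreover have "\<not> col E A (Suc j)"
  proof
    assume "col E A (Suc j)"
    then obtain f where f: "is_colouring E A (Suc j) f" unfolding col_def by blast
    have "\<exists>a<Suc j. s \<le> card {v\<in>W. f v = a}"
    proof (rule majority_class[OF finW])
      show "f v < Suc j" if "v \<in> W" for v using f that unfolding is_colouring_def A_def by blast
    qed (use W(2) w s in auto)
    then obtain a where a: "a < Suc j" "s \<le> card {v\<in>W. f v = a}" by blast
    define T where "T = {v\<in>W. f v = a}"
    have T: "T \<subseteq> W" "s \<le> card T" using a unfolding T_def by auto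
    then have FA: "F T \<subseteq> A" unfolding A_def TT_def by blast
    obtain z where z: "z \<in> F T" "f z = a"
      using colour_used[OF is_colouring_subset[OF f FA] F(3)[OF T] a(1)] by blast
    have zX: "z \<in> X T" using z F(1)[OF T] by blast
    obtain b where b: "b \<in> B" "E b z" using zX B(1) unfolding X_def dom_def by blast
    then have bT: "b \<in> T" using zX unfolding X_def by blast
    have A0A: "A0 \<subseteq> A" unfolding A_def by blast
    obtain d where d: "d \<in> A0" "f d = a"
      using colour_used[OF is_colouring_subset[OF f A0A] A0(3) a(1)] by blast
    show False
    proof (rule is_colouring_no_triangle[OF f])
      show "b \<in> A" using bT unfolding A_def T_def by blast
      show "z \<in> A" using z FA by blast
      show "d \<in> A" using d A0A by blast
      show "f z = f b" "f d = f b" using z d bT unfolding T_def by auto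
      show "E b z" by fact
      show "E z d" using zX d unfolding X_def by blast
      show "E d b" using d A0(1) bT T(1) unfolding U0_def by blast
    qed
  qed
  ultimately show ?thesis by blast
qed

text \<open>\<open>small\<close> splits off the case in which the wanted set is already present with
  at most \<open>l0\<close> vertices, the bound that \<open>undominated_parts\<close> yields. Its
  negation passes to subsets, so the induction on \<open>j\<close> can carry it along while
  \<open>k\<close> stays fixed.\<close>

lemma uncovered_imp_bounded_chromatic:
  "\<exists>K l. \<forall>(E :: 'v \<Rightarrow> 'v \<Rightarrow> bool) V. ocm E V \<longrightarrow> \<not> covered E V K \<longrightarrow>
     (\<exists>A\<subseteq>V. card A \<le> l \<and> \<not> col E A k)"
proof -
  obtain n y l0 where parts: "\<And>(E :: 'v \<Rightarrow> 'v \<Rightarrow> bool) (Q :: 'v \<Rightarrow> 'v set) I. mp_family E Q I \<Longrightarrow> n \<le> card I \<Longrightarrow>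
       (\<And>i. i \<in> I \<Longrightarrow> undominated E (\<Union>(Q ` I)) y (Q i)) \<Longrightarrow>
       (\<exists>A\<subseteq>\<Union>(Q ` I). card A \<le> l0 \<and> \<not> col E A k)"
    using undominated_parts[of k] by metis
  define small where "small E V \<longleftrightarrow> (\<exists>A\<subseteq>V. card A \<le> l0 \<and> \<not> col E A k)" for E :: "'v \<Rightarrow> 'v \<Rightarrow> bool" and V
  have "\<exists>K l. \<forall>(E :: 'v \<Rightarrow> 'v \<Rightarrow> bool) V. ocm E V \<longrightarrow> \<not> small E V \<longrightarrow> \<not> covered E V K \<longrightarrow>
     (\<exists>A\<subseteq>V. card A \<le> l \<and> \<not> col E A j)" for j
  proof (induction j)
    case 0
    have "\<exists>A\<subseteq>V. card A \<le> 1 \<and> \<not> col E A 0" if "\<not> covered E V 0" for E :: "'v \<Rightarrow> 'v \<Rightarrow> bool" and V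
    proof -
      have "V \<noteq> {}" using that unfolding covered_def by auto
      then obtain x where "x \<in> V" by blast
      then show ?thesis by (intro exI[of _ "{x}"]) auto
    qed
    then show ?case by metis
  next
    case (Suc j)
    then obtain K l where IH: "\<And>(E :: 'v \<Rightarrow> 'v \<Rightarrow> bool) V. ocm E V \<Longrightarrow> \<not> small E V \<Longrightarrow> \<not> covered E V K \<Longrightarrow>
     (\<exists>A\<subseteq>V. card A \<le> l \<and> \<not> col E A j)" by metis
    define s where "s = l + K + y * (K + l) + 1"
    define w where "w = Suc j * s"
    have step: "\<exists>A\<subseteq>V. card A \<le> w + l + 2 ^ w * l \<and> \<not> col E A (Suc j)"
      if V: "ocm E V" and small: "\<not> small E V" and unc: "\<not> covered E V (K + 2 * w + n)"
      for E :: "'v \<Rightarrow> 'v \<Rightarrow> bool" and V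
    proof (rule uncovered_imp_step[OF _ _ _ s_def w_def V unc])
      show "\<exists>A\<subseteq>\<Union>(Q ` I). card A \<le> l0 \<and> \<not> col E A k"
        if "mp_family E Q I" "n \<le> card I" "\<And>i. i \<in> I \<Longrightarrow> undominated E (\<Union>(Q ` I)) y (Q i)"
        for Q :: "'v \<Rightarrow> 'v set" and I using parts that by blast
      show "\<not> (\<exists>A\<subseteq>V. card A \<le> l0 \<and> \<not> col E A k)" using small unfolding small_def .
      show "\<exists>A\<subseteq>U. card A \<le> l \<and> \<not> col E A j" if U: "U \<subseteq> V" and "\<not> covered E U K" for U
      proof (rule IH)
        show "ocm E U" using V U by (rule ocm_subset)
        show "\<not> small E U" using small U unfolding small_def by blast
      qed fact
    qed
    show ?case
      by (rule exI[of _ "K + 2 * w + n"], rule exI[of _ "w + l + 2 ^ w * l"], intro allI impI, rule step)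
  qed
  then obtain K l where Kl: "\<And>(E :: 'v \<Rightarrow> 'v \<Rightarrow> bool) V. ocm E V \<Longrightarrow> \<not> small E V \<Longrightarrow> \<not> covered E V K \<Longrightarrow>
     (\<exists>A\<subseteq>V. card A \<le> l \<and> \<not> col E A k)" by metis
  have "\<exists>A\<subseteq>V. card A \<le> max l l0 \<and> \<not> col E A k" if "ocm E V" "\<not> covered E V K" for E :: "'v \<Rightarrow> 'v \<Rightarrow> bool" and V
    using Kl[OF that(1) _ that(2)] unfolding small_def by (meson max.coboundedI1 max.coboundedI2)
  then show ?thesis by blast
qed

lemma covered_col:
  assumes V: "ocm E V" and "covered E V K" and t: "\<And>v. v \<in> V \<Longrightarrow> col E {x\<in>V. E v x} t"
  shows "col E V (K * Suc t)"
proof -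
  from assms obtain B Q where BQ: "B \<subseteq> V" "Q \<subseteq> V" "card B + card Q \<le> K"
    "\<forall>x\<in>V. (\<exists>b\<in>B. E b x) \<or> (\<exists>q\<in>Q. nadj E q x)" unfolding covered_def by blast
  have fin: "finite B" "finite Q" using BQ(1,2) ocm_finite[OF V] finite_subset by blast+
  have B: "col E (\<Union>b\<in>B. {x\<in>V. E b x}) (card B * t)"
    by (rule col_UN_le[OF fin(1) order_refl]) (use t BQ(1) in blast)
  have Q: "col E (\<Union>q\<in>Q. {x\<in>V. nadj E q x}) (card Q * Suc 0)"
    by (rule col_UN_le[OF fin(2) order_refl]) (use col_part[OF V] BQ(2) in blast)
  show ?thesis
  proof (rule col_Un_le[OF B Q])
    show "V \<subseteq> (\<Union>b\<in>B. {x\<in>V. E b x}) \<union> (\<Union>q\<in>Q. {x\<in>V. nadj E q x})" using BQ(4) by blast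
    have "card B * t + card Q * Suc 0 \<le> card B * Suc t + card Q * Suc t" by simp
    also have "\<dots> = (card B + card Q) * Suc t" by (simp add: algebra_simps)
    also have "\<dots> \<le> K * Suc t" by (rule mult_le_mono1[OF BQ(3)])
    finally show "card B * t + card Q * Suc 0 \<le> K * Suc t" .
  qed
qed

text \<open>If \<open>V\<close> is not covered, it has a bounded set that is not
  (\<open>t + 1\<close>)-colourable. Such a set does not fit into the out-neighbourhood and the part
  of any vertex \<open>x\<close>, so \<open>x\<close> has an in-neighbour in it. Hence at most
  \<open>l\<close> out-neighbourhoods cover \<open>V\<close>.\<close>

theorem local_to_global_out:
  "\<exists>T. \<forall>(E :: 'v \<Rightarrow> 'v \<Rightarrow> bool) V. ocm E V \<longrightarrow> (\<forall>v\<in>V. col E {x\<in>V. E v x} t) \<longrightarrow> col E V T"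
proof -
  obtain K l where Kl: "\<And>(E :: 'v \<Rightarrow> 'v \<Rightarrow> bool) V. ocm E V \<Longrightarrow> \<not> covered E V K \<Longrightarrow>
     (\<exists>A\<subseteq>V. card A \<le> l \<and> \<not> col E A (Suc t))"
    using uncovered_imp_bounded_chromatic[of "Suc t"] by metis
  have "col E V (K * Suc t + l * t)" if V: "ocm E V" and t: "\<And>v. v \<in> V \<Longrightarrow> col E {x\<in>V. E v x} t"
    for E :: "'v \<Rightarrow> 'v \<Rightarrow> bool" and V
  proof (cases "covered E V K")
    case True
    then show ?thesis using covered_col[OF V True t] by (rule_tac col_mono) auto
  next
    case False
    then obtain A where A: "A \<subseteq> V" "card A \<le> l" "\<not> col E A (Suc t)" using Kl[OF V] by blast
    have "V \<subseteq> (\<Union>a\<in>A. {x\<in>V. E a x})"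
    proof
      fix x assume x: "x \<in> V"
      have "\<not> A \<subseteq> {z\<in>V. E x z} \<union> {z\<in>V. nadj E x z}"
        using col_Un_le[OF t[OF x] col_part[OF V x order_refl], of A "Suc t"] A(3) by auto
      then obtain a where "a \<in> A" "\<not> E x a" "\<not> nadj E x a" using A(1) by blast
      then show "x \<in> (\<Union>a\<in>A. {x\<in>V. E a x})" using x unfolding nadj_def by blast
    qed
    moreover have "col E (\<Union>a\<in>A. {x\<in>V. E a x}) (l * t)"
    proof (rule col_UN_le[OF _ A(2)])
      show "finite A" using A(1) ocm_finite[OF V] finite_subset by blast
    qed (use t A(1) in blast)
    ultimately show ?thesis by (rule_tac col_mono) auto
  qed
  then show ?thesis by blast
qed

theorem local_to_global_in:
  "\<exists>T. \<forall>(E :: 'v \<Rightarrow> 'v \<Rightarrow> bool) V. ocm E V \<longrightarrow> (\<forall>v\<in>V. col E {x\<in>V. E x v} t) \<longrightarrow> col E V T"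
proof -
  obtain T where T: "\<And>(E :: 'v \<Rightarrow> 'v \<Rightarrow> bool) V. ocm E V \<Longrightarrow> (\<And>v. v \<in> V \<Longrightarrow> col E {x\<in>V. E v x} t) \<Longrightarrow> col E V T"
    using local_to_global_out[of t] by metis
  have "col E V T" if "ocm E V" "\<And>v. v \<in> V \<Longrightarrow> col E {x\<in>V. E x v} t" for E :: "'v \<Rightarrow> 'v \<Rightarrow> bool" and V
    using T[OF ocm_rev[OF that(1)]] that(2) col_rev[of E] by simp
  then show ?thesis by blast
qed

section \<open>Digraphs without a complete pair of copies\<close>

text \<open>The predicate \<open>p\<close> abstracts from being the vertex set of a copy of a hero.
  The size bound \<open>h\<close> allows colours to be added up over the vertices of a copy.\<close>

definition supplies :: "('v \<Rightarrow> 'v \<Rightarrow> bool) \<Rightarrow> 'v set \<Rightarrow> ('v set \<Rightarrow> bool) \<Rightarrow> nat \<Rightarrow> nat \<Rightarrow> bool" where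
  "supplies E V p c h \<longleftrightarrow> (\<forall>U\<subseteq>V. \<not> col E U c \<longrightarrow> (\<exists>Y\<subseteq>U. p Y \<and> card Y \<le> h))"

definition dijoin_free ::
  "('v \<Rightarrow> 'v \<Rightarrow> bool) \<Rightarrow> 'v set \<Rightarrow> ('v set \<Rightarrow> bool) \<Rightarrow> ('v set \<Rightarrow> bool) \<Rightarrow> nat \<Rightarrow> nat \<Rightarrow> bool" where
  "dijoin_free E V p q c h \<longleftrightarrow> ocm E V \<and> supplies E V p c h \<and> supplies E V q c h \<and>
     \<not> (\<exists>Y Z. Y \<subseteq> V \<and> Z \<subseteq> V \<and> p Y \<and> q Z \<and> (\<forall>y\<in>Y. \<forall>z\<in>Z. E y z))"

definition heavy_arc :: "('v \<Rightarrow> 'v \<Rightarrow> bool) \<Rightarrow> 'v set \<Rightarrow> nat \<Rightarrow> nat \<Rightarrow> 'v \<Rightarrow> 'v \<Rightarrow> bool" where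
  "heavy_arc E V k l u v \<longleftrightarrow> E u v \<and> (\<exists>A\<subseteq>{w\<in>V. E v w \<and> E w u}. card A \<le> l \<and> \<not> col E A k)"

abbreviation heavy_edge :: "('v \<Rightarrow> 'v \<Rightarrow> bool) \<Rightarrow> 'v set \<Rightarrow> nat \<Rightarrow> nat \<Rightarrow> 'v \<Rightarrow> 'v \<Rightarrow> bool" where
  "heavy_edge E V k l u v \<equiv> heavy_arc E V k l u v \<or> heavy_arc E V k l v u"

definition heavy_clique :: "('v \<Rightarrow> 'v \<Rightarrow> bool) \<Rightarrow> 'v set \<Rightarrow> nat \<Rightarrow> nat \<Rightarrow> 'v set \<Rightarrow> bool" where
  "heavy_clique E V k l R \<longleftrightarrow> (\<forall>x\<in>R. \<forall>y\<in>R. x \<noteq> y \<longrightarrow> heavy_edge E V k l x y)"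

lemma supplies_subset: "supplies E V p c h \<Longrightarrow> U \<subseteq> V \<Longrightarrow> supplies E U p c h"
  unfolding supplies_def by (meson order_trans)

lemma supplies_obtain:
  assumes "supplies E V p c h" "U \<subseteq> V" "\<not> col E U c"
  obtains Y where "Y \<subseteq> U" "p Y" "card Y \<le> h"
  using assms unfolding supplies_def by blast

lemma dijoin_freeD:
  assumes "dijoin_free E V p q c h"
  shows "ocm E V" "supplies E V p c h" "supplies E V q c h"
    "\<And>Y Z. Y \<subseteq> V \<Longrightarrow> Z \<subseteq> V \<Longrightarrow> p Y \<Longrightarrow> q Z \<Longrightarrow> \<exists>y\<in>Y. \<exists>z\<in>Z. \<not> E y z"
  using assms unfolding dijoin_free_def by blast+

lemma dijoin_free_subset:
  assumes "dijoin_free E V p q c h" "U \<subseteq> V" shows "dijoin_free E U p q c h"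
proof -
  have "\<not> (\<exists>Y Z. Y \<subseteq> U \<and> Z \<subseteq> U \<and> p Y \<and> q Z \<and> (\<forall>y\<in>Y. \<forall>z\<in>Z. E y z))"
    using assms unfolding dijoin_free_def by (meson order_trans)
  then show ?thesis using assms ocm_subset supplies_subset unfolding dijoin_free_def by metis
qed

text \<open>If the in-neighbours are hard to colour, the light ones contain a \<open>p\<close>-set
  \<open>Y\<close>. An out-neighbour of \<open>v\<close> missed by some \<open>y\<close> in
  \<open>Y\<close> lies in the part of \<open>y\<close> or closes a triangle over the light arc
  \<open>yv\<close>, so \<open>Suc M\<close> colours per \<open>y\<close> handle these. If the other
  out-neighbours were hard to colour, they would contain a \<open>q\<close>-set that
  \<open>Y\<close> dominates completely.\<close>

lemma light_in_or_out:
  assumes free: "dijoin_free E V p q c h"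
    and IH: "\<And>U. U \<subseteq> V \<Longrightarrow> \<not> col E U M \<Longrightarrow> \<exists>A\<subseteq>U. card A \<le> l \<and> \<not> col E A k"
    and U: "U \<subseteq> V" "v \<in> U" and nb: "col E {x\<in>U. heavy_edge E V k l v x} m"
  shows "col E {x\<in>U. E x v} (m + c) \<or> col E {x\<in>U. E v x} (h * Suc M + c)"
proof (rule disjCI)
  assume "\<not> col E {x\<in>U. E v x} (h * Suc M + c)"
  note no_out = this
  have V: "ocm E V" using free unfolding dijoin_free_def by blast
  show "col E {x\<in>U. E x v} (m + c)"
  proof (rule ccontr)
    assume no_in: "\<not> ?thesis"
    let ?L = "{x\<in>U. E x v \<and> \<not> heavy_edge E V k l v x}"
    have "\<not> col E ?L c"
      using col_Un_le[OF nb, of ?L c "{x\<in>U. E x v}" "m + c"] no_in by blast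
    moreover have "?L \<subseteq> V" using U by blast
    ultimately obtain Y where Y: "Y \<subseteq> ?L" "p Y" "card Y \<le> h"
      using free unfolding dijoin_free_def supplies_def by meson
    have YV: "Y \<subseteq> V" using Y(1) U(1) by blast
    have finY: "finite Y" using finite_subset[OF YV ocm_finite[OF V]] .
    let ?C = "\<lambda>y. {w\<in>V. E v w \<and> E w y} \<union> {w\<in>V. nadj E y w}"
    have C: "col E (?C y) (Suc M)" if "y \<in> Y" for y
    proof -
      have "\<not> heavy_arc E V k l y v" "E y v" using that Y(1) by auto
      then have "\<not> (\<exists>A\<subseteq>{w\<in>V. E v w \<and> E w y}. card A \<le> l \<and> \<not> col E A k)"
        unfolding heavy_arc_def by simp
      then have "col E {w\<in>V. E v w \<and> E w y} M" using IH[of "{w\<in>V. E v w \<and> E w y}"] by auto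
      then show ?thesis using col_Un[OF _ col_part[OF V _ order_refl], of _ M y] that YV by auto
    qed
    let ?Z = "{x\<in>U. E v x \<and> (\<forall>y\<in>Y. E y x)}"
    have "\<not> col E ?Z c"
    proof
      assume "col E ?Z c"
      have "col E {x\<in>U. E v x} (h * Suc M + c)"
      proof (rule col_Un_le[OF col_UN_le[OF finY Y(3) C] \<open>col E ?Z c\<close> _ order_refl])
        show "{x\<in>U. E v x} \<subseteq> (\<Union>y\<in>Y. ?C y) \<union> ?Z" using U(1) unfolding nadj_def by blast
      qed
      with no_out show False ..
    qed
    moreover have "?Z \<subseteq> V" using U by blast
    ultimately obtain Z where Z: "Z \<subseteq> ?Z" "q Z"
      using free unfolding dijoin_free_def supplies_def by meson
    then have "Z \<subseteq> V" "\<forall>y\<in>Y. \<forall>z\<in>Z. E y z" using U(1) by auto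
    then show False using free Y(2) YV Z(2) unfolding dijoin_free_def by blast
  qed
qed

text \<open>Induction on the clique size, as in Ramsey's theorem: the heavy neighbourhood of a
  vertex has no heavy clique of size \<open>n\<close>, so \<open>light_in_or_out\<close> splits
  \<open>U\<close> into two sets with bounded out- and in-neighbourhoods respectively.
  \<open>U\<close> varies separately because heaviness is always measured in the ambient
  \<open>V\<close>.\<close>

lemma no_heavy_clique_col:
  assumes IH: "\<And>(E :: 'v \<Rightarrow> 'v \<Rightarrow> bool) V p q. dijoin_free E V p q c h \<Longrightarrow> \<not> col E V M \<Longrightarrow>
     \<exists>A\<subseteq>V. card A \<le> l \<and> \<not> col E A k"
  shows "\<exists>m. \<forall>(E :: 'v \<Rightarrow> 'v \<Rightarrow> bool) V p q U. dijoin_free E V p q c h \<longrightarrow> U \<subseteq> V \<longrightarrow>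
     \<not> (\<exists>R\<subseteq>U. card R = n \<and> heavy_clique E V k l R) \<longrightarrow> col E U m"
proof (induction n)
  case 0
  have "\<exists>R\<subseteq>U. card R = 0 \<and> heavy_clique E V k l R" for E :: "'v \<Rightarrow> 'v \<Rightarrow> bool" and V U
    by (intro exI[of _ "{}"]) (auto simp: heavy_clique_def)
  then show ?case by blast
next
  case (Suc n)
  then obtain m where m: "\<And>(E :: 'v \<Rightarrow> 'v \<Rightarrow> bool) V p q U. dijoin_free E V p q c h \<Longrightarrow> U \<subseteq> V \<Longrightarrow>
     \<not> (\<exists>R\<subseteq>U. card R = n \<and> heavy_clique E V k l R) \<Longrightarrow> col E U m" by metis
  obtain T where T: "\<And>(E :: 'v \<Rightarrow> 'v \<Rightarrow> bool) V. ocm E V \<Longrightarrow> (\<And>v. v \<in> V \<Longrightarrow> col E {x\<in>V. E v x} (h * Suc M + c)) \<Longrightarrow> col E V T"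
    using local_to_global_out by metis
  obtain T' where T': "\<And>(E :: 'v \<Rightarrow> 'v \<Rightarrow> bool) V. ocm E V \<Longrightarrow> (\<And>v. v \<in> V \<Longrightarrow> col E {x\<in>V. E x v} (m + c)) \<Longrightarrow> col E V T'"
    using local_to_global_in by metis
  have "col E U (T + T')" if free: "dijoin_free E V p q c h" and U: "U \<subseteq> V"
    and nc: "\<not> (\<exists>R\<subseteq>U. card R = Suc n \<and> heavy_clique E V k l R)"
    for E :: "'v \<Rightarrow> 'v \<Rightarrow> bool" and V p q U
  proof -
    have V: "ocm E V" using free unfolding dijoin_free_def by blast
    define UO where "UO = {v\<in>U. col E {x\<in>U. E v x} (h * Suc M + c)}"
    define UI where "UI = {v\<in>U. col E {x\<in>U. E x v} (m + c)}"
    have "U \<subseteq> UO \<union> UI"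
    proof
      fix v assume v: "v \<in> U"
      have "col E {x\<in>U. heavy_edge E V k l v x} m"
      proof (rule m[OF free])
        show "{x\<in>U. heavy_edge E V k l v x} \<subseteq> V" using U by blast
        show "\<not> (\<exists>R\<subseteq>{x\<in>U. heavy_edge E V k l v x}. card R = n \<and> heavy_clique E V k l R)"
        proof (intro notI, elim exE conjE)
          fix R assume R: "R \<subseteq> {x\<in>U. heavy_edge E V k l v x}" "card R = n" "heavy_clique E V k l R"
          have "R \<subseteq> V" using R(1) U by blast
          then have finR: "finite R" using finite_subset ocm_finite[OF V] by blast
          have "v \<notin> R"
            using R(1) ocm_irrefl[OF V, of v] v U unfolding heavy_arc_def by blast
          then have "card (insert v R) = Suc n" using finR R(2) by simp
          moreover have "heavy_clique E V k l (insert v R)"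
            using R(1,3) unfolding heavy_clique_def by blast
          moreover have "insert v R \<subseteq> U" using R(1) v by blast
          ultimately show False using nc by blast
        qed
      qed
      then have "col E {x\<in>U. E x v} (m + c) \<or> col E {x\<in>U. E v x} (h * Suc M + c)"
        using light_in_or_out[OF free _ U v] IH dijoin_free_subset[OF free] by blast
      then show "v \<in> UO \<union> UI" using v unfolding UO_def UI_def by blast
    qed
    moreover have "col E UO T"
    proof (rule T)
      show "ocm E UO" by (rule ocm_subset[OF V]) (use U in \<open>auto simp: UO_def\<close>)
      show "col E {x\<in>UO. E v x} (h * Suc M + c)" if "v \<in> UO" for v
        using that unfolding UO_def by (auto elim!: col_subset)
    qed
    moreover have "col E UI T'"
    proof (rule T')
      show "ocm E UI" by (rule ocm_subset[OF V]) (use U in \<open>auto simp: UI_def\<close>)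
      show "col E {x\<in>UI. E x v} (m + c)" if "v \<in> UI" for v
        using that unfolding UI_def by (auto elim!: col_subset)
    qed
    ultimately show ?thesis using col_Un_le by blast
  qed
  then show ?case by blast
qed

text \<open>With \<open>k + 1\<close> colours, two of the \<open>k + 2\<close> clique vertices
  agree. The return set of the arc between them contains their colour as well, which closes a
  monochromatic triangle.\<close>

lemma heavy_clique_not_col:
  assumes V: "finite V" and R: "R \<subseteq> V" "card R = Suc (Suc k)" "heavy_clique E V k l R"
  shows "\<exists>A\<subseteq>V. card A \<le> Suc (Suc k) + Suc (Suc k) * (Suc (Suc k) * l) \<and> \<not> col E A (Suc k)"
proof -
  have finR: "finite R" using finite_subset[OF R(1) V] .
  \<comment> \<open>Pairs that are not heavy arcs get the empty set, so that the size bound holds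
    for all pairs.\<close>
  have "\<exists>A. A \<subseteq> V \<and> card A \<le> l \<and> (heavy_arc E V k l x y \<longrightarrow> \<not> col E A k \<and> (\<forall>w\<in>A. E y w \<and> E w x))" for x y
  proof (cases "heavy_arc E V k l x y")
    case True
    then obtain A where "A \<subseteq> {w\<in>V. E y w \<and> E w x}" "card A \<le> l" "\<not> col E A k"
      unfolding heavy_arc_def by blast
    then show ?thesis by (intro exI[of _ A]) auto
  next
    case False
    then show ?thesis by (intro exI[of _ "{}"]) auto
  qed
  then obtain F where F: "\<And>x y. F x y \<subseteq> V" "\<And>x y. card (F x y) \<le> l"
    "\<And>x y. heavy_arc E V k l x y \<Longrightarrow> \<not> col E (F x y) k"
    "\<And>x y w. heavy_arc E V k l x y \<Longrightarrow> w \<in> F x y \<Longrightarrow> E y w \<and> E w x" by metis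
  define A where "A = R \<union> (\<Union>x\<in>R. \<Union>y\<in>R. F x y)"
  have "A \<subseteq> V" using F(1) R(1) unfolding A_def by auto
  moreover have "card A \<le> Suc (Suc k) + Suc (Suc k) * (Suc (Suc k) * l)"
  proof -
    have "card (\<Union>x\<in>R. \<Union>y\<in>R. F x y) \<le> Suc (Suc k) * (Suc (Suc k) * l)"
      by (intro card_UN_bound finR F(2)) (use R(2) in auto)
    then show ?thesis using card_Un_le[of R "\<Union>x\<in>R. \<Union>y\<in>R. F x y"] R(2) unfolding A_def by linarith
  qed
  moreover have "\<not> col E A (Suc k)"
  proof
    assume "col E A (Suc k)"
    then obtain f where f: "is_colouring E A (Suc k) f" unfolding col_def by blast
    have RA: "R \<subseteq> A" unfolding A_def by blast
    have "f ` R \<subseteq> {..<Suc k}" using f RA unfolding is_colouring_def by blast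
    then have "card (f ` R) < card R" using card_mono[of "{..<Suc k}" "f ` R"] R(2) by simp
    then have "\<not> inj_on f R" using pigeonhole by blast
    then obtain x y where xy: "x \<in> R" "y \<in> R" "x \<noteq> y" "f x = f y" unfolding inj_on_def by blast
    have contra: False if xy: "x \<in> R" "y \<in> R" "f x = f y" "heavy_arc E V k l x y" for x y
    proof -
      have FA: "F x y \<subseteq> A" using xy unfolding A_def by blast
      have "f x < Suc k" using f RA xy(1) unfolding is_colouring_def by blast
      then obtain w where w: "w \<in> F x y" "f w = f x"
        using colour_used[OF is_colouring_subset[OF f FA] F(3)[OF xy(4)]] by blast
      show False
        by (rule is_colouring_no_triangle[OF f, of x y w])
          (use xy w RA FA F(4)[OF xy(4) w(1)] in \<open>auto simp: heavy_arc_def\<close>)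
    qed
    have "heavy_edge E V k l x y" using R(3) xy unfolding heavy_clique_def by blast
    then show False using contra xy by metis
  qed
  ultimately show ?thesis by blast
qed

lemma dijoin_free_bounded_chromatic:
  "\<exists>M l. \<forall>(E :: 'v \<Rightarrow> 'v \<Rightarrow> bool) V p q. dijoin_free E V p q c h \<longrightarrow> \<not> col E V M \<longrightarrow>
     (\<exists>A\<subseteq>V. card A \<le> l \<and> \<not> col E A k)"
proof (induction k)
  case 0
  have "\<exists>A\<subseteq>V. card A \<le> 1 \<and> \<not> col E A 0" if "\<not> col E V 0" for E :: "'v \<Rightarrow> 'v \<Rightarrow> bool" and V
  proof -
    obtain x where "x \<in> V" using \<open>\<not> col E V 0\<close> by auto
    then show ?thesis by (intro exI[of _ "{x}"]) auto
  qed
  then show ?case by metis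
next
  case (Suc k)
  then obtain M l where IH: "\<And>(E :: 'v \<Rightarrow> 'v \<Rightarrow> bool) V p q. dijoin_free E V p q c h \<Longrightarrow> \<not> col E V M \<Longrightarrow>
     \<exists>A\<subseteq>V. card A \<le> l \<and> \<not> col E A k" by metis
  obtain m where "\<forall>(E :: 'v \<Rightarrow> 'v \<Rightarrow> bool) V p q U. dijoin_free E V p q c h \<longrightarrow> U \<subseteq> V \<longrightarrow>
     \<not> (\<exists>R\<subseteq>U. card R = Suc (Suc k) \<and> heavy_clique E V k l R) \<longrightarrow> col E U m"
    using no_heavy_clique_col[where n = "Suc (Suc k)", OF IH] by (rule exE)
  note m = this[rule_format]
  have "\<exists>A\<subseteq>V. card A \<le> Suc (Suc k) + Suc (Suc k) * (Suc (Suc k) * l) \<and> \<not> col E A (Suc k)"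
    if free: "dijoin_free E V p q c h" and nc: "\<not> col E V m" for E :: "'v \<Rightarrow> 'v \<Rightarrow> bool" and V p q
  proof -
    from m[OF free order_refl] nc obtain R where "R \<subseteq> V" "card R = Suc (Suc k)" "heavy_clique E V k l R" by blast
    moreover have "finite V" using free unfolding dijoin_free_def by (blast intro: ocm_finite)
    ultimately show ?thesis by (intro heavy_clique_not_col)
  qed
  then show ?case by metis
qed

text \<open>Every vertex is complete from a copy of \<open>p\<close> or complete to a copy of \<open>q\<close> inside a bounded set
  of chromatic number more than \<open>2 * c + 1\<close>.\<close>
theorem dijoin_free_col:
  "\<exists>C. \<forall>(E :: 'v \<Rightarrow> 'v \<Rightarrow> bool) V p q. dijoin_free E V p q c h \<longrightarrow> col E V C"
proof -
  obtain M l where Ml: "\<And>(E :: 'v \<Rightarrow> 'v \<Rightarrow> bool) V p q. dijoin_free E V p q c h \<Longrightarrow> \<not> col E V M \<Longrightarrow>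
     \<exists>A\<subseteq>V. card A \<le> l \<and> \<not> col E A (2 * c + 1)" using dijoin_free_bounded_chromatic by metis
  have "col E V (M + 2 * (2 ^ l * c))" if free: "dijoin_free E V p q c h" for E :: "'v \<Rightarrow> 'v \<Rightarrow> bool" and V p q
  proof (cases "col E V M")
    case True
    then show ?thesis by (rule col_mono) auto
  next
    case False
    have V: "ocm E V" using free unfolding dijoin_free_def by blast
    from Ml[OF free False] obtain A where A: "A \<subseteq> V" "card A \<le> l" "\<not> col E A (2 * c + 1)" by blast
    have finA: "finite A" using finite_subset[OF A(1) ocm_finite[OF V]] .
    let ?P = "{Y\<in>Pow A. p Y}" and ?Q = "{Z\<in>Pow A. q Z}"
    have "card {Y\<in>Pow A. r Y} \<le> 2 ^ l" for r
    proof -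
      have "card {Y\<in>Pow A. r Y} \<le> card (Pow A)" using finA by (intro card_mono) auto
      also have "\<dots> \<le> 2 ^ l" using A(2) finA by (simp add: card_Pow)
      finally show ?thesis .
    qed
    note card_le = this
    \<comment> \<open>The common out-neighbourhood of a \<open>p\<close>-set contains no
      \<open>q\<close>-set, so \<open>c\<close> colours suffice for it, and \<open>A\<close> has at
      most \<open>2 ^ l\<close> subsets.\<close>
    have P: "col E (\<Union>Y\<in>?P. {v\<in>V. \<forall>y\<in>Y. E y v}) (2 ^ l * c)"
    proof (rule col_UN_le[OF _ card_le])
      fix Y assume Y: "Y \<in> ?P"
      show "col E {v\<in>V. \<forall>y\<in>Y. E y v} c"
      proof (rule ccontr)
        assume nc: "\<not> ?thesis"
        have sub: "{v\<in>V. \<forall>y\<in>Y. E y v} \<subseteq> V" by blast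
        obtain Z where Z: "Z \<subseteq> {v\<in>V. \<forall>y\<in>Y. E y v}" "q Z"
          by (rule supplies_obtain[OF dijoin_freeD(3)[OF free] sub nc])
        have "Y \<subseteq> V" using Y A(1) by auto
        moreover have "Z \<subseteq> V" using Z(1) by auto
        moreover have "p Y" using Y by simp
        ultimately obtain y z where "y \<in> Y" "z \<in> Z" "\<not> E y z"
          using dijoin_freeD(4)[OF free _ _ _ Z(2)] by metis
        then show False using Z(1) by auto
      qed
    qed (use finA in simp)
    have Q: "col E (\<Union>Z\<in>?Q. {v\<in>V. \<forall>z\<in>Z. E v z}) (2 ^ l * c)"
    proof (rule col_UN_le[OF _ card_le])
      fix Z assume Z: "Z \<in> ?Q"
      show "col E {v\<in>V. \<forall>z\<in>Z. E v z} c"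
      proof (rule ccontr)
        assume nc: "\<not> ?thesis"
        have sub: "{v\<in>V. \<forall>z\<in>Z. E v z} \<subseteq> V" by blast
        obtain Y where Y: "Y \<subseteq> {v\<in>V. \<forall>z\<in>Z. E v z}" "p Y"
          by (rule supplies_obtain[OF dijoin_freeD(2)[OF free] sub nc])
        have "Z \<subseteq> V" using Z A(1) by auto
        moreover have "Y \<subseteq> V" using Y(1) by auto
        moreover have "q Z" using Z by simp
        ultimately obtain y z where "y \<in> Y" "z \<in> Z" "\<not> E y z"
          using dijoin_freeD(4)[OF free _ _ Y(2)] by metis
        then show False using Y(1) by auto
      qed
    qed (use finA in simp)
    have "V \<subseteq> (\<Union>Y\<in>?P. {v\<in>V. \<forall>y\<in>Y. E y v}) \<union> (\<Union>Z\<in>?Q. {v\<in>V. \<forall>z\<in>Z. E v z})"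
    proof
      fix v assume v: "v \<in> V"
      have "\<not> (col E {x\<in>A. E x v} c \<and> col E {x\<in>A. E v x} c)"
      proof
        assume "col E {x\<in>A. E x v} c \<and> col E {x\<in>A. E v x} c"
        then have "col E ({x\<in>A. E x v} \<union> {x\<in>A. E v x}) (c + c)" using col_Un by blast
        then have "col E A (c + c + Suc 0)"
          by (rule col_Un_le[OF _ col_part[OF V v A(1)]]) (auto simp: nadj_def)
        then show False using A(3) by (simp add: mult_2)
      qed
      then consider "\<not> col E {x\<in>A. E x v} c" | "\<not> col E {x\<in>A. E v x} c" by blast
      then show "v \<in> (\<Union>Y\<in>?P. {v\<in>V. \<forall>y\<in>Y. E y v}) \<union> (\<Union>Z\<in>?Q. {v\<in>V. \<forall>z\<in>Z. E v z})"
      proof cases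
        case 1
        have sub: "{x\<in>A. E x v} \<subseteq> V" using A(1) by blast
        obtain Y where "Y \<subseteq> {x\<in>A. E x v}" "p Y"
          by (rule supplies_obtain[OF dijoin_freeD(2)[OF free] sub 1])
        then show ?thesis using v by auto
      next
        case 2
        have sub: "{x\<in>A. E v x} \<subseteq> V" using A(1) by blast
        obtain Z where "Z \<subseteq> {x\<in>A. E v x}" "q Z"
          by (rule supplies_obtain[OF dijoin_freeD(3)[OF free] sub 2])
        then show ?thesis using v by auto
      qed
    qed
    then show ?thesis by (rule col_Un_le[OF P Q]) simp
  qed
  then show ?thesis by blast
qed

section \<open>Digraphs with light arcs only\<close>

definition light :: "('v \<Rightarrow> 'v \<Rightarrow> bool) \<Rightarrow> 'v set \<Rightarrow> nat \<Rightarrow> bool" where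
  "light E V c \<longleftrightarrow> ocm E V \<and> (\<forall>u\<in>V. \<forall>v\<in>V. E u v \<longrightarrow> col E {w\<in>V. E v w \<and> E w u} c)"

lemma light_ocm: "light E V c \<Longrightarrow> ocm E V" by (simp add: light_def)

lemma light_col: "light E V c \<Longrightarrow> u \<in> V \<Longrightarrow> v \<in> V \<Longrightarrow> E u v \<Longrightarrow> col E {w\<in>V. E v w \<and> E w u} c"
  by (simp add: light_def)

lemma light_subset:
  assumes "light E V c" "U \<subseteq> V" shows "light E U c"
  unfolding light_def
proof (intro conjI ballI impI)
  show "ocm E U" using ocm_subset light_ocm assms by blast
  fix u v assume "u \<in> U" "v \<in> U" "E u v"
  then have "col E {w\<in>V. E v w \<and> E w u} c" using assms by (intro light_col) auto
  then show "col E {w\<in>U. E v w \<and> E w u} c" by (rule col_subset) (use assms in auto)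
qed

lemma light_rev:
  assumes "light E V c" shows "light (\<lambda>x y. E y x) V c"
  unfolding light_def
proof (intro conjI ballI impI)
  show "ocm (\<lambda>x y. E y x) V" using ocm_rev light_ocm assms by blast
  fix u v assume "u \<in> V" "v \<in> V" "E v u"
  then have "col E {w\<in>V. E u w \<and> E w v} c" using assms by (intro light_col) auto
  then show "col (\<lambda>x y. E y x) {w\<in>V. E w v \<and> E u w} c"
    unfolding col_rev[of E] by (rule col_subset) auto
qed

text \<open>An out-neighbour of \<open>v\<close> that \<open>u\<close> misses closes a triangle over
  the arc \<open>uv\<close> or lies in the part of \<open>u\<close>.\<close>

lemma light_out_subset:
  assumes "light E V c" "U \<subseteq> V" "u \<in> V" "v \<in> V" "E u v"
  shows "col E {x\<in>U. E v x \<and> \<not> E u x} (Suc c)"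
proof (rule col_Un_le[OF light_col[OF assms(1,3-5)] col_part[OF light_ocm[OF assms(1)] assms(3) order_refl]])
  show "{x \<in> U. E v x \<and> \<not> E u x} \<subseteq> {w \<in> V. E v w \<and> E w u} \<union> {y \<in> V. nadj E u y}"
    using assms(2) by (auto simp: nadj_def)
qed simp

section \<open>Almost sources of light digraphs and the order they induce\<close>

lemma out_diff_trans:
  assumes "col E {x\<in>U. E a x \<and> \<not> E b x} m" "col E {x\<in>U. E b x \<and> \<not> E d x} n"
  shows "col E {x\<in>U. E a x \<and> \<not> E d x} (m + n)"
  by (rule col_Un_le[OF assms]) auto

text \<open>Up to few colours, out-neighbourhoods grow towards the tail of an arc, so for adjacent
  \<open>a\<close> and \<open>b\<close> the tail serves. Otherwise an in-neighbour \<open>w\<close>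
  of either is adjacent to both, and \<open>w\<close> or the start of the path of length two through
  \<open>w\<close> serves. The factor 2 pays for this path.\<close>

lemma light_pair_dominator:
  assumes L: "light E V c" and U: "U \<subseteq> V" and a: "a \<in> U" and b: "b \<in> U"
  shows "\<exists>d\<in>U. col E {x\<in>U. E a x \<and> \<not> E d x} (2 * Suc c) \<and> col E {x\<in>U. E b x \<and> \<not> E d x} (2 * Suc c)"
proof -
  have V: "ocm E V" using L by (rule light_ocm)
  have arc: "col E {x\<in>U. E v x \<and> \<not> E u x} (2 * Suc c)" if "u \<in> U" "v \<in> U" "E u v" for u v
    by (rule col_mono[OF light_out_subset[OF L U, of u v]]) (use that U in auto)
  have arc2: "col E {x\<in>U. E w x \<and> \<not> E u x} (2 * Suc c)"
    if "u \<in> U" "v \<in> U" "w \<in> U" "E u v" "E v w" for u v w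
    using out_diff_trans[OF light_out_subset[OF L U, of v w] light_out_subset[OF L U, of u v]] that U
    by (auto simp: mult_2)
  have self: "col E {x\<in>U. E v x \<and> \<not> E v x} (2 * Suc c)" for v by simp
  consider "E a b" | "E b a" | "nadj E a b" unfolding nadj_def by blast
  then show ?thesis
  proof cases
    case 1 then show ?thesis using arc[of a b] self[of a] a b by blast
  next
    case 2 then show ?thesis using arc[of b a] self[of b] a b by blast
  next
    case 3
    have other: "E w b \<or> E b w" if "w \<in> U" "E w a \<or> E a w" "a \<in> U" "b \<in> U" "nadj E a b" for w a b
      using ocm_trans[OF V, of a b w] that U unfolding nadj_def by blast
    show ?thesis
    proof (cases "\<exists>w\<in>U. E w a \<or> E w b")
      case True
      then obtain w where w: "w \<in> U" "E w a \<or> E w b" by blast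
      show ?thesis
      proof (cases "E w a \<and> E w b")
        case True then show ?thesis using arc[of w a] arc[of w b] w a b by blast
      next
        case False
        have "E b w \<and> E w a \<or> E a w \<and> E w b"
          using False w other[of w a b] other[of w b a] a b 3 nadj_sym[OF 3] by blast
        then show ?thesis
        proof
          assume "E b w \<and> E w a"
          then show ?thesis using arc2[of b w a] self[of b] a b w by blast
        next
          assume "E a w \<and> E w b"
          then show ?thesis using arc2[of a w b] self[of a] a b w by blast
        qed
      qed
    next
      case False
      \<comment> \<open>Neither vertex has an in-neighbour in \<open>U\<close>, and they lie in the
        same part, so a neighbour of \<open>a\<close> is an out-neighbour of
        \<open>b\<close>.\<close>
      have e: "{x\<in>U. E a x \<and> \<not> E b x} = {}" using other[of _ a b] False a b 3 by blast
      show ?thesis by (rule bexI[OF _ b]) (unfold e, use self[of b] in simp)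
    qed
  qed
qed

text \<open>Each new vertex \<open>b\<close> is merged with the dominator \<open>d\<close> of the
  earlier ones; passing from \<open>b\<close> and from \<open>d\<close> to the new dominator costs
  \<open>2 * Suc c\<close> colours each.\<close>

lemma light_set_dominator:
  assumes L: "light E V c" and U: "U \<subseteq> V" and B: "finite B" "B \<noteq> {}" "B \<subseteq> U"
  shows "\<exists>d\<in>U. col E {x\<in>U. (\<exists>b\<in>B. E b x) \<and> \<not> E d x} (card B * (4 * Suc c))"
  using B
proof (induction B rule: finite_ne_induct)
  case (singleton b)
  have e: "{x\<in>U. (\<exists>b'\<in>{b}. E b' x) \<and> \<not> E b x} = {}" by blast
  show ?case by (rule bexI[of _ b]) (use singleton in \<open>simp_all add: e\<close>)
next
  case (insert b B)
  then obtain d where d: "d \<in> U" "col E {x\<in>U. (\<exists>b\<in>B. E b x) \<and> \<not> E d x} (card B * (4 * Suc c))" by auto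
  obtain e where e: "e \<in> U" "col E {x\<in>U. E b x \<and> \<not> E e x} (2 * Suc c)" "col E {x\<in>U. E d x \<and> \<not> E e x} (2 * Suc c)"
    using light_pair_dominator[OF L U, of b d] insert.prems d(1) by auto
  have "col E {x\<in>U. (\<exists>b'\<in>insert b B. E b' x) \<and> \<not> E e x} (card (insert b B) * (4 * Suc c))"
  proof (rule col_Un_le[OF d(2) col_Un[OF e(2,3)]])
    show "card B * (4 * Suc c) + (2 * Suc c + 2 * Suc c) \<le> card (insert b B) * (4 * Suc c)"
      using insert.hyps by simp
  qed blast
  then show ?case using e(1) by blast
qed

lemma covered_almost_source:
  assumes L: "light E V c" and U: "U \<subseteq> V" "U \<noteq> {}" and cov: "covered E U K"
  shows "\<exists>d\<in>U. col E {x\<in>U. \<not> E d x} (K * (4 * Suc c) + K)"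
proof -
  have oU: "ocm E U" using ocm_subset[OF light_ocm[OF L] U(1)] .
  obtain B Q where BQ: "B \<subseteq> U" "Q \<subseteq> U" "card B + card Q \<le> K"
    "\<forall>x\<in>U. (\<exists>b\<in>B. E b x) \<or> (\<exists>q\<in>Q. nadj E q x)" using cov unfolding covered_def by blast
  have finB: "finite B" using finite_subset[OF BQ(1) ocm_finite[OF oU]] .
  have finQ: "finite Q" using finite_subset[OF BQ(2) ocm_finite[OF oU]] .
  have "\<exists>d\<in>U. col E {x\<in>U. (\<exists>b\<in>B. E b x) \<and> \<not> E d x} (card B * (4 * Suc c))"
  proof (cases "B = {}")
    case True
    then show ?thesis using U(2) by auto
  next
    case False
    then show ?thesis using light_set_dominator[OF L U(1) finB] BQ(1) by blast
  qed
  then obtain d where d: "d \<in> U" "col E {x\<in>U. (\<exists>b\<in>B. E b x) \<and> \<not> E d x} (card B * (4 * Suc c))" by blast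
  have Q: "col E (\<Union>q\<in>Q. {x\<in>U. nadj E q x}) (card Q * Suc 0)"
    by (rule col_UN_le[OF finQ order_refl]) (use col_part[OF oU] BQ(2) in auto)
  have "col E {x\<in>U. \<not> E d x} (K * (4 * Suc c) + K)"
  proof (rule col_Un_le[OF d(2) Q])
    show "{x\<in>U. \<not> E d x} \<subseteq> {x\<in>U. (\<exists>b\<in>B. E b x) \<and> \<not> E d x} \<union> (\<Union>q\<in>Q. {x\<in>U. nadj E q x})"
      using BQ(4) by auto
    have "card B * (4 * Suc c) \<le> K * (4 * Suc c)" using BQ(3) by (intro mult_le_mono1) simp
    then show "card B * (4 * Suc c) + card Q * Suc 0 \<le> K * (4 * Suc c) + K" using BQ(3) by linarith
  qed
  then show ?thesis using d(1) by blast
qed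

text \<open>Almost sources are removed one by one and \<open>r\<close> records the order of removal:
  a vertex dominates almost everything that was still present.\<close>

lemma almost_source_order:
  assumes "finite V" and src: "\<And>U. U \<subseteq> V \<Longrightarrow> U \<noteq> {} \<Longrightarrow> \<exists>d\<in>U. col E {x\<in>U. \<not> E d x} \<kappa>"
  shows "\<exists>r :: 'v \<Rightarrow> nat. inj_on r V \<and> (\<forall>v\<in>V. col E {x\<in>V. r v \<le> r x \<and> \<not> E v x} \<kappa>)"
  using assms
proof (induction V rule: finite_psubset_induct)
  case (psubset V)
  show ?case
  proof (cases "V = {}")
    case False
    then obtain d where d: "d \<in> V" "col E {x\<in>V. \<not> E d x} \<kappa>" using psubset.prems[of V] by blast
    have "V - {d} \<subset> V" using d(1) by blast
    moreover have "\<exists>e\<in>U. col E {x\<in>U. \<not> E e x} \<kappa>" if "U \<subseteq> V - {d}" "U \<noteq> {}" for U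
      using psubset.prems[of U] that by blast
    ultimately have "\<exists>r :: 'v \<Rightarrow> nat. inj_on r (V - {d}) \<and>
        (\<forall>v\<in>V - {d}. col E {x\<in>V - {d}. r v \<le> r x \<and> \<not> E v x} \<kappa>)"
      by (rule psubset.IH)
    then obtain r :: "'v \<Rightarrow> nat" where r: "inj_on r (V - {d})"
      "\<forall>v\<in>V - {d}. col E {x\<in>V - {d}. r v \<le> r x \<and> \<not> E v x} \<kappa>"
      by (elim exE conjE)
    define r' where "r' x = (if x = d then 0 else Suc (r x))" for x
    have "inj_on r' V"
    proof (rule inj_onI)
      fix x y assume "x \<in> V" "y \<in> V" "r' x = r' y"
      then show "x = y" using r(1) unfolding r'_def inj_on_def by (auto split: if_splits)
    qed
    moreover have "col E {x\<in>V. r' v \<le> r' x \<and> \<not> E v x} \<kappa>" if v: "v \<in> V" for v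
    proof (cases "v = d")
      case True
      show ?thesis by (rule col_subset[OF d(2)]) (use True in auto)
    next
      case False
      then have "{x\<in>V. r' v \<le> r' x \<and> \<not> E v x} = {x\<in>V - {d}. r v \<le> r x \<and> \<not> E v x}"
        unfolding r'_def by auto
      then show ?thesis using r(2) v False by auto
    qed
    ultimately show ?thesis by blast
  qed simp
qed

text \<open>A shortest initial segment that is not \<open>R\<close>-colourable is cut off
  repeatedly. Without its last vertex it is \<open>R\<close>-colourable, so one more colour
  suffices. Only the final block may be \<open>R\<close>-colourable.\<close>

lemma interval_blocks:
  fixes r :: "'v \<Rightarrow> nat"
  assumes "finite V" "inj_on r V" "\<And>x. x \<in> V \<Longrightarrow> \<not> E x x"
  shows "\<exists>\<beta> :: 'v \<Rightarrow> nat. (\<forall>x\<in>V. \<forall>y\<in>V. r x \<le> r y \<longrightarrow> \<beta> x \<le> \<beta> y) \<and>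
    (\<forall>i. col E {x\<in>V. \<beta> x = i} (Suc R)) \<and> (\<forall>v\<in>V. \<forall>i<\<beta> v. \<not> col E {x\<in>V. \<beta> x = i} R)"
  using assms
proof (induction V rule: finite_psubset_induct)
  case (psubset V)
  show ?case
  proof (cases "col E V (Suc R)")
    case True
    have "col E {x\<in>V. (0::nat) = i} (Suc R)" for i by (rule col_subset[OF True]) auto
    then show ?thesis by (intro exI[of _ "\<lambda>_. 0"]) simp
  next
    case False
    define P where "P t \<longleftrightarrow> \<not> col E {x\<in>V. r x \<le> t} R" for t
    have "{x\<in>V. r x \<le> Max (r ` V)} = V" using psubset.hyps by auto
    then have "P (Max (r ` V))" unfolding P_def using False col_mono[of E V R V "Suc R"] by auto
    then have t: "P (LEAST t. P t)" by (rule LeastI)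
    define t where "t = (LEAST t. P t)"
    define I where "I = {x\<in>V. r x \<le> t}"
    have nI: "\<not> col E I R" using t unfolding P_def I_def t_def by simp
    have "col E {x\<in>V. r x < t} R"
    proof (cases t)
      case (Suc t')
      then have "\<not> P t'" using not_less_Least[of t' P] unfolding t_def by simp
      then show ?thesis unfolding P_def Suc by (simp add: less_Suc_eq_le)
    qed simp
    moreover have "col E {x\<in>V. r x = t} (Suc 0)"
    proof (rule col_indep)
      fix x y assume xy: "x \<in> {x\<in>V. r x = t}" "y \<in> {x\<in>V. r x = t}"
      then have "x = y" using inj_onD[OF psubset.prems(1), of x y] by auto
      then show "\<not> E x y" using psubset.prems(2) xy by auto
    qed
    ultimately have cI: "col E I (Suc R)"
      by (rule col_Un_le) (auto simp: I_def)
    have "I \<noteq> {}" using nI by auto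
    then have "V - I \<subset> V" unfolding I_def by blast
    moreover have "inj_on r (V - I)" using psubset.prems(1) by (rule inj_on_subset) blast
    moreover have "\<not> E x x" if "x \<in> V - I" for x using psubset.prems(2) that by blast
    ultimately have "\<exists>\<beta> :: 'v \<Rightarrow> nat. (\<forall>x\<in>V - I. \<forall>y\<in>V - I. r x \<le> r y \<longrightarrow> \<beta> x \<le> \<beta> y) \<and>
      (\<forall>i. col E {x\<in>V - I. \<beta> x = i} (Suc R)) \<and> (\<forall>v\<in>V - I. \<forall>i<\<beta> v. \<not> col E {x\<in>V - I. \<beta> x = i} R)"
      by (rule psubset.IH)
    then obtain \<beta> :: "'v \<Rightarrow> nat" where \<beta>: "\<forall>x\<in>V - I. \<forall>y\<in>V - I. r x \<le> r y \<longrightarrow> \<beta> x \<le> \<beta> y"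
      "\<forall>i. col E {x\<in>V - I. \<beta> x = i} (Suc R)" "\<forall>v\<in>V - I. \<forall>i<\<beta> v. \<not> col E {x\<in>V - I. \<beta> x = i} R"
      by (elim exE conjE)
    define \<beta>' where "\<beta>' x = (if r x \<le> t then 0 else Suc (\<beta> x))" for x
    have lev0: "{x\<in>V. \<beta>' x = 0} = I" unfolding \<beta>'_def I_def by auto
    have lev: "{x\<in>V. \<beta>' x = Suc i} = {x\<in>V - I. \<beta> x = i}" for i unfolding \<beta>'_def I_def by auto
    have "\<forall>x\<in>V. \<forall>y\<in>V. r x \<le> r y \<longrightarrow> \<beta>' x \<le> \<beta>' y"
      using \<beta>(1) unfolding \<beta>'_def I_def by auto
    moreover have "col E {x\<in>V. \<beta>' x = i} (Suc R)" for i
      using cI \<beta>(2) by (cases i) (auto simp: lev0 lev)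
    moreover have "\<not> col E {x\<in>V. \<beta>' x = i} R" if "v \<in> V" "i < \<beta>' v" for v i
    proof (cases i)
      case 0 then show ?thesis using nI lev0 by simp
    next
      case (Suc j)
      have "v \<in> V - I" "j < \<beta> v" using that Suc unfolding \<beta>'_def I_def by (auto split: if_splits)
      then show ?thesis using \<beta>(3) lev Suc by auto
    qed
    ultimately show ?thesis by blast
  qed
qed

text \<open>A vertex dominates almost all of each later block. The potential \<open>\<phi> x\<close>
  is the first block in which the in-neighbours of \<open>x\<close> need few colours; up to few
  colours it is the block of \<open>x\<close> or the next one.\<close>

lemma light_almost_source_col:
  fixes E :: "'v \<Rightarrow> 'v \<Rightarrow> bool"
  assumes L: "light E V c"
    and src: "\<And>U. U \<subseteq> V \<Longrightarrow> U \<noteq> {} \<Longrightarrow> \<exists>d\<in>U. col E {x\<in>U. \<not> E d x} \<kappa>"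
    and snk: "\<And>U. U \<subseteq> V \<Longrightarrow> U \<noteq> {} \<Longrightarrow> \<exists>d\<in>U. col E {x\<in>U. \<not> E x d} \<kappa>"
  shows "col E V (2 * (2 * (2 * \<kappa> + 2 * c + 3) + \<kappa>))"
proof -
  have V: "ocm E V" using L by (rule light_ocm)
  \<comment> \<open>A block that is not \<open>R\<close>-colourable must not be exhausted by the
    covers used below, which take \<open>2 * \<kappa> + 2 * c + 1\<close> and
    \<open>\<kappa> + 2 * c + 2\<close> colours.\<close>
  define R where "R = 2 * \<kappa> + 2 * c + 2"
  obtain r :: "'v \<Rightarrow> nat" where r: "inj_on r V" "\<And>v. v \<in> V \<Longrightarrow> col E {x\<in>V. r v \<le> r x \<and> \<not> E v x} \<kappa>"
    using almost_source_order[OF ocm_finite[OF V] src] by blast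
  have irr: "\<not> E x x" if "x \<in> V" for x using ocm_irrefl[OF V that] .
  have "\<exists>\<beta> :: 'v \<Rightarrow> nat. (\<forall>x\<in>V. \<forall>y\<in>V. r x \<le> r y \<longrightarrow> \<beta> x \<le> \<beta> y) \<and>
    (\<forall>i. col E {x\<in>V. \<beta> x = i} (Suc R)) \<and> (\<forall>v\<in>V. \<forall>i<\<beta> v. \<not> col E {x\<in>V. \<beta> x = i} R)"
    by (rule interval_blocks[OF ocm_finite[OF V] r(1)], rule irr)
  then obtain \<beta> :: "'v \<Rightarrow> nat" where \<beta>: "\<forall>x\<in>V. \<forall>y\<in>V. r x \<le> r y \<longrightarrow> \<beta> x \<le> \<beta> y"
    "\<forall>i. col E {x\<in>V. \<beta> x = i} (Suc R)" "\<forall>v\<in>V. \<forall>i<\<beta> v. \<not> col E {x\<in>V. \<beta> x = i} R"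
    by (elim exE conjE)
  note \<beta> = \<beta>[rule_format]
  define blk where "blk i = {x\<in>V. \<beta> x = i}" for i
  have blkV: "blk i \<subseteq> V" for i unfolding blk_def by blast
  have later: "col E {y\<in>blk j. \<not> E z y} \<kappa>" if "z \<in> V" "\<beta> z < j" for z j
  proof (rule col_subset[OF r(2)[OF that(1)]])
    show "{y\<in>blk j. \<not> E z y} \<subseteq> {x\<in>V. r z \<le> r x \<and> \<not> E z x}"
      using \<beta>(1)[OF _ that(1)] that(2) unfolding blk_def by force
  qed
  define P where "P x i \<longleftrightarrow> col E {y\<in>blk i. E y x} (\<kappa> + c)" for x i
  define \<phi> where "\<phi> x = (LEAST i. P x i)" for x
  \<comment> \<open>Beyond the last block there are only empty ones, so \<open>LEAST\<close> in
    \<open>\<phi>\<close> is meaningful.\<close>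
  have "P x (Suc (Max (\<beta> ` V)))" for x
  proof -
    have "\<beta> v \<le> Max (\<beta> ` V)" if "v \<in> V" for v using that ocm_finite[OF V] by simp
    then have "blk (Suc (Max (\<beta> ` V))) = {}" unfolding blk_def by fastforce
    then show ?thesis unfolding P_def by simp
  qed
  then have P\<phi>: "P x (\<phi> x)" for x unfolding \<phi>_def by (rule LeastI)
  have \<phi>_le: "\<phi> x \<le> i" if "P x i" for x i using that unfolding \<phi>_def by (rule Least_le)
  have "col E {x\<in>V. \<phi> x = i} (2 * Suc R + \<kappa>)" for i
  proof -
    have low: "i \<le> Suc (\<beta> x)" if "x \<in> V" "\<phi> x = i" for x
    proof -
      have "col E {y\<in>blk (Suc (\<beta> x)). \<not> E x y} \<kappa>" using later[OF that(1)] by simp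
      then have "P x (Suc (\<beta> x))" unfolding P_def
        by (rule col_mono) (use that(1) ocm_asym[OF V] blkV in auto)
      then show ?thesis using \<phi>_le that(2) by blast
    qed
    \<comment> \<open>Let \<open>z\<close> be an almost sink of block \<open>i\<close>. If
      \<open>z\<close> dominated \<open>x\<close>, the block would consist of in-neighbours of
      \<open>x\<close>, the part of \<open>x\<close>, vertices that miss \<open>z\<close>, and
      returns over the arc \<open>zx\<close>, all cheap. So \<open>x\<close> is one of the few later
      vertices that \<open>z\<close> misses.\<close>
    have far: "col E {x\<in>V. \<phi> x = i \<and> i < \<beta> x} \<kappa>"
    proof (cases "{x\<in>V. \<phi> x = i \<and> i < \<beta> x} = {}")
      case False
      then have nb: "\<not> col E (blk i) R" using \<beta>(3) unfolding blk_def by blast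
      then have "blk i \<noteq> {}" by auto
      then obtain z where z: "z \<in> blk i" "col E {x\<in>blk i. \<not> E x z} \<kappa>" using snk[OF blkV] by blast
      have zV: "z \<in> V" using z(1) blkV by blast
      have "r z \<le> r x \<and> \<not> E z x" if x: "x \<in> V" "\<phi> x = i" "i < \<beta> x" for x
      proof
        show "r z \<le> r x" using \<beta>(1)[OF x(1) zV] x(3) z(1) unfolding blk_def by force
        show "\<not> E z x"
        proof
          assume zx: "E z x"
          have "col E {y\<in>blk i. E y x} (\<kappa> + c)" using P\<phi>[of x] x(2) unfolding P_def by simp
          note 1 = col_Un[OF this col_part[OF V x(1) blkV]]
          note 2 = col_Un[OF z(2) light_col[OF L zV x(1) zx]]
          have "col E (blk i) R"
          proof (rule col_Un_le[OF 1 2])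
            show "blk i \<subseteq> {y \<in> blk i. E y x} \<union> {y \<in> blk i. nadj E x y} \<union>
              ({x \<in> blk i. \<not> E x z} \<union> {w \<in> V. E x w \<and> E w z})"
              using blkV unfolding nadj_def by blast
            show "\<kappa> + c + Suc 0 + (\<kappa> + c) \<le> R" unfolding R_def by simp
          qed
          then show False using nb by simp
        qed
      qed
      then have "{x\<in>V. \<phi> x = i \<and> i < \<beta> x} \<subseteq> {x\<in>V. r z \<le> r x \<and> \<not> E z x}" by blast
      then show ?thesis by (rule col_subset[OF r(2)[OF zV]])
    next
      case True then show ?thesis by (simp only: col_empty)
    qed
    have near: "col E (blk (i - 1) \<union> blk i) (Suc R + Suc R)"
      using col_Un[OF \<beta>(2) \<beta>(2)] unfolding blk_def by blast
    show ?thesis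
    proof (rule col_Un_le[OF near far])
      show "{x\<in>V. \<phi> x = i} \<subseteq> blk (i - 1) \<union> blk i \<union> {x\<in>V. \<phi> x = i \<and> i < \<beta> x}"
        using low unfolding blk_def by force
    qed simp
  qed
  moreover have "\<phi> x \<le> Suc (\<phi> y)" if xy: "x \<in> V" "y \<in> V" "E x y" for x y
  proof (rule \<phi>_le)
    let ?i = "\<phi> y"
    show "P x (Suc ?i)"
    proof (cases "blk (Suc ?i) = {}")
      case True then show ?thesis unfolding P_def by simp
    next
      case False
      then have nb: "\<not> col E (blk ?i) R" using \<beta>(3) unfolding blk_def by auto
      have "col E {z\<in>blk ?i. E z y} (\<kappa> + c)" using P\<phi>[of y] unfolding P_def .
      note 1 = col_Un[OF this col_part[OF V xy(2) blkV[of ?i]]]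
      note 2 = col_Un[OF light_col[OF L xy] col_part[OF V xy(1) blkV[of ?i]]]
      \<comment> \<open>A vertex \<open>z\<close> outside these sets satisfies \<open>E x z\<close>.
        In the next block, an in-neighbour of \<open>x\<close> is missed by \<open>z\<close> or
        closes a triangle over the arc \<open>xz\<close>.\<close>
      have "\<not> blk ?i \<subseteq> {z\<in>blk ?i. E z y} \<union> {z\<in>blk ?i. nadj E y z} \<union>
          ({w\<in>V. E y w \<and> E w x} \<union> {z\<in>blk ?i. nadj E x z})"
      proof
        assume "blk ?i \<subseteq> {z\<in>blk ?i. E z y} \<union> {z\<in>blk ?i. nadj E y z} \<union>
          ({w\<in>V. E y w \<and> E w x} \<union> {z\<in>blk ?i. nadj E x z})"
        then have "col E (blk ?i) R" by (rule col_Un_le[OF 1 2]) (simp add: R_def)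
        with nb show False ..
      qed
      then obtain z where z: "z \<in> blk ?i" "\<not> E z y" "\<not> nadj E y z" "\<not> (E y z \<and> E z x)" "\<not> nadj E x z"
        using blkV by auto
      then have xz: "E x z" unfolding nadj_def by blast
      have zV: "z \<in> V" "\<beta> z < Suc ?i" using z(1) unfolding blk_def by auto
      show ?thesis unfolding P_def
      proof (rule col_Un_le[OF later[OF zV] light_col[OF L xy(1) zV(1) xz]])
        show "{y\<in>blk (Suc ?i). E y x} \<subseteq> {y\<in>blk (Suc ?i). \<not> E z y} \<union> {w\<in>V. E z w \<and> E w x}"
          using blkV by blast
      qed simp
    qed
  qed
  ultimately have "col E V (2 * (2 * Suc R + \<kappa>))" by (intro col_levels[where \<phi> = \<phi>])
  moreover have "2 * (2 * Suc R + \<kappa>) = 2 * (2 * (2 * \<kappa> + 2 * c + 3) + \<kappa>)" unfolding R_def by simp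
  ultimately show ?thesis by (simp only:)
qed

section \<open>Chains of critical bounded sets\<close>

definition jewel :: "('v \<Rightarrow> 'v \<Rightarrow> bool) \<Rightarrow> 'v set \<Rightarrow> nat \<Rightarrow> nat \<Rightarrow> 'v set \<Rightarrow> bool" where
  "jewel E V l r J \<longleftrightarrow> J \<subseteq> V \<and> card J \<le> l \<and> \<not> col E J r \<and> (\<forall>J'. J' \<subset> J \<longrightarrow> col E J' r)"

definition jewel_exception :: "('v \<Rightarrow> 'v \<Rightarrow> bool) \<Rightarrow> 'v set \<Rightarrow> 'v set \<Rightarrow> 'v set" where
  "jewel_exception E V J = (\<Union>a\<in>J. \<Union>b\<in>{b\<in>J. E a b}. {w\<in>V. E b w \<and> E w a}) \<union> (\<Union>a\<in>J. {w\<in>V. nadj E a w})"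

lemma jewelD:
  assumes "jewel E V l r J"
  shows "J \<subseteq> V" "card J \<le> l" "\<not> col E J r" "\<And>J'. J' \<subset> J \<Longrightarrow> col E J' r"
  using assms unfolding jewel_def by auto

lemma jewel_exists:
  assumes "finite V" "A \<subseteq> V" "card A \<le> l" "\<not> col E A r"
  shows "\<exists>J\<subseteq>A. jewel E V l r J"
proof -
  obtain J where J: "J \<subseteq> A \<and> \<not> col E J r" "\<And>J'. J' \<subseteq> A \<and> \<not> col E J' r \<Longrightarrow> card J \<le> card J'"
    using minimal_card[of "\<lambda>J. J \<subseteq> A \<and> \<not> col E J r" A] assms(4) by blast
  have finA: "finite A" using finite_subset[OF assms(2,1)] .
  then have finJ: "finite J" using J(1) finite_subset by blast
  have "card J \<le> l" using card_mono[OF finA, of J] J(1) assms(3) by simp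
  moreover have "col E J' r" if "J' \<subset> J" for J'
    using J(2)[of J'] psubset_card_mono[OF finJ that] that J(1) by auto
  ultimately have "jewel E V l r J" using J(1) assms(2) unfolding jewel_def by auto
  then show ?thesis using J(1) by blast
qed

lemma jewel_exception_col:
  assumes L: "light E V c" and J: "jewel E V l r J"
  shows "col E (jewel_exception E V J) (l * (l * c) + l)"
proof -
  have V: "ocm E V" using L by (rule light_ocm)
  have JV: "J \<subseteq> V" and Jl: "card J \<le> l" using jewelD[OF J] by blast+
  have finJ: "finite J" using finite_subset[OF JV ocm_finite[OF V]] .
  have 1: "col E (\<Union>a\<in>J. \<Union>b\<in>{b\<in>J. E a b}. {w\<in>V. E b w \<and> E w a}) (l * (l * c))"
  proof (intro col_UN_le finJ Jl)
    fix a b assume "a \<in> J" "b \<in> {b\<in>J. E a b}"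
    then show "col E {w\<in>V. E b w \<and> E w a} c" using JV by (intro light_col[OF L]) auto
  next
    fix a show "card {b\<in>J. E a b} \<le> l"
      using card_mono[OF finJ, of "{b\<in>J. E a b}"] Jl by force
  qed (use finJ in simp)
  have 2: "col E (\<Union>a\<in>J. {w\<in>V. nadj E a w}) (l * Suc 0)"
    by (intro col_UN_le finJ Jl) (use col_part[OF V _ order_refl] JV in auto)
  show ?thesis using col_Un[OF 1 2] unfolding jewel_exception_def by simp
qed

text \<open>Otherwise the in-neighbours and the out-neighbours of \<open>x\<close> in
  \<open>J\<close> are proper subsets, \<open>r\<close>-colourable by criticality. An arc from an
  out-neighbour to an in-neighbour would close a triangle with \<open>x\<close>, so by
  \<open>col_dijoin\<close> the same \<open>r\<close> colours suffice for all of
  \<open>J\<close>.\<close>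

lemma jewel_dichotomy:
  assumes V: "ocm E V" and J: "jewel E V l r J" and x: "x \<in> V" "x \<notin> jewel_exception E V J"
  shows "(\<forall>a\<in>J. E x a) \<or> (\<forall>a\<in>J. E a x)"
proof (rule ccontr)
  assume n: "\<not> ?thesis"
  let ?I = "{a\<in>J. E a x}" and ?O = "{a\<in>J. E x a}"
  have JV: "J \<subseteq> V" using jewelD(1)[OF J] .
  have "?I \<subset> J" "?O \<subset> J" using n by blast+
  then have "col E ?I r" "col E ?O r" using jewelD(4)[OF J] by auto
  moreover have "?I \<inter> ?O = {}" using ocm_asym[OF V x(1)] JV by auto
  moreover have "\<not> E b a" if "a \<in> ?I" "b \<in> ?O" for a b
    using x that unfolding jewel_exception_def by blast
  ultimately have "col E (?I \<union> ?O) r" by (rule col_dijoin)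
  moreover have "J \<subseteq> ?I \<union> ?O"
    using x unfolding jewel_exception_def nadj_def by blast
  ultimately show False using col_subset jewelD(3)[OF J] by blast
qed

definition jewel_chain :: "('v \<Rightarrow> 'v \<Rightarrow> bool) \<Rightarrow> 'v set \<Rightarrow> nat \<Rightarrow> nat \<Rightarrow> nat \<Rightarrow> (nat \<Rightarrow> 'v set) \<Rightarrow> bool" where
  "jewel_chain E V l r n J \<longleftrightarrow> (\<forall>i<n. jewel E V l r (J i)) \<and>
     (\<forall>i. Suc i < n \<longrightarrow> (\<forall>a\<in>J i. \<forall>b\<in>J (Suc i). E a b))"

text \<open>\<open>J j\<close> needs more than \<open>2 * c + 2\<close> colours, so besides the
  in-neighbours and the part of \<open>x\<close> it contains some \<open>z\<close> with
  \<open>E x z\<close>. As \<open>z\<close> dominates the next jewel, in-neighbours of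
  \<open>x\<close> there close triangles over the arc \<open>xz\<close>. Returning from
  \<open>2 * c + 1\<close> to \<open>c\<close> keeps errors from piling up along a chain.\<close>

lemma jewel_chain_next:
  assumes L: "light E V c" and ch: "jewel_chain E V l (2 * c + 2) n J"
    and x: "x \<in> V" and j: "Suc j < n" and backward: "col E {y\<in>J j. E y x} (2 * c + 1)"
  shows "col E {y\<in>J (Suc j). E y x} c"
proof -
  have V: "ocm E V" using L by (rule light_ocm)
  have jj: "jewel E V l (2 * c + 2) (J j)" "jewel E V l (2 * c + 2) (J (Suc j))"
    using ch j unfolding jewel_chain_def by auto
  have "\<not> J j \<subseteq> {y\<in>J j. E y x} \<union> {y\<in>J j. nadj E x y}"
  proof
    assume "J j \<subseteq> {y\<in>J j. E y x} \<union> {y\<in>J j. nadj E x y}"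
    then have "col E (J j) (2 * c + 2)"
      by (rule col_Un_le[OF backward col_part[OF V x jewelD(1)[OF jj(1)]]]) simp
    then show False using jewelD(3)[OF jj(1)] by blast
  qed
  then obtain z where z: "z \<in> J j" "E x z" unfolding nadj_def by blast
  have zV: "z \<in> V" using z(1) jewelD(1)[OF jj(1)] by blast
  show ?thesis
  proof (rule col_subset[OF light_col[OF L x zV z(2)]])
    have "\<forall>y\<in>J (Suc j). E z y" using ch j z(1) unfolding jewel_chain_def by blast
    then show "{y\<in>J (Suc j). E y x} \<subseteq> {w\<in>V. E z w \<and> E w x}" using jewelD(1)[OF jj(2)] by blast
  qed
qed

text \<open>This ensures that a longest chain exists. The jewels are disjoint: a vertex of an
  earlier jewel has few in-neighbours in every later one, but if it also lay in a later jewel, the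
  whole predecessor of that jewel would dominate it.\<close>

lemma jewel_chain_length:
  assumes L: "light E V c" and ch: "jewel_chain E V l (2 * c + 2) n J"
  shows "n \<le> card V"
proof -
  have V: "ocm E V" using L by (rule light_ocm)
  have jw: "jewel E V l (2 * c + 2) (J i)" if "i < n" for i using ch that unfolding jewel_chain_def by blast
  have arc: "E a b" if "Suc i < n" "a \<in> J i" "b \<in> J (Suc i)" for i a b
    using ch that unfolding jewel_chain_def by blast
  have backward: "col E {y\<in>J j. E y x} c" if "i < j" "j < n" "x \<in> J i" for i j x
    using that
  proof (induction j)
    case (Suc j)
    have xV: "x \<in> V" using jewelD(1)[OF jw, of i] Suc.prems by auto
    show ?case
    proof (cases "j = i")
      case True
      have "\<not> E y x" if "y \<in> J (Suc j)" for y
        using arc[of i x y] ocm_asym[OF V xV, of y] jewelD(1)[OF jw, of "Suc j"] that Suc.prems True by auto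
      then have "{y\<in>J (Suc j). E y x} = {}" by blast
      then show ?thesis by (simp only: col_empty)
    next
      case False
      then have "col E {y\<in>J j. E y x} c" using Suc by simp
      then have "col E {y\<in>J j. E y x} (2 * c + 1)" by (rule col_mono) auto
      then show ?thesis using jewel_chain_next[OF L ch xV] Suc.prems(2) by blast
    qed
  qed simp
  have disj: "J i \<inter> J j = {}" if ij: "i < j" "j < n" for i j
  proof (rule ccontr)
    assume "J i \<inter> J j \<noteq> {}"
    then obtain x where x: "x \<in> J i" "x \<in> J j" by blast
    have xV: "x \<in> V" using jewelD(1)[OF jw[OF ij(2)]] x(2) by blast
    obtain k where k: "j = Suc k" using ij by (cases j) auto
    show False
    proof (cases "k = i")
      case True
      then show False using arc[of i x x] ocm_irrefl[OF V xV] x k ij by simp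
    next
      case False
      then have "col E {y\<in>J k. E y x} c" using backward[of i k x] x k ij by simp
      moreover have "{y\<in>J k. E y x} = J k" using arc[of k _ x] x k ij by auto
      ultimately have "col E (J k) (2 * c + 2)" by (auto intro: col_mono)
      then show False using jewelD(3)[OF jw, of k] k ij by simp
    qed
  qed
  have "\<exists>x. x \<in> J i" if "i < n" for i using jewelD(3)[OF jw[OF that]] by (metis col_empty ex_in_conv)
  then obtain m where m: "\<And>i. i < n \<Longrightarrow> m i \<in> J i" by metis
  have "inj_on m {..<n}"
  proof (rule linorder_inj_onI)
    fix i j assume "i < j" "i \<in> {..<n}" "j \<in> {..<n}"
    then show "m i \<noteq> m j" using disj[of i j] m[of i] m[of j] by auto
  qed auto
  moreover have "m ` {..<n} \<subseteq> V" using m jewelD(1)[OF jw] by blast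
  ultimately show ?thesis using card_inj_on_le[of m "{..<n}" V] ocm_finite[OF V] by simp
qed

lemma jewel_chain_insert:
  assumes ch: "jewel_chain E V l r n J" and K: "jewel E V l r K" and i: "i \<le> n"
    and into_K: "\<And>a b. 0 < i \<Longrightarrow> a \<in> J (i - 1) \<Longrightarrow> b \<in> K \<Longrightarrow> E a b"
    and from_K: "\<And>a b. i < n \<Longrightarrow> a \<in> K \<Longrightarrow> b \<in> J i \<Longrightarrow> E a b"
  shows "jewel_chain E V l r (Suc n) (\<lambda>k. if k < i then J k else if k = i then K else J (k - 1))"
  unfolding jewel_chain_def
proof (intro conjI allI impI ballI)
  fix k assume "k < Suc n"
  then show "jewel E V l r (if k < i then J k else if k = i then K else J (k - 1))"
    using ch K i unfolding jewel_chain_def by auto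
next
  fix k a b
  assume k: "Suc k < Suc n" and a: "a \<in> (if k < i then J k else if k = i then K else J (k - 1))"
    and b: "b \<in> (if Suc k < i then J (Suc k) else if Suc k = i then K else J (Suc k - 1))"
  have old: "E a b" if "Suc m < n" "a \<in> J m" "b \<in> J (Suc m)" for m
    using ch that unfolding jewel_chain_def by blast
  consider "Suc k < i" | "Suc k = i" | "k = i" | "i < k" by linarith
  then show "E a b"
  proof cases
    case 1 then show ?thesis using old[of k] a b i by simp
  next
    case 2 then show ?thesis using into_K[of a b] a b by auto
  next
    case 3 then show ?thesis using from_K[of a b] a b k by simp
  next
    case 4
    then obtain k' where "k = Suc k'" by (cases k) auto
    then show ?thesis using old[of k'] a b k 4 by simp
  qed
qed

text \<open>The potential of \<open>x\<close> is the first jewel of a longest chain in which the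
  in-neighbours of \<open>x\<close> need few colours. Apart from the exceptions of two jewels, level
  \<open>i\<close> is complete from \<open>J (i - 1)\<close> and complete to \<open>J i\<close>, so
  a jewel inside it could be inserted at position \<open>i\<close>. Hence the level is
  \<open>g\<close>-colourable.\<close>

lemma light_jewel_col:
  assumes L: "light E V c"
    and sup: "\<And>U. U \<subseteq> V \<Longrightarrow> \<not> col E U g \<Longrightarrow> \<exists>A\<subseteq>U. card A \<le> l \<and> \<not> col E A (2 * c + 2)"
  shows "col E V (2 * (g + ((l * (l * c) + l) + (l * (l * c) + l))))"
proof -
  have V: "ocm E V" using L by (rule light_ocm)
  let ?ch = "jewel_chain E V l (2 * c + 2)" and ?x = "l * (l * c) + l"
  define N where "N = {n. \<exists>J. ?ch n J}"
  have "?ch 0 (\<lambda>_. {})" unfolding jewel_chain_def by simp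
  then have N0: "N \<noteq> {}" unfolding N_def by blast
  have "N \<subseteq> {..card V}" using jewel_chain_length[OF L] unfolding N_def by auto
  then have finN: "finite N" by (rule finite_subset) simp
  define n where "n = Max N"
  have "n \<in> N" unfolding n_def using finN N0 by (rule Max_in)
  then obtain J where J: "?ch n J" unfolding N_def by blast
  have n_max: "m \<le> n" if "?ch m J'" for m J'
    unfolding n_def by (rule Max_ge[OF finN]) (use that in \<open>auto simp: N_def\<close>)
  have jw: "jewel E V l (2 * c + 2) (J i)" if "i < n" for i using J that unfolding jewel_chain_def by blast
  \<comment> \<open>The disjunct \<open>n \<le> i\<close> makes the potential of every vertex at
    most \<open>n\<close>, the position at the end of the chain.\<close>
  define P where "P x i \<longleftrightarrow> n \<le> i \<or> col E {y\<in>J i. E y x} c" for x i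
  define \<phi> where "\<phi> x = (LEAST i. P x i)" for x
  have \<phi>_le: "\<phi> x \<le> i" if "P x i" for x i using that unfolding \<phi>_def by (rule Least_le)
  have "P x n" for x unfolding P_def by simp
  then have P\<phi>: "P x (\<phi> x)" and \<phi>n: "\<phi> x \<le> n" for x unfolding \<phi>_def by (rule LeastI, rule Least_le)
  have "col E {x\<in>V. \<phi> x = i} (g + (?x + ?x))" for i
  proof -
    define X1 where "X1 = (if i < n then jewel_exception E V (J i) else {})"
    define X2 where "X2 = (if 0 < i \<and> i - 1 < n then jewel_exception E V (J (i - 1)) else {})"
    have X: "col E (X1 \<union> X2) (?x + ?x)"
      by (rule col_Un) (use jewel_exception_col[OF L jw] in \<open>auto simp: X1_def X2_def\<close>)
    let ?U = "{x\<in>V. \<phi> x = i} - (X1 \<union> X2)"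
    have from_K: "E x b" if x: "x \<in> ?U" and "i < n" "b \<in> J i" for x b
    proof -
      have "col E {y\<in>J i. E y x} c" using P\<phi>[of x] x \<open>i < n\<close> unfolding P_def by auto
      then have "\<not> (\<forall>a\<in>J i. E a x)"
        using jewelD(3)[OF jw[OF \<open>i < n\<close>]] col_mono[of E "{y\<in>J i. E y x}" c "J i" "2 * c + 2"] by auto
      moreover have "x \<notin> jewel_exception E V (J i)" using x \<open>i < n\<close> unfolding X1_def by auto
      ultimately show ?thesis using jewel_dichotomy[OF V jw[OF \<open>i < n\<close>]] x \<open>b \<in> J i\<close> by blast
    qed
    have into_K: "E a x" if x: "x \<in> ?U" and i: "0 < i" and a: "a \<in> J (i - 1)" for x a
    proof -
      have phx: "\<phi> x = i" "x \<in> V" using x by auto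
      have "\<not> P x (i - 1)" using \<phi>_le[of x "i - 1"] phx(1) i by auto
      then have i1: "i - 1 < n" "\<not> col E {y\<in>J (i - 1). E y x} c" unfolding P_def by auto
      then have "{y\<in>J (i - 1). E y x} \<noteq> {}" by (metis col_empty)
      then obtain y where y: "y \<in> J (i - 1)" "E y x" by blast
      have "y \<in> V" using y(1) jewelD(1)[OF jw[OF i1(1)]] by blast
      then have "\<not> E x y" using ocm_asym[OF V] y(2) phx(2) by blast
      moreover have "x \<notin> jewel_exception E V (J (i - 1))" using x i i1(1) unfolding X2_def by auto
      ultimately show ?thesis using jewel_dichotomy[OF V jw[OF i1(1)] phx(2)] y(1) a by blast
    qed
    have "col E ?U g"
    proof (rule ccontr)
      assume nc: "\<not> ?thesis"
      have UV: "?U \<subseteq> V" by blast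
      obtain A where A: "A \<subseteq> ?U" "card A \<le> l" "\<not> col E A (2 * c + 2)" using sup[OF UV nc] by blast
      obtain K where K: "K \<subseteq> A" "jewel E V l (2 * c + 2) K"
        using jewel_exists[OF ocm_finite[OF V] subset_trans[OF A(1) UV] A(2,3)] by blast
      have KU: "K \<subseteq> ?U" using K(1) A(1) by (rule subset_trans)
      then have "i \<le> n" using \<phi>n jewelD(3)[OF K(2)] by (cases "K = {}") auto
      then have "?ch (Suc n) (\<lambda>k. if k < i then J k else if k = i then K else J (k - 1))"
        by (rule jewel_chain_insert[OF J K(2)]) (use into_K from_K KU in blast)+
      then have "Suc n \<le> n" by (rule n_max)
      then show False by simp
    qed
    then show ?thesis by (rule col_Un_le[OF _ X]) auto
  qed
  moreover have "\<phi> x \<le> Suc (\<phi> y)" if xy: "x \<in> V" "y \<in> V" "E x y" for x y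
  proof (rule \<phi>_le)
    let ?i = "\<phi> y"
    show "P x (Suc ?i)"
    proof (cases "Suc ?i < n")
      case False then show ?thesis unfolding P_def by simp
    next
      case True
      then have i: "?i < n" by simp
      then have 1: "col E {z\<in>J ?i. E z y} c" using P\<phi>[of y] unfolding P_def by auto
      note 2 = col_Un[OF 1 col_part[OF V xy(2) jewelD(1)[OF jw[OF i]]]]
      have "col E {z\<in>J ?i. E z x} (2 * c + 1)"
      proof (rule col_Un_le[OF 2 light_col[OF L xy]])
        show "{z\<in>J ?i. E z x} \<subseteq> {z\<in>J ?i. E z y} \<union> {z\<in>J ?i. nadj E y z} \<union> {w\<in>V. E y w \<and> E w x}"
          using jewelD(1)[OF jw[OF i]] unfolding nadj_def by blast
      qed simp
      then show ?thesis unfolding P_def using jewel_chain_next[OF L J xy(1) True] by blast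
    qed
  qed
  ultimately show ?thesis by (intro col_levels[where \<phi> = \<phi>])
qed

text \<open>Without a bounded set that is not (\<open>2 * c + 2\<close>)-colourable, all subsets are
  covered in both directions and have almost sources and almost sinks; \<open>g\<close> is the bound
  for this case. So every \<open>U\<close> that is not \<open>g\<close>-colourable contains such a
  set, as jewel chains require.\<close>

theorem light_bounded:
  "\<exists>C. \<forall>(E :: 'v \<Rightarrow> 'v \<Rightarrow> bool) V. light E V c \<longrightarrow> col E V C"
proof -
  obtain K l where Kl: "\<And>(E :: 'v \<Rightarrow> 'v \<Rightarrow> bool) V. ocm E V \<Longrightarrow> \<not> covered E V K \<Longrightarrow>
     (\<exists>A\<subseteq>V. card A \<le> l \<and> \<not> col E A (2 * c + 2))"
    using uncovered_imp_bounded_chromatic[of "2 * c + 2"] by metis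
  define \<kappa> where "\<kappa> = K * (4 * Suc c) + K"
  define g where "g = 2 * (2 * (2 * \<kappa> + 2 * c + 3) + \<kappa>)"
  have g: "col E V g" if L: "light E V c" and none: "\<not> (\<exists>A\<subseteq>V. card A \<le> l \<and> \<not> col E A (2 * c + 2))"
    for E :: "'v \<Rightarrow> 'v \<Rightarrow> bool" and V
    unfolding g_def
  proof (rule light_almost_source_col[OF L])
    fix U assume U: "U \<subseteq> V" "U \<noteq> {}"
    have oU: "ocm E U" using ocm_subset[OF light_ocm[OF L] U(1)] .
    have none': "\<not> (\<exists>A\<subseteq>U. card A \<le> l \<and> \<not> col E A (2 * c + 2))" using none U(1) by blast
    have "covered E U K" using Kl[OF oU] none' by blast
    then show "\<exists>d\<in>U. col E {x\<in>U. \<not> E d x} \<kappa>"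
      unfolding \<kappa>_def by (rule covered_almost_source[OF L U])
    have "covered (\<lambda>x y. E y x) U K" using Kl[OF ocm_rev[OF oU]] none' col_rev[of E] by blast
    then have "\<exists>d\<in>U. col (\<lambda>x y. E y x) {x\<in>U. \<not> E x d} \<kappa>"
      unfolding \<kappa>_def by (rule covered_almost_source[OF light_rev[OF L] U])
    then show "\<exists>d\<in>U. col E {x\<in>U. \<not> E x d} \<kappa>" unfolding col_rev[of E] .
  qed
  have "col E V (2 * (g + ((l * (l * c) + l) + (l * (l * c) + l))))" if L: "light E V c" for E :: "'v \<Rightarrow> 'v \<Rightarrow> bool" and V
  proof (rule light_jewel_col[OF L])
    show "\<exists>A\<subseteq>U. card A \<le> l \<and> \<not> col E A (2 * c + 2)" if "U \<subseteq> V" "\<not> col E U g" for U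
      using g[OF light_subset[OF L that(1)]] that(2) by blast
  qed
  then show ?thesis by blast
qed

section \<open>An ordered graph of large chromatic number and its double shift\<close>

lemma prefix_imp_le: "prefix xs ys \<Longrightarrow> (xs :: 'a :: linorder list) \<le> ys"
  by (induction xs arbitrary: ys) (auto simp: prefix_def)

text \<open>In the lexicographic order, which is preorder on the tree, the descendants of a node
  form an interval.\<close>

lemma between_prefix: "(j :: 'a :: linorder list) \<le> r \<Longrightarrow> r \<le> k \<Longrightarrow> prefix j k \<Longrightarrow> prefix j r"
proof (induction j arbitrary: r k)
  case (Cons a j)
  from Cons.prems(3) obtain k' where k: "k = a # k'" "prefix j k'" by (auto simp: prefix_def)
  from Cons.prems(1) obtain b r' where r: "r = b # r'" by (cases r) auto
  with Cons.prems(1,2) k have "b = a" "j \<le> r'" "r' \<le> k'" by auto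
  then show ?case using Cons.IH[of r' k'] k r by simp
qed simp

text \<open>The last letter of a node encodes the lengths of the prefixes adjacent to it, so that letter \<open>j - 1\<close>
  of \<open>s\<close> belongs to the prefix of length \<open>j\<close>.\<close>
definition tree_adj :: "nat list \<Rightarrow> nat list \<Rightarrow> bool" where
  "tree_adj i j \<longleftrightarrow> strict_prefix i j \<and> length i \<in> set_decode (last j)"

definition noncrossing :: "nat list \<Rightarrow> bool" where
  "noncrossing s \<longleftrightarrow> (\<forall>i q j r. i < q \<longrightarrow> q < j \<longrightarrow> j < r \<longrightarrow> r \<le> length s \<longrightarrow>
     i \<in> set_decode (s ! (j - 1)) \<longrightarrow> q \<notin> set_decode (s ! (r - 1)))"

text \<open>Letters below \<open>2 ^ Suc n\<close> encode all sets of lengths up to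
  \<open>n\<close>.\<close>

definition nodes :: "nat \<Rightarrow> nat list set" where
  "nodes n = {s. noncrossing s \<and> length s \<le> n \<and> set s \<subseteq> {..<2 ^ Suc n}}"

text \<open>A visible prefix can still be joined to a new node below \<open>s\<close> without creating a crossing.\<close>
definition visible :: "nat list \<Rightarrow> nat \<Rightarrow> bool" where
  "visible s q \<longleftrightarrow> (\<forall>j. q < j \<longrightarrow> j \<le> length s \<longrightarrow> (\<forall>i\<in>set_decode (s ! (j - 1)). q \<le> i))"

lemma finite_nodes: "finite (nodes n)"
proof (rule finite_subset)
  show "nodes n \<subseteq> {s. set s \<subseteq> {..<2 ^ Suc n} \<and> length s \<le> n}" unfolding nodes_def by auto
qed (rule finite_lists_length_le, simp)

lemma noncrossing_prefix: "noncrossing (s @ u) \<Longrightarrow> noncrossing s"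
  unfolding noncrossing_def
proof (intro allI impI)
  fix i q j r
  assume nc: "\<forall>i q j r. i < q \<longrightarrow> q < j \<longrightarrow> j < r \<longrightarrow> r \<le> length (s @ u) \<longrightarrow>
      i \<in> set_decode ((s @ u) ! (j - 1)) \<longrightarrow> q \<notin> set_decode ((s @ u) ! (r - 1))"
    and h: "i < q" "q < j" "j < r" "r \<le> length s" "i \<in> set_decode (s ! (j - 1))"
  have "(s @ u) ! (j - 1) = s ! (j - 1)" "(s @ u) ! (r - 1) = s ! (r - 1)" using h by (auto simp: nth_append)
  then show "q \<notin> set_decode (s ! (r - 1))" using nc[rule_format, of i q j r] h by simp
qed

lemma nodes_prefix: "s @ u \<in> nodes n \<Longrightarrow> s \<in> nodes n"
  unfolding nodes_def using noncrossing_prefix by auto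

lemma noncrossing_snoc:
  assumes "noncrossing s" "\<And>q. q \<in> set_decode x \<Longrightarrow> visible s q"
  shows "noncrossing (s @ [x])"
  unfolding noncrossing_def
proof (intro allI impI)
  fix i q j r
  assume h: "i < q" "q < j" "j < r" "r \<le> length (s @ [x])" "i \<in> set_decode ((s @ [x]) ! (j - 1))"
  then have j: "(s @ [x]) ! (j - 1) = s ! (j - 1)" by (auto simp: nth_append)
  show "q \<notin> set_decode ((s @ [x]) ! (r - 1))"
  proof (cases "r \<le> length s")
    case True
    then have "(s @ [x]) ! (r - 1) = s ! (r - 1)" using h by (auto simp: nth_append)
    then show ?thesis using assms(1) h True j unfolding noncrossing_def by metis
  next
    case False
    then have "r = Suc (length s)" using h by simp
    then have r: "(s @ [x]) ! (r - 1) = x" by simp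
    show ?thesis
    proof
      assume "q \<in> set_decode ((s @ [x]) ! (r - 1))"
      then have "visible s q" using assms(2) r by simp
      then have "q \<le> i" using h j False unfolding visible_def by simp
      then show False using h by simp
    qed
  qed
qed

text \<open>The edge from \<open>j\<close> to \<open>k\<close> puts \<open>r\<close> below
  \<open>j\<close>, since \<open>r\<close> lies between them. Then \<open>q\<close>, a prefix of
  \<open>r\<close> that comes before \<open>j\<close>, is a prefix of \<open>j\<close>, and likewise
  \<open>i\<close> is a prefix of \<open>q\<close>. On the branch of \<open>r\<close> the edges from
  \<open>i\<close> to \<open>j\<close> and from \<open>q\<close> to \<open>r\<close> cross.\<close>

lemma tree_adj_pattern:
  assumes "tree_adj i j" "tree_adj j k" "tree_adj q r" "noncrossing r"
    and ord: "i < q" "q < j" "j < r" "r < k"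
  shows False
proof -
  have sp: "strict_prefix i j" "strict_prefix j k" "strict_prefix q r" using assms unfolding tree_adj_def by auto
  have jr: "prefix j r" using between_prefix[of j r k] ord sp by (simp add: strict_prefix_def)
  have "\<not> prefix j q" using prefix_imp_le[of j q] ord by auto
  then have qj: "prefix q j" using prefix_same_cases[of j r q] jr sp(3) by (auto simp: strict_prefix_def)
  have "\<not> prefix q i" using prefix_imp_le[of q i] ord by auto
  then have iq: "prefix i q" using prefix_same_cases[of i j q] qj sp(1) by (auto simp: strict_prefix_def)
  have lens: "length i < length q" "length q < length j" "length j < length r"
    using iq qj jr ord by (auto intro!: prefix_length_less simp: strict_prefix_def)
  obtain w where w: "r = j @ w" using jr by (auto simp: prefix_def)
  have "last j = r ! (length j - 1)" using w lens by (subst last_conv_nth) (auto simp: nth_append)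
  then have 1: "length i \<in> set_decode (r ! (length j - 1))" using assms(1) unfolding tree_adj_def by simp
  have "last r = r ! (length r - 1)" using lens by (subst last_conv_nth) auto
  then have "length q \<in> set_decode (r ! (length r - 1))" using assms(3) unfolding tree_adj_def by simp
  then show False using assms(4) lens 1 unfolding noncrossing_def by blast
qed

section \<open>Forcing many colours on one branch of the tree\<close>

lemma set_encode_less:
  assumes "T \<subseteq> {..n}" shows "set_encode T < 2 ^ Suc n"
proof -
  have "set_encode T \<le> (\<Sum>i\<in>{0..<Suc n}. 2 ^ i)"
    unfolding set_encode_def by (rule sum_mono2) (use assms in auto)
  also have "\<dots> < 2 ^ Suc n" by (subst sum_power2) simp
  finally show ?thesis .
qed

text \<open>Letters spent per colour: two recursive extensions and possibly one new node.\<close>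

fun rounds :: "nat \<Rightarrow> nat" where
  "rounds 0 = 0"
| "rounds (Suc k) = Suc (rounds k + rounds k)"

text \<open>\<open>T\<close> consists of lengths of nodes on the branch \<open>s @ u\<close>. The
  condition on letters says that the new edges do not reach back to \<open>s\<close>, so lengths up
  to \<open>length s\<close> that were visible stay visible.\<close>

definition forces :: "(nat list \<Rightarrow> 'c) \<Rightarrow> nat \<Rightarrow> nat list \<Rightarrow> nat \<Rightarrow> nat list \<Rightarrow> nat set \<Rightarrow> bool" where
  "forces f n s k u T \<longleftrightarrow> length u \<le> rounds k \<and> s @ u \<in> nodes n \<and>
    (\<forall>j i. length s < j \<longrightarrow> j \<le> length (s @ u) \<longrightarrow> i \<in> set_decode ((s @ u) ! (j - 1)) \<longrightarrow> length s < i) \<and>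
    (\<forall>q\<in>T. length s < q \<and> q \<le> length (s @ u) \<and> visible (s @ u) q) \<and>
    k \<le> card ((\<lambda>q. f (take q (s @ u))) ` T)"

lemma forcesD:
  assumes "forces f n s k u T"
  shows "length u \<le> rounds k" "s @ u \<in> nodes n"
    "\<And>j i. length s < j \<Longrightarrow> j \<le> length (s @ u) \<Longrightarrow> i \<in> set_decode ((s @ u) ! (j - 1)) \<Longrightarrow> length s < i"
    "\<And>q. q \<in> T \<Longrightarrow> length s < q \<and> q \<le> length (s @ u) \<and> visible (s @ u) q"
    "k \<le> card ((\<lambda>q. f (take q (s @ u))) ` T)"
  using assms unfolding forces_def by blast+

text \<open>Two successive extensions make sets \<open>T\<close> and \<open>R\<close> visible, each
  with \<open>k\<close> colours. If both show the same \<open>k\<close> colours, a node joined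
  exactly to the nodes of \<open>R\<close> has a new colour; as \<open>R\<close> lies beyond
  \<open>T\<close>, it leaves \<open>T\<close> visible.\<close>

lemma force_colours:
  fixes f :: "nat list \<Rightarrow> 'c"
  assumes proper: "\<And>i j. i \<in> nodes n \<Longrightarrow> j \<in> nodes n \<Longrightarrow> tree_adj i j \<Longrightarrow> f i \<noteq> f j"
    and "s \<in> nodes n" "length s + rounds k \<le> n"
  shows "\<exists>u T. forces f n s k u T"
  using assms(2,3)
proof (induction k arbitrary: s)
  case 0
  then show ?case by (intro exI[of _ "[]"] exI[of _ "{}"]) (auto simp: forces_def)
next
  case (Suc k)
  have "length s + rounds k \<le> n" using Suc.prems(2) by simp
  then obtain u T where "forces f n s k u T" using Suc.IH[OF Suc.prems(1)] by blast
  note u = forcesD(1,2)[OF this] and uS = forcesD(3)[OF this] and T = forcesD(4)[OF this] and cT = forcesD(5)[OF this]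
  define t where "t = s @ u"
  have "t \<in> nodes n" "length t + rounds k \<le> n" using u Suc.prems(2) unfolding t_def by auto
  then obtain v R where "forces f n t k v R" using Suc.IH by blast
  note v = forcesD(1,2)[OF this] and vS = forcesD(3)[OF this] and R = forcesD(4)[OF this] and cR = forcesD(5)[OF this]
  define w where "w = t @ v"
  have lt: "length t = length s + length u" unfolding t_def by simp
  have wS: "length s < i" if "length s < j" "j \<le> length w" "i \<in> set_decode (w ! (j - 1))" for j i
  proof (cases "j \<le> length t")
    case True
    then have "w ! (j - 1) = t ! (j - 1)" using that unfolding w_def by (auto simp: nth_append)
    then show ?thesis using uS[of j i] that True unfolding t_def by simp
  next
    case False
    then have "length t < i" using vS[of j i] that unfolding w_def by simp
    then show ?thesis using lt by simp
  qed
  have Tw: "length s < q \<and> q \<le> length t \<and> visible w q" if q: "q \<in> T" for q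
  proof (intro conjI)
    show "length s < q" "q \<le> length t" using T[OF q] unfolding t_def by auto
    show "visible w q" unfolding visible_def
    proof (intro allI impI ballI)
      fix j i assume j: "q < j" "j \<le> length w" "i \<in> set_decode (w ! (j - 1))"
      show "q \<le> i"
      proof (cases "j \<le> length t")
        case True
        then have "w ! (j - 1) = t ! (j - 1)" using j unfolding w_def by (auto simp: nth_append)
        then show ?thesis using T[OF q] j True unfolding t_def[symmetric] visible_def by auto
      next
        case False
        then have "length t < i" using vS[of j i] j unfolding w_def by simp
        then show ?thesis using T[OF q] unfolding t_def[symmetric] by simp
      qed
    qed
  qed
  have Rw: "length t < q \<and> q \<le> length w \<and> visible w q" if "q \<in> R" for q using R[OF that] unfolding w_def .
  define col where "col q = f (take q w)" for q
  have colT: "(\<lambda>q. f (take q (s @ u))) ` T = col ` T"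
    by (rule image_cong) (use Tw in \<open>auto simp: col_def w_def t_def[symmetric]\<close>)
  have finT: "finite T" by (rule finite_subset[of _ "{..length t}"]) (use Tw in auto)
  have finR: "finite R" by (rule finite_subset[of _ "{..length w}"]) (use Rw in auto)
  have kT: "k \<le> card (col ` T)" using cT colT by simp
  have kR: "k \<le> card (col ` R)" using cR unfolding col_def w_def .
  have sw: "s @ (u @ v) = w" unfolding w_def t_def by simp
  have wn: "w \<in> nodes n" using v(2) unfolding w_def .
  show ?case
  proof (cases "Suc k \<le> card (col ` (T \<union> R))")
    case True
    show ?thesis
    proof (rule exI[of _ "u @ v"], rule exI[of _ "T \<union> R"], unfold forces_def sw, intro conjI allI impI ballI)
      show "length (u @ v) \<le> rounds (Suc k)" using u(1) v(1) by simp
      show "w \<in> nodes n" by fact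
      show "length s < i" if "length s < j" "j \<le> length w" "i \<in> set_decode (w ! (j - 1))" for j i
        using wS that by blast
      show "Suc k \<le> card ((\<lambda>q. f (take q w)) ` (T \<union> R))" using True unfolding col_def .
      fix q assume "q \<in> T \<union> R"
      then have "length s < q \<and> q \<le> length w \<and> visible w q" using Tw[of q] Rw[of q] lt unfolding w_def by auto
      then show "length s < q" "q \<le> length w" "visible w q" by auto
    qed
  next
    case False
    then have le: "card (col ` (T \<union> R)) \<le> k" by simp
    have "col ` T = col ` (T \<union> R)" using le kT finT finR by (intro card_seteq) auto
    moreover have "col ` R = col ` (T \<union> R)" using le kR finT finR by (intro card_seteq) auto
    ultimately have eq: "col ` T = col ` R" by simp
    define x where "x = set_encode R"
    have dx: "set_decode x = R" unfolding x_def using finR by (rule set_encode_inverse)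
    define s' where "s' = w @ [x]"
    have ls': "length s' = Suc (length w)" unfolding s'_def by simp
    have lw: "Suc (length w) \<le> n" using u(1) v(1) Suc.prems(2) unfolding w_def t_def by simp
    have "R \<subseteq> {..n}" using Rw lw by fastforce
    then have "x < 2 ^ Suc n" unfolding x_def by (rule set_encode_less)
    moreover have "noncrossing s'" unfolding s'_def
      by (rule noncrossing_snoc) (use wn Rw dx in \<open>auto simp: nodes_def\<close>)
    ultimately have s'n: "s' \<in> nodes n" using wn lw unfolding nodes_def s'_def by auto
    have new: "f s' \<notin> col ` R"
    proof
      assume "f s' \<in> col ` R"
      then obtain q where q: "q \<in> R" "f s' = f (take q w)" unfolding col_def by auto
      have "take q w \<in> nodes n" using nodes_prefix[of "take q w" "drop q w"] wn by simp
      moreover have "tree_adj (take q w) s'" unfolding tree_adj_def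
      proof
        show "strict_prefix (take q w) s'" unfolding s'_def strict_prefix_def
          by (metis append_Nil2 append_assoc append_eq_conv_conj butlast_snoc length_append_singleton
              length_take lessI min.cobounded1 not_le prefix_def same_append_eq take_is_prefix)
        show "length (take q w) \<in> set_decode (last s')" using q Rw[of q] dx unfolding s'_def by simp
      qed
      ultimately show False using proper[OF _ s'n] q(2) by metis
    qed
    have s_eq: "s @ (u @ v @ [x]) = s'" unfolding s'_def w_def t_def by simp
    have nth_w: "s' ! (j - 1) = w ! (j - 1)" if "j \<le> length w" "0 < j" for j
      using that unfolding s'_def by (auto simp: nth_append)
    have nth_x: "s' ! (Suc (length w) - 1) = x" unfolding s'_def by simp
    have S': "length s < i" if "length s < j" "j \<le> length s'" "i \<in> set_decode (s' ! (j - 1))" for j i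
    proof (cases "j \<le> length w")
      case True
      then show ?thesis using wS[of j i] that nth_w by simp
    next
      case False
      then have "j = Suc (length w)" using that ls' by simp
      then have "i \<in> R" using that nth_x dx by simp
      then show ?thesis using Rw[of i] lt by simp
    qed
    have V': "visible s' q" if q: "q \<in> insert (Suc (length w)) T" for q
      unfolding visible_def
    proof (intro allI impI ballI)
      fix j i assume j: "q < j" "j \<le> length s'" "i \<in> set_decode (s' ! (j - 1))"
      then have qT: "q \<in> T" using q ls' by auto
      show "q \<le> i"
      proof (cases "j \<le> length w")
        case True
        then show ?thesis using Tw[OF qT] j nth_w unfolding visible_def by simp
      next
        case False
        then have "j = Suc (length w)" using j ls' by simp
        then have "i \<in> R" using j nth_x dx by simp
        then show ?thesis using Rw[of i] Tw[OF qT] by simp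
      qed
    qed
    have colT': "(\<lambda>q. f (take q s')) ` insert (Suc (length w)) T = insert (f s') (col ` T)"
    proof -
      have "f (take q s') = col q" if "q \<in> T" for q
        using Tw[OF that] unfolding col_def s'_def w_def by simp
      then show ?thesis using ls' by (simp add: image_iff cong: image_cong)
    qed
    have "Suc k \<le> card (insert (f s') (col ` T))" using new eq kT finR by simp
    then have card': "Suc k \<le> card ((\<lambda>q. f (take q s')) ` insert (Suc (length w)) T)" unfolding colT' .
    show ?thesis
    proof (rule exI[of _ "u @ v @ [x]"], rule exI[of _ "insert (Suc (length w)) T"], unfold forces_def s_eq, intro conjI allI impI ballI)
      show "length (u @ v @ [x]) \<le> rounds (Suc k)" using u(1) v(1) by simp
      show "s' \<in> nodes n" by fact
      show "length s < i" if "length s < j" "j \<le> length s'" "i \<in> set_decode (s' ! (j - 1))" for j i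
        using S' that by blast
      fix q assume q: "q \<in> insert (Suc (length w)) T"
      show "visible s' q" using V' q .
      show "length s < q" "q \<le> length s'" using q Tw[of q] ls' unfolding w_def t_def by auto
    next
      show "Suc k \<le> card ((\<lambda>q. f (take q s')) ` insert (Suc (length w)) T)" by fact
    qed
  qed
qed

lemma nodes_chromatic:
  fixes f :: "nat list \<Rightarrow> 'c"
  assumes "\<And>i j. i \<in> nodes (rounds k) \<Longrightarrow> j \<in> nodes (rounds k) \<Longrightarrow> tree_adj i j \<Longrightarrow> f i \<noteq> f j"
  shows "k \<le> card (f ` nodes (rounds k))"
proof -
  have "[] \<in> nodes (rounds k)" unfolding nodes_def noncrossing_def by simp
  from force_colours[of "rounds k" f "[]" k, OF assms this] obtain u T where
    u: "u \<in> nodes (rounds k)" and c: "k \<le> card ((\<lambda>q. f (take q u)) ` T)"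
    by (auto dest: forcesD(2,5))
  have "take q u \<in> nodes (rounds k)" for q using nodes_prefix[of "take q u" "drop q u"] u by simp
  then have "(\<lambda>q. f (take q u)) ` T \<subseteq> f ` nodes (rounds k)" by blast
  then have "card ((\<lambda>q. f (take q u)) ` T) \<le> card (f ` nodes (rounds k))"
    using finite_nodes by (intro card_mono) auto
  with c show ?thesis by simp
qed

section \<open>The double shift\<close>

type_synonym triple = "nat list \<times> nat list \<times> nat list"

fun left :: "triple \<Rightarrow> nat list" where "left (i, j, k) = i"
fun mid :: "triple \<Rightarrow> nat list" where "mid (i, j, k) = j"
fun right :: "triple \<Rightarrow> nat list" where "right (i, j, k) = k"

definition triples :: "nat \<Rightarrow> triple set" where
  "triples n = {p. left p \<in> nodes n \<and> mid p \<in> nodes n \<and> right p \<in> nodes n \<and>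
     tree_adj (left p) (mid p) \<and> tree_adj (mid p) (right p)}"

text \<open>Triples rather than pairs, because then the shift successors of \<open>p\<close> all
  have the middle entry \<open>right p\<close> and its predecessors the middle entry
  \<open>left p\<close>: on each side they lie in a single part.\<close>

definition shifted :: "triple \<Rightarrow> triple \<Rightarrow> bool" where
  "shifted p q \<longleftrightarrow> mid p < mid q \<and> right p = mid q \<and> left q = mid p"

text \<open>The parts are the classes of equal middle entries; they are ordered by this entry, and the
  backward arcs are the shift pairs.\<close>
definition shift_arc :: "triple \<Rightarrow> triple \<Rightarrow> bool" where
  "shift_arc p q \<longleftrightarrow> mid p < mid q \<and> \<not> shifted p q \<or> mid q < mid p \<and> shifted q p"

lemma nadj_shift_arc: "nadj shift_arc p q \<longleftrightarrow> mid p = mid q"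
  unfolding nadj_def shift_arc_def shifted_def by (cases "mid p" "mid q" rule: linorder_cases) auto

lemma finite_triples: "finite (triples n)"
proof (rule finite_subset)
  show "triples n \<subseteq> nodes n \<times> nodes n \<times> nodes n" unfolding triples_def by auto
qed (simp add: finite_nodes)

lemma ocm_triples: "ocm shift_arc (triples n)"
  unfolding ocm_def nadj_shift_arc using finite_triples by (auto simp: shift_arc_def)

text \<open>\<open>left p\<close> and \<open>right p\<close> are the middle entries of
  \<open>a\<close> and \<open>b\<close>, so \<open>p\<close> itself supplies two consecutive tree
  edges and \<open>q\<close> the edge that crosses them.\<close>

lemma shifted_pattern:
  assumes "p \<in> triples n" "q \<in> triples n" "r \<in> triples n" "shifted a p" "shifted p b" "shifted q r"
    "mid a < mid q" "mid q < mid p" "mid p < mid r" "mid r < mid b"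
  shows False
proof (rule tree_adj_pattern)
  show "tree_adj (mid a) (mid p)" "tree_adj (mid p) (mid b)"
    using assms unfolding triples_def shifted_def by auto
  show "tree_adj (mid q) (mid r)" using assms unfolding triples_def shifted_def by auto
  show "noncrossing (mid r)" using assms unfolding triples_def nodes_def by auto
qed fact+

text \<open>A matching-like backward graph has to meet all four triangles of \<open>C3 1 2 2\<close>; this is only possible
  by a monotone path of backward arcs through \<open>x\<close> that crosses a third backward arc.\<close>
lemma triples_C122_free:
  assumes V: "x \<in> triples n" "y \<in> triples n" "y' \<in> triples n" "z \<in> triples n" "z' \<in> triples n"
    and arcs: "shift_arc x y" "shift_arc x y'" "shift_arc y y'" "shift_arc y z" "shift_arc y z'"
      "shift_arc y' z" "shift_arc y' z'" "shift_arc z z'" "shift_arc z x" "shift_arc z' x"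
  shows False
proof -
  have pat: "shifted a p \<Longrightarrow> shifted p b \<Longrightarrow> shifted q r \<Longrightarrow> mid a < mid q \<Longrightarrow> mid q < mid p \<Longrightarrow>
      mid p < mid r \<Longrightarrow> mid r < mid b \<Longrightarrow> False" if "p \<in> {x,y,y',z,z'}" "q \<in> {x,y,y',z,z'}" "r \<in> {x,y,y',z,z'}" for a p b q r
    using shifted_pattern[of p n q r a b] that V by blast
  have out: "shifted p q \<Longrightarrow> shifted p q' \<Longrightarrow> mid q = mid q'" for p q q' unfolding shifted_def by simp
  have inn: "shifted p q \<Longrightarrow> shifted p' q \<Longrightarrow> mid p = mid p'" for p p' q unfolding shifted_def by simp
  have lt: "shifted p q \<Longrightarrow> mid p < mid q" for p q unfolding shifted_def by simp
  have arc: "mid p < mid q \<or> shifted q p" "\<not> shifted p q" if "shift_arc p q" for p q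
    using that unfolding shift_arc_def shifted_def by auto
  have ne: "mid p \<noteq> mid q" if "shift_arc p q" for p q using that unfolding shift_arc_def by auto
  have tri: "shifted b a \<or> shifted c b \<or> shifted a c" if "shift_arc a b" "shift_arc b c" "shift_arc c a" for a b c
    using arc(1)[OF that(1)] arc(1)[OF that(2)] arc(1)[OF that(3)] by auto
  have X: "\<not> (shifted y x \<and> shifted y' x)" using inn ne[OF arcs(3)] by blast
  have Z: "\<not> (shifted x z \<and> shifted x z')" using out ne[OF arcs(8)] by blast
  have M: "\<not> (shifted z y \<and> shifted z' y)" "\<not> (shifted z y' \<and> shifted z' y')"
    "\<not> (shifted z y \<and> shifted z y')" "\<not> (shifted z' y \<and> shifted z' y')"
    using inn[of z y z'] inn[of z y' z'] out[of z y y'] out[of z' y y'] ne[OF arcs(3)] ne[OF arcs(8)] by blast+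
  \<comment> \<open>Middle entries cannot increase all the way around a triangle, so each of the
    four triangles through \<open>x\<close> has a backward arc.\<close>
  have T: "shifted y x \<or> shifted z y \<or> shifted x z" "shifted y x \<or> shifted z' y \<or> shifted x z'"
    "shifted y' x \<or> shifted z y' \<or> shifted x z" "shifted y' x \<or> shifted z' y' \<or> shifted x z'"
    using tri arcs by blast+
  consider "shifted y x" "shifted x z" "shifted z' y'" | "shifted y x" "shifted x z'" "shifted z y'"
    | "shifted y' x" "shifted x z" "shifted z' y" | "shifted y' x" "shifted x z'" "shifted z y"
    using X Z M T by blast
  \<comment> \<open>In cases 1, 3 and 4 a further shift pair is forced and clashes with uniqueness
    in \<open>out\<close> or \<open>inn\<close>. In case 2 the shift path \<open>y\<close>,
    \<open>x\<close>, \<open>z'\<close> is crossed by the pair \<open>z\<close>,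
    \<open>y'\<close>.\<close>
  then show False
  proof cases
    case 1
    have "mid z' < mid x" using arc(1)[OF arcs(10)] out[OF 1(2), of z'] ne[OF arcs(8)] by auto
    then have "shifted z' z" using arc(1)[OF arcs(8)] lt[OF 1(2)] by auto
    then show False using inn[OF 1(2), of z'] ne[OF arcs(10)] by auto
  next
    case 2
    have zx: "mid z < mid x" using arc(1)[OF arcs(9)] out[OF 2(2), of z] ne[OF arcs(8)] by auto
    have xy': "mid x < mid y'" using arc(1)[OF arcs(2)] inn[OF 2(1), of y'] ne[OF arcs(3)] by auto
    have yz: "mid y < mid z" using arc(1)[OF arcs(4)] out[OF 2(3), of y] ne[OF arcs(3)] by auto
    have yz': "mid y' < mid z'" using arc(1)[OF arcs(7)] inn[OF 2(2), of z'] inn[OF 2(3), of z'] ne[OF arcs(8)] by auto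
    show False by (rule pat[of x z y' y z'], simp_all, fact+)
  next
    case 3
    have "mid x < mid y" using arc(1)[OF arcs(1)] inn[OF 3(1), of y] ne[OF arcs(3)] by auto
    then have "shifted y' y" using arc(1)[OF arcs(3)] lt[OF 3(1)] by auto
    then show False using out[OF 3(1), of y] ne[OF arcs(1)] by auto
  next
    case 4
    have "mid x < mid y" using arc(1)[OF arcs(1)] inn[OF 4(1), of y] ne[OF arcs(3)] by auto
    then have "shifted y' y" using arc(1)[OF arcs(3)] lt[OF 4(1)] by auto
    then show False using out[OF 4(1), of y] ne[OF arcs(1)] by auto
  qed
qed

text \<open>In an acyclic set, no part lies strictly between the two parts of a shift pair, so the parity of
  the position of the part colours the shift pairs within each colour class.\<close>
lemma shifted_colouring:
  assumes f: "is_colouring shift_arc (triples n) K f"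
  shows "\<exists>h :: triple \<Rightarrow> nat. (\<forall>p\<in>triples n. h p < 2 * K) \<and>
    (\<forall>p\<in>triples n. \<forall>q\<in>triples n. shifted p q \<longrightarrow> h p \<noteq> h q)"
proof -
  let ?V = "triples n"
  define below where "below p = mid ` {v\<in>?V. f v = f p \<and> mid v < mid p}" for p
  have fin: "finite (below p)" for p unfolding below_def using finite_triples by simp
  define h where "h p = 2 * f p + card (below p) mod 2" for p
  have "h p \<noteq> h q" if pq: "p \<in> ?V" "q \<in> ?V" "shifted p q" for p q
  proof
    assume "h p = h q"
    then have eq: "f q = f p" "card (below p) mod 2 = card (below q) mod 2" unfolding h_def by presburger+
    have lt: "mid p < mid q" using pq(3) unfolding shifted_def by simp
    have no_between: "mid v \<le> mid p" if v: "v \<in> ?V" "f v = f p" "mid v < mid q" for v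
    proof (rule ccontr)
      assume n: "\<not> ?thesis"
      show False
      proof (rule is_colouring_no_triangle[OF f pq(1) v(1) pq(2) v(2) eq(1)])
        show "shift_arc p v" using n v(3) pq(3) unfolding shift_arc_def shifted_def by auto
        show "shift_arc v q" using n v(3) pq(3) unfolding shift_arc_def shifted_def by auto
        show "shift_arc q p" using lt pq(3) unfolding shift_arc_def by auto
      qed
    qed
    have "below q = insert (mid p) (below p)"
    proof (intro equalityI subsetI)
      fix m assume "m \<in> below q"
      then obtain v where v: "v \<in> ?V" "f v = f q" "mid v < mid q" "m = mid v" unfolding below_def by blast
      then have "mid v \<le> mid p" using no_between[of v] eq(1) by simp
      then show "m \<in> insert (mid p) (below p)" using v eq(1) unfolding below_def by (cases "mid v = mid p") auto
    next
      fix m assume "m \<in> insert (mid p) (below p)"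
      then show "m \<in> below q" using eq(1) lt pq(1) unfolding below_def by (auto dest: less_trans)
    qed
    moreover have "mid p \<notin> below p" unfolding below_def by auto
    ultimately have "card (below q) = Suc (card (below p))" using fin by simp
    with eq(2) show False by presburger
  qed
  moreover have "h p < 2 * K" if "p \<in> ?V" for p
  proof -
    have "f p < K" using f that unfolding is_colouring_def by blast
    then show ?thesis unfolding h_def by linarith
  qed
  ultimately show ?thesis by blast
qed

text \<open>The classical shift argument, applied twice: colours of triples give sets
  \<open>g i j\<close> on edges and sets of sets \<open>S i\<close> on nodes. If
  \<open>S i = S j\<close> for an edge, then \<open>g i j = g j k\<close> for some \<open>k\<close>,
  and then a shift pair has equal colours.\<close>

lemma triples_not_col: "\<exists>n. \<not> col shift_arc (triples n) K"
proof
  \<comment> \<open>One more than the number of sets of subsets of the \<open>2 * K\<close>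
    colours.\<close>
  define k where "k = Suc (2 ^ (2 ^ (2 * K)))"
  let ?n = "rounds k"
  show "\<not> col shift_arc (triples ?n) K"
  proof
    assume "col shift_arc (triples ?n) K"
    then obtain f where "is_colouring shift_arc (triples ?n) K f" unfolding col_def by blast
    then have "\<exists>h :: triple \<Rightarrow> nat. (\<forall>p\<in>triples ?n. h p < 2 * K) \<and>
        (\<forall>p\<in>triples ?n. \<forall>q\<in>triples ?n. shifted p q \<longrightarrow> h p \<noteq> h q)" by (rule shifted_colouring)
    then obtain h :: "triple \<Rightarrow> nat" where h: "\<forall>p\<in>triples ?n. h p < 2 * K"
      "\<forall>p\<in>triples ?n. \<forall>q\<in>triples ?n. shifted p q \<longrightarrow> h p \<noteq> h q" by (elim exE conjE)
    note h = h[rule_format]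
    define g where "g i j = {h (i, j, k) |k. (i, j, k) \<in> triples ?n}" for i j
    define S where "S i = {g i j |j. j \<in> nodes ?n \<and> tree_adj i j}" for i
    have "S i \<noteq> S j" if ij: "i \<in> nodes ?n" "j \<in> nodes ?n" "tree_adj i j" for i j
    proof
      assume "S i = S j"
      moreover have "g i j \<in> S i" using ij unfolding S_def by blast
      ultimately obtain k where k: "k \<in> nodes ?n" "tree_adj j k" "g i j = g j k" unfolding S_def by auto
      have t: "(i, j, k) \<in> triples ?n" using ij k unfolding triples_def by simp
      then have "h (i, j, k) \<in> g j k" using k(3) unfolding g_def by blast
      then obtain l where l: "(j, k, l) \<in> triples ?n" "h (i, j, k) = h (j, k, l)" unfolding g_def by auto
      have "strict_prefix j k" using k(2) unfolding tree_adj_def by simp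
      then have "j < k" using prefix_imp_le[of j k] by (auto simp: strict_prefix_def order.strict_iff_order)
      then have "shifted (i, j, k) (j, k, l)" unfolding shifted_def by simp
      then show False using h(2)[OF t l(1)] l(2) by simp
    qed
    then have "k \<le> card (S ` nodes ?n)" by (rule nodes_chromatic)
    also have "\<dots> \<le> card (Pow (Pow {..<2 * K}))"
    proof (rule card_mono)
      show "S ` nodes ?n \<subseteq> Pow (Pow {..<2 * K})" using h(1) unfolding S_def g_def by auto
    qed simp
    also have "\<dots> = 2 ^ (2 ^ (2 * K))" by (simp add: card_Pow)
    finally show False unfolding k_def by simp
  qed
qed

section \<open>Digraphs with vertices and arcs as sets\<close>

definition arc_rel :: "'a pair_pre_digraph \<Rightarrow> 'a \<Rightarrow> 'a \<Rightarrow> bool" where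
  "arc_rel D x y \<longleftrightarrow> (x, y) \<in> parcs D"

definition embeds :: "('a \<Rightarrow> 'a \<Rightarrow> bool) \<Rightarrow> 'a set \<Rightarrow> ('v \<Rightarrow> 'v \<Rightarrow> bool) \<Rightarrow> 'v set \<Rightarrow> bool" where
  "embeds F W E V \<longleftrightarrow> (\<exists>g. inj_on g W \<and> g ` W \<subseteq> V \<and> (\<forall>x\<in>W. \<forall>y\<in>W. F x y \<longleftrightarrow> E (g x) (g y)))"

lemma embeds_trans:
  assumes "embeds F W E V" "embeds E V G U" shows "embeds F W G U"
proof -
  obtain g where g: "inj_on g W" "g ` W \<subseteq> V" "\<forall>x\<in>W. \<forall>y\<in>W. F x y \<longleftrightarrow> E (g x) (g y)"
    using assms(1) unfolding embeds_def by blast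
  obtain h where h: "inj_on h V" "h ` V \<subseteq> U" "\<forall>x\<in>V. \<forall>y\<in>V. E x y \<longleftrightarrow> G (h x) (h y)"
    using assms(2) unfolding embeds_def by blast
  have gV: "g x \<in> V" if "x \<in> W" for x using g(2) that by blast
  have "inj_on (h \<circ> g) W" using g h by (intro comp_inj_on) (auto intro: inj_on_subset)
  moreover have "(h \<circ> g) ` W \<subseteq> U" using gV h(2) by auto
  moreover have "\<forall>x\<in>W. \<forall>y\<in>W. F x y \<longleftrightarrow> G ((h \<circ> g) x) ((h \<circ> g) y)" using g(3) h(3) gV by simp
  ultimately show ?thesis unfolding embeds_def by blast
qed

lemma embeds_cong:
  "(\<And>x y. x \<in> V \<Longrightarrow> y \<in> V \<Longrightarrow> E x y \<longleftrightarrow> E' x y) \<Longrightarrow> embeds F W E V \<longleftrightarrow> embeds F W E' V"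
  unfolding embeds_def by (intro ex_cong1 conj_cong refl ball_cong) (simp add: image_subset_iff)

lemma ocm_cong:
  "(\<And>x y. x \<in> V \<Longrightarrow> y \<in> V \<Longrightarrow> E x y \<longleftrightarrow> E' x y) \<Longrightarrow> ocm E V \<longleftrightarrow> ocm E' V"
  unfolding ocm_def nadj_def by simp

lemma col_cong:
  assumes "\<And>x y. x \<in> V \<Longrightarrow> y \<in> V \<Longrightarrow> E x y \<longleftrightarrow> E' x y"
  shows "col E V k \<longleftrightarrow> col E' V k"
proof -
  have "acy E {v\<in>V. f v = i} \<longleftrightarrow> acy E' {v\<in>V. f v = i}" for f :: "'a \<Rightarrow> nat" and i
    by (rule acy_cong) (use assms in auto)
  then show ?thesis unfolding col_def is_colouring_def by simp
qed

lemma nonnull_digraph_iff: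
  "nonnull_digraph D \<longleftrightarrow> finite (pverts D) \<and> pverts D \<noteq> {} \<and> parcs D \<subseteq> pverts D \<times> pverts D \<and>
     (\<forall>x. \<not> arc_rel D x x)"
proof
  assume "nonnull_digraph D"
  then have "pair_digraph D" and ne: "pverts D \<noteq> {}" unfolding nonnull_digraph_def by auto
  then interpret pair_digraph D by simp
  show "finite (pverts D) \<and> pverts D \<noteq> {} \<and> parcs D \<subseteq> pverts D \<times> pverts D \<and> (\<forall>x. \<not> arc_rel D x x)"
    using ne pair_finite_verts pair_no_loops in_arcsD1 in_arcsD2 unfolding arc_rel_def by fastforce
next
  assume h: "finite (pverts D) \<and> pverts D \<noteq> {} \<and> parcs D \<subseteq> pverts D \<times> pverts D \<and> (\<forall>x. \<not> arc_rel D x x)"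
  then have "finite (parcs D)" using finite_subset by blast
  then have "pair_digraph D"
    using h unfolding arc_rel_def by unfold_locales auto
  then show "nonnull_digraph D" using h unfolding nonnull_digraph_def by simp
qed

section \<open>Isomorphism, induced copies and dichromatic number in terms of relations\<close>

lemma pair_wf_digraph_iff: "pair_wf_digraph D \<longleftrightarrow> parcs D \<subseteq> pverts D \<times> pverts D"
proof
  assume "pair_wf_digraph D"
  then interpret pair_wf_digraph D .
  show "parcs D \<subseteq> pverts D \<times> pverts D" using in_arcsD1 in_arcsD2 by auto
qed (unfold_locales, auto)

text \<open>An isomorphism carries its own arc, head and tail maps; for arcs given as pairs, the
  vertex map determines its action on them.\<close>

lemma digraph_isomorphism_arc:
  assumes f: "pre_digraph.digraph_isomorphism (with_proj A) f" and B: "with_proj B = app_iso f (with_proj A)"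
  shows "bij_betw (iso_verts f) (pverts A) (pverts B)"
    and "x \<in> pverts A \<Longrightarrow> y \<in> pverts A \<Longrightarrow> arc_rel A x y \<longleftrightarrow> arc_rel B (iso_verts f x) (iso_verts f y)"
proof -
  have inj: "inj_on (iso_verts f) (pverts A)" and wf: "parcs A \<subseteq> pverts A \<times> pverts A"
    using f unfolding pre_digraph.digraph_isomorphism_def wf_digraph_wp_iff pair_wf_digraph_iff by auto
  have vB: "pverts B = iso_verts f ` pverts A" using arg_cong[OF B, of verts] by simp
  have aB: "parcs B = iso_arcs f ` parcs A" using arg_cong[OF B, of arcs] by simp
  have t: "iso_tail f = fst" "iso_head f = snd" using arg_cong[OF B, of tail] arg_cong[OF B, of head] by simp_all
  have e: "iso_arcs f (u, v) = (iso_verts f u, iso_verts f v)" if "(u, v) \<in> parcs A" for u v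
    using f that unfolding pre_digraph.digraph_isomorphism_def t by (auto simp: prod_eq_iff)
  show "bij_betw (iso_verts f) (pverts A) (pverts B)" using inj vB by (simp add: bij_betw_def)
  assume xy: "x \<in> pverts A" "y \<in> pverts A"
  show "arc_rel A x y \<longleftrightarrow> arc_rel B (iso_verts f x) (iso_verts f y)"
  proof
    assume "arc_rel A x y"
    then show "arc_rel B (iso_verts f x) (iso_verts f y)" using e[of x y] aB unfolding arc_rel_def by force
  next
    assume "arc_rel B (iso_verts f x) (iso_verts f y)"
    then obtain u v where uv: "(u, v) \<in> parcs A" "iso_arcs f (u, v) = (iso_verts f x, iso_verts f y)"
      using aB unfolding arc_rel_def by force
    then have "iso_verts f u = iso_verts f x" "iso_verts f v = iso_verts f y" using e by auto
    then have "u = x" "v = y" using inj_onD[OF inj] uv(1) wf xy by blast+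
    then show "arc_rel A x y" using uv(1) unfolding arc_rel_def by simp
  qed
qed

lemma digraph_iso_iff:
  assumes A: "parcs A \<subseteq> pverts A \<times> pverts A" and B: "parcs B \<subseteq> pverts B \<times> pverts B"
  shows "digraph_iso (with_proj A) (with_proj B) \<longleftrightarrow>
    (\<exists>g. bij_betw g (pverts A) (pverts B) \<and>
      (\<forall>x\<in>pverts A. \<forall>y\<in>pverts A. arc_rel A x y \<longleftrightarrow> arc_rel B (g x) (g y)))"
proof
  assume "digraph_iso (with_proj A) (with_proj B)"
  then obtain f where f: "pre_digraph.digraph_isomorphism (with_proj A) f" "with_proj B = app_iso f (with_proj A)"
    unfolding digraph_iso_def by blast
  show "\<exists>g. bij_betw g (pverts A) (pverts B) \<and>
      (\<forall>x\<in>pverts A. \<forall>y\<in>pverts A. arc_rel A x y \<longleftrightarrow> arc_rel B (g x) (g y))"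
    using digraph_isomorphism_arc[OF f] by blast
next
  assume "\<exists>g. bij_betw g (pverts A) (pverts B) \<and>
      (\<forall>x\<in>pverts A. \<forall>y\<in>pverts A. arc_rel A x y \<longleftrightarrow> arc_rel B (g x) (g y))"
  then obtain g where g: "inj_on g (pverts A)" "g ` pverts A = pverts B"
    "\<And>x y. x \<in> pverts A \<Longrightarrow> y \<in> pverts A \<Longrightarrow> arc_rel A x y \<longleftrightarrow> arc_rel B (g x) (g y)"
    unfolding bij_betw_def by blast
  define f where "f = \<lparr>iso_verts = g, iso_arcs = map_prod g g, iso_head = snd, iso_tail = fst\<rparr>"
  have "inj_on (map_prod g g) (pverts A \<times> pverts A)" using g(1) by (auto simp: inj_on_def)
  then have "inj_on (map_prod g g) (parcs A)" using A by (rule inj_on_subset)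
  then have "pre_digraph.digraph_isomorphism (with_proj A) f"
    unfolding pre_digraph.digraph_isomorphism_def wf_digraph_wp_iff pair_wf_digraph_iff f_def
    using A g(1) by simp
  moreover have "parcs B = map_prod g g ` parcs A"
  proof (intro equalityI subsetI)
    fix e assume e: "e \<in> parcs B"
    then obtain x y where xy: "x \<in> pverts A" "y \<in> pverts A" "e = (g x, g y)"
      using B unfolding g(2)[symmetric] by blast
    then have "(x, y) \<in> parcs A" using g(3) e unfolding arc_rel_def by blast
    then show "e \<in> map_prod g g ` parcs A" using xy(3) by force
  next
    fix e assume "e \<in> map_prod g g ` parcs A"
    then obtain x y where "(x, y) \<in> parcs A" "e = (g x, g y)" by auto
    then show "e \<in> parcs B" using g(3)[of x y] A unfolding arc_rel_def by auto
  qed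
  then have "with_proj B = app_iso f (with_proj A)"
    unfolding app_iso_def with_proj_def f_def using g(2) by simp
  ultimately show "digraph_iso (with_proj A) (with_proj B)" unfolding digraph_iso_def by blast
qed

lemma contains_induced_iff:
  assumes D: "parcs D \<subseteq> pverts D \<times> pverts D" and H: "parcs H \<subseteq> pverts H \<times> pverts H"
  shows "contains_induced D H \<longleftrightarrow> embeds (arc_rel H) (pverts H) (arc_rel D) (pverts D)"
proof
  assume "contains_induced D H"
  then obtain K where K: "induced_subgraph K (with_proj D)" "digraph_iso K (with_proj H)"
    unfolding contains_induced_def by blast
  define L where "L = \<lparr>pverts = verts K, parcs = arcs K\<rparr>"
  have KL: "K = with_proj L"
    using K(1) unfolding induced_subgraph_def subgraph_def compatible_def L_def with_proj_def by simp
  have L: "pverts L \<subseteq> pverts D" "parcs L = {e \<in> parcs D. fst e \<in> pverts L \<and> snd e \<in> pverts L}"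
    using K(1) unfolding KL induced_subgraph_def subgraph_def by auto
  have "parcs L \<subseteq> pverts L \<times> pverts L" using L(2) by auto
  then obtain g where g: "bij_betw g (pverts L) (pverts H)"
    "\<forall>x\<in>pverts L. \<forall>y\<in>pverts L. arc_rel L x y \<longleftrightarrow> arc_rel H (g x) (g y)"
    using K(2) H digraph_iso_iff unfolding KL by blast
  let ?h = "the_inv_into (pverts L) g"
  have h: "bij_betw ?h (pverts H) (pverts L)" using g(1) by (rule bij_betw_the_inv_into)
  have gh: "g (?h x) = x" if "x \<in> pverts H" for x using f_the_inv_into_f_bij_betw[OF g(1)] that by blast
  have hL: "?h x \<in> pverts L" if "x \<in> pverts H" for x using h that by (auto dest: bij_betwE)
  have "arc_rel H x y \<longleftrightarrow> arc_rel D (?h x) (?h y)" if xy: "x \<in> pverts H" "y \<in> pverts H" for x y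
  proof -
    have "arc_rel L (?h x) (?h y) \<longleftrightarrow> arc_rel H x y" using g(2) hL[OF xy(1)] hL[OF xy(2)] gh xy by simp
    moreover have "arc_rel L (?h x) (?h y) \<longleftrightarrow> arc_rel D (?h x) (?h y)"
      using hL[OF xy(1)] hL[OF xy(2)] L(2) unfolding arc_rel_def by auto
    ultimately show ?thesis by simp
  qed
  then show "embeds (arc_rel H) (pverts H) (arc_rel D) (pverts D)"
    unfolding embeds_def using h L(1) by (intro exI[of _ ?h]) (auto simp: bij_betw_def)
next
  assume "embeds (arc_rel H) (pverts H) (arc_rel D) (pverts D)"
  then obtain g where g: "inj_on g (pverts H)" "g ` pverts H \<subseteq> pverts D"
    "\<And>x y. x \<in> pverts H \<Longrightarrow> y \<in> pverts H \<Longrightarrow> arc_rel H x y \<longleftrightarrow> arc_rel D (g x) (g y)"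
    unfolding embeds_def by blast
  define L where "L = \<lparr>pverts = g ` pverts H, parcs = {e \<in> parcs D. fst e \<in> g ` pverts H \<and> snd e \<in> g ` pverts H}\<rparr>"
  have wfL: "parcs L \<subseteq> pverts L \<times> pverts L" unfolding L_def by auto
  have "induced_subgraph (with_proj L) (with_proj D)"
    unfolding induced_subgraph_def subgraph_def wf_digraph_wp_iff pair_wf_digraph_iff compatible_def
    using D g(2) wfL by (auto simp: L_def)
  moreover have "digraph_iso (with_proj L) (with_proj H)"
    unfolding digraph_iso_iff[OF wfL H]
  proof (intro exI conjI ballI)
    let ?h = "the_inv_into (pverts H) g"
    show "bij_betw ?h (pverts L) (pverts H)"
      by (rule bij_betw_the_inv_into) (simp add: bij_betw_def g(1) L_def)
    fix x y assume "x \<in> pverts L" "y \<in> pverts L"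
    then obtain u v where uv: "u \<in> pverts H" "v \<in> pverts H" "x = g u" "y = g v" unfolding L_def by auto
    then show "arc_rel L x y \<longleftrightarrow> arc_rel H (?h x) (?h y)"
      using g(3)[OF uv(1,2)] the_inv_into_f_f[OF g(1)] unfolding L_def arc_rel_def by simp
  qed
  ultimately show "contains_induced D H" unfolding contains_induced_def by blast
qed

lemma acyclic_digraph_iff:
  assumes D: "parcs D \<subseteq> pverts D \<times> pverts D"
  shows "acyclic_digraph (with_proj D \<restriction> X) \<longleftrightarrow> acy (arc_rel D) X"
proof -
  let ?G = "with_proj D \<restriction> X"
  interpret pair_wf_digraph D using D by (simp add: pair_wf_digraph_iff)
  interpret G: wf_digraph ?G by (rule wellformed_induce_subgraph)
  have ends: "arcs_ends ?G = {(x, y). x \<in> X \<and> y \<in> X \<and> arc_rel D x y}"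
    unfolding arcs_ends_conv arc_rel_def by force
  have "(\<exists>p. G.cycle p) \<longleftrightarrow> (\<exists>p. G.closed_w p)"
    using G.closed_w_imp_cycle G.cycle_altdef by blast
  also have "\<dots> \<longleftrightarrow> (\<exists>u. (u, u) \<in> (arcs_ends ?G)\<^sup>+)"
    unfolding G.closed_w_def using G.reachable1_awalk by auto
  finally show ?thesis unfolding acyclic_digraph_def acy_def acyclic_def ends by blast
qed

text \<open>A partition has no empty classes, so a colouring may yield fewer than \<open>c\<close>
  of them. The injective colouring \<open>to_nat_on\<close> shows that \<open>LEAST\<close> ranges
  over a non-empty set.\<close>

lemma dichromatic_number_le_iff:
  assumes D: "finite (pverts D)" "parcs D \<subseteq> pverts D \<times> pverts D" "\<And>x. \<not> arc_rel D x x"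
  shows "dichromatic_number (with_proj D) \<le> c \<longleftrightarrow> col (arc_rel D) (pverts D) c"
proof -
  let ?V = "pverts D" and ?E = "arc_rel D"
  define good where "good k P \<longleftrightarrow> partition_on ?V P \<and> finite P \<and> card P = k \<and> (\<forall>X\<in>P. acy ?E X)" for k P
  have dn: "dichromatic_number (with_proj D) = (LEAST k. \<exists>P. good k P)"
    unfolding dichromatic_number_def good_def acyclic_digraph_iff[OF D(2)] by simp
  have good_if_col: "\<exists>k\<le>c. \<exists>P. good k P" if c: "col ?E ?V c" for c
  proof -
    obtain f where f: "is_colouring ?E ?V c f" using c unfolding col_def by blast
    define P where "P = (\<lambda>i. {v\<in>?V. f v = i}) ` {..<c} - {{}}"
    have fin: "finite P" unfolding P_def by simp
    have "partition_on ?V P"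
    proof (rule partition_onI)
      show "\<Union>P = ?V" using f unfolding P_def is_colouring_def by auto
      show "disjnt p q" if "p \<in> P" "q \<in> P" "p \<noteq> q" for p q using that unfolding P_def disjnt_def by auto
    qed (simp add: P_def)
    moreover have "card P \<le> c"
    proof -
      have "card P \<le> card ((\<lambda>i. {v\<in>?V. f v = i}) ` {..<c})" unfolding P_def by (intro card_mono) auto
      also have "\<dots> \<le> c" using card_image_le[of "{..<c}" "\<lambda>i. {v\<in>?V. f v = i}"] by simp
      finally show ?thesis .
    qed
    moreover have "\<forall>X\<in>P. acy ?E X" using f unfolding P_def is_colouring_def by auto
    ultimately show ?thesis using fin unfolding good_def by blast
  qed
  have "is_colouring ?E ?V (card ?V) (to_nat_on ?V)"
    unfolding is_colouring_def
  proof (intro conjI ballI allI)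
    show "to_nat_on ?V v < card ?V" if "v \<in> ?V" for v
      using to_nat_on_finite[OF D(1)] that by (auto dest: bij_betwE)
    fix i show "acy ?E {v\<in>?V. to_nat_on ?V v = i}"
    proof (rule acy_indep)
      fix x y assume "x \<in> {v\<in>?V. to_nat_on ?V v = i}" "y \<in> {v\<in>?V. to_nat_on ?V v = i}"
      then have "x = y" using inj_on_to_nat_on[OF countable_finite[OF D(1)]] by (auto dest: inj_onD)
      then show "\<not> ?E x y" using D(3) by simp
    qed
  qed
  then have "\<exists>k P. good k P" using good_if_col unfolding col_def by blast
  then have least: "\<exists>P. good (dichromatic_number (with_proj D)) P" unfolding dn by (rule LeastI_ex)
  show ?thesis
  proof
    assume le: "dichromatic_number (with_proj D) \<le> c"
    obtain P where P: "partition_on ?V P" "finite P" "card P = dichromatic_number (with_proj D)" "\<forall>X\<in>P. acy ?E X"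
      using least unfolding good_def by blast
    have "col ?E (\<Union>X\<in>P. X) (card P * Suc 0)" by (rule col_UN) (use P(2,4) col_acy in auto)
    moreover have "(\<Union>X\<in>P. X) = ?V" using P(1) unfolding partition_on_def by simp
    ultimately show "col ?E ?V c" using col_mono[of ?E ?V "card P" ?V c] P(3) le by simp
  next
    assume "col ?E ?V c"
    then obtain k P where "k \<le> c" "good k P" using good_if_col by blast
    then have "(LEAST k. \<exists>P. good k P) \<le> k" by (intro Least_le) blast
    then show "dichromatic_number (with_proj D) \<le> c" unfolding dn using \<open>k \<le> c\<close> by simp
  qed
qed

lemma orientation_arcs:
  assumes "orientation_of D G"
  shows "pverts D = pverts G" "(x, y) \<in> parcs G \<longleftrightarrow> arc_rel D x y \<or> arc_rel D y x" "arc_rel D x y \<Longrightarrow> \<not> arc_rel D y x"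
  using assms unfolding orientation_of_def arc_rel_def by auto

text \<open>The parts are recovered as the classes of non-adjacency, which \<open>ocm\<close> makes
  an equivalence on the vertices.\<close>

lemma oriented_complete_multipartite_iff:
  "D \<in> oriented_complete_multipartite_graphs \<longleftrightarrow>
    pverts D \<noteq> {} \<and> parcs D \<subseteq> pverts D \<times> pverts D \<and> ocm (arc_rel D) (pverts D)"
proof
  assume "D \<in> oriented_complete_multipartite_graphs"
  then obtain G P where G: "pair_graph G" "pverts G \<noteq> {}" and P: "partition_on (pverts G) P"
    "parcs G = {(u, v). \<exists>A\<in>P. \<exists>B\<in>P. A \<noteq> B \<and> u \<in> A \<and> v \<in> B}" and or: "orientation_of D G"
    unfolding oriented_complete_multipartite_graphs_def complete_multipartite_def by blast
  note o = orientation_arcs[OF or]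
  interpret pair_graph G by (rule G(1))
  have U: "\<Union>P = pverts G" using P(1) unfolding partition_on_def by blast
  have uniq: "A = B" if "A \<in> P" "B \<in> P" "x \<in> A" "x \<in> B" for A B x
    using P(1) that unfolding partition_on_def disjoint_def by blast
  have n: "nadj (arc_rel D) x y \<longleftrightarrow> (x, y) \<notin> parcs G" for x y
    unfolding nadj_def using o(2) by blast
  have trans: "nadj (arc_rel D) x z"
    if v: "x \<in> pverts G" "y \<in> pverts G" "z \<in> pverts G" and "nadj (arc_rel D) x y" "nadj (arc_rel D) y z" for x y z
  proof -
    obtain A B C where ABC: "A \<in> P" "x \<in> A" "B \<in> P" "y \<in> B" "C \<in> P" "z \<in> C" using v U by blast
    then have "A = B" "B = C" using that(4,5) unfolding n P(2) by blast+
    then have "A' = B'" if "A' \<in> P" "B' \<in> P" "x \<in> A'" "z \<in> B'" for A' B'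
      using uniq[of A' A x] uniq[of B' A z] that ABC by simp
    then show ?thesis unfolding n P(2) by blast
  qed
  have "ocm (arc_rel D) (pverts D)"
    unfolding ocm_def o(1) using pair_finite_verts o(3) trans by blast
  moreover have "parcs D \<subseteq> pverts D \<times> pverts D"
  proof
    fix e assume "e \<in> parcs D"
    then have "e \<in> parcs G" using or unfolding orientation_of_def by blast
    then show "e \<in> pverts D \<times> pverts D" unfolding o(1) P(2) using U by auto
  qed
  ultimately show "pverts D \<noteq> {} \<and> parcs D \<subseteq> pverts D \<times> pverts D \<and> ocm (arc_rel D) (pverts D)"
    using G(2) o(1) by simp
next
  assume "pverts D \<noteq> {} \<and> parcs D \<subseteq> pverts D \<times> pverts D \<and> ocm (arc_rel D) (pverts D)"
  then have ne: "pverts D \<noteq> {}" and wf: "parcs D \<subseteq> pverts D \<times> pverts D" and V: "ocm (arc_rel D) (pverts D)" by auto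
  define G where "G = \<lparr>pverts = pverts D, parcs = parcs D \<union> (parcs D)\<inverse>\<rparr>"
  have mem: "(x, y) \<in> parcs G \<longleftrightarrow> arc_rel D x y \<or> arc_rel D y x" for x y unfolding G_def arc_rel_def by auto
  have finV: "finite (pverts D)" using ocm_finite[OF V] .
  have "pair_graph G"
  proof
    show "finite (pverts G)" using finV unfolding G_def by simp
    have "finite (parcs D)" using finite_subset[OF wf] finV by simp
    then show "finite (parcs G)" unfolding G_def by simp
    show "symmetric (with_proj G)" unfolding symmetric_def sym_def G_def by auto
    fix e assume e: "e \<in> parcs G"
    then show "fst e \<in> pverts G" "snd e \<in> pverts G" using wf unfolding G_def by auto
    show "fst e \<noteq> snd e"
    proof
      assume "fst e = snd e"
      then have "arc_rel D (fst e) (fst e)" using e mem[of "fst e" "snd e"] by (cases e) auto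
      then show False using ocm_irrefl[OF V] wf unfolding arc_rel_def by blast
    qed
  qed
  moreover have "\<exists>P. partition_on (pverts G) P \<and> parcs G = {(u, v). \<exists>A\<in>P. \<exists>B\<in>P. A \<noteq> B \<and> u \<in> A \<and> v \<in> B}"
  proof (intro exI conjI)
    define c where "c x = {y\<in>pverts D. nadj (arc_rel D) x y}" for x
    have cc: "c x = c y \<longleftrightarrow> nadj (arc_rel D) x y" if "x \<in> pverts D" "y \<in> pverts D" for x y
    proof
      assume "c x = c y"
      moreover have "y \<in> c y" unfolding c_def using nadj_refl[OF V that(2)] that(2) by simp
      ultimately show "nadj (arc_rel D) x y" unfolding c_def by blast
    next
      assume xy: "nadj (arc_rel D) x y"
      then have "nadj (arc_rel D) x z \<longleftrightarrow> nadj (arc_rel D) y z" if "z \<in> pverts D" for z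
        using ocm_trans[OF V _ _ that] nadj_sym \<open>x \<in> pverts D\<close> \<open>y \<in> pverts D\<close> by metis
      then show "c x = c y" unfolding c_def by blast
    qed
    have in_c: "u \<in> c x \<longleftrightarrow> u \<in> pverts D \<and> c u = c x" if "x \<in> pverts D" for u x
    proof
      assume "u \<in> c x"
      then have u: "u \<in> pverts D" "nadj (arc_rel D) x u" unfolding c_def by auto
      then show "u \<in> pverts D \<and> c u = c x" using cc[OF that u(1)] by simp
    next
      assume u: "u \<in> pverts D \<and> c u = c x"
      then have "nadj (arc_rel D) x u" using cc[OF that, of u] by auto
      then show "u \<in> c x" using u unfolding c_def by simp
    qed
    show "partition_on (pverts G) (c ` pverts D)"
    proof (rule partition_onI)
      show "\<Union>(c ` pverts D) = pverts G" unfolding G_def using in_c by auto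
      show "disjnt p q" if "p \<in> c ` pverts D" "q \<in> c ` pverts D" "p \<noteq> q" for p q
        using that in_c unfolding disjnt_def by auto
      show "{} \<notin> c ` pverts D" using in_c by fastforce
    qed
    show "parcs G = {(u, v). \<exists>A\<in>c ` pverts D. \<exists>B\<in>c ` pverts D. A \<noteq> B \<and> u \<in> A \<and> v \<in> B}"
    proof (intro set_eqI iffI)
      fix e assume e: "e \<in> parcs G"
      obtain u v where uv: "e = (u, v)" by (cases e)
      have "u \<in> pverts D" "v \<in> pverts D" using e wf uv unfolding G_def by auto
      moreover have "\<not> nadj (arc_rel D) u v" using e uv mem unfolding nadj_def by blast
      ultimately show "e \<in> {(u, v). \<exists>A\<in>c ` pverts D. \<exists>B\<in>c ` pverts D. A \<noteq> B \<and> u \<in> A \<and> v \<in> B}"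
        using uv cc in_c by auto
    next
      fix e assume "e \<in> {(u, v). \<exists>A\<in>c ` pverts D. \<exists>B\<in>c ` pverts D. A \<noteq> B \<and> u \<in> A \<and> v \<in> B}"
      then obtain u v x y where e: "e = (u, v)" "x \<in> pverts D" "y \<in> pverts D" "c x \<noteq> c y" "u \<in> c x" "v \<in> c y" by blast
      then have "u \<in> pverts D" "v \<in> pverts D" "c u \<noteq> c v" using in_c by auto
      then have "\<not> nadj (arc_rel D) u v" using cc by blast
      then show "e \<in> parcs G" using e(1) mem unfolding nadj_def by blast
    qed
  qed
  moreover have "pverts G \<noteq> {}" using ne unfolding G_def by simp
  ultimately have "complete_multipartite G" unfolding complete_multipartite_def by blast
  moreover have "orientation_of D G" unfolding orientation_of_def
  proof (intro conjI)
    show "parcs D \<inter> (parcs D)\<inverse> = {}"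
    proof (rule ccontr)
      assume "parcs D \<inter> (parcs D)\<inverse> \<noteq> {}"
      then obtain x y where xy: "(x, y) \<in> parcs D" "(y, x) \<in> parcs D" by blast
      then show False using ocm_asym[OF V, of x y] wf unfolding arc_rel_def by blast
    qed
  qed (simp_all add: G_def)
  ultimately show "D \<in> oriented_complete_multipartite_graphs"
    unfolding oriented_complete_multipartite_graphs_def by blast
qed

section \<open>Heroes as uniform bounds on \<open>col\<close>\<close>

abbreviation hero :: "'a pair_pre_digraph \<Rightarrow> bool" where
  "hero \<equiv> hero_in oriented_complete_multipartite_graphs"

lemma hero_nat_iff:
  assumes H: "nonnull_digraph H"
  shows "hero H \<longleftrightarrow> (\<exists>c. \<forall>(E :: nat \<Rightarrow> nat \<Rightarrow> bool) V. ocm E V \<longrightarrow>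
    \<not> embeds (arc_rel H) (pverts H) E V \<longrightarrow> col E V c)"
proof -
  have wfH: "parcs H \<subseteq> pverts H \<times> pverts H" using H unfolding nonnull_digraph_iff by blast
  have dn: "dichromatic_number (with_proj D) \<le> c \<longleftrightarrow> col (arc_rel D) (pverts D) c"
    and ci: "contains_induced D H \<longleftrightarrow> embeds (arc_rel H) (pverts H) (arc_rel D) (pverts D)"
    if "D \<in> oriented_complete_multipartite_graphs" for D c
  proof -
    have D: "parcs D \<subseteq> pverts D \<times> pverts D" "ocm (arc_rel D) (pverts D)"
      using that unfolding oriented_complete_multipartite_iff by auto
    show "contains_induced D H \<longleftrightarrow> embeds (arc_rel H) (pverts H) (arc_rel D) (pverts D)"
      by (rule contains_induced_iff[OF D(1) wfH])
    show "dichromatic_number (with_proj D) \<le> c \<longleftrightarrow> col (arc_rel D) (pverts D) c"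
    proof (rule dichromatic_number_le_iff[OF ocm_finite[OF D(2)] D(1)])
      show "\<not> arc_rel D x x" for x using ocm_irrefl[OF D(2)] D(1) unfolding arc_rel_def by blast
    qed
  qed
  show ?thesis
  proof
    assume "hero H"
    then obtain c where c: "\<And>D. D \<in> oriented_complete_multipartite_graphs \<Longrightarrow> \<not> contains_induced D H \<Longrightarrow>
        dichromatic_number (with_proj D) \<le> c" unfolding hero_in_def by blast
    have "col E V c" if V: "ocm E V" and ne: "\<not> embeds (arc_rel H) (pverts H) E V" for E and V :: "nat set"
    proof (cases "V = {}")
      case False
      define D where "D = \<lparr>pverts = V, parcs = {(x, y). x \<in> V \<and> y \<in> V \<and> E x y}\<rparr>"
      have [simp]: "pverts D = V" unfolding D_def by simp
      have eq: "arc_rel D x y \<longleftrightarrow> E x y" if "x \<in> V" "y \<in> V" for x y using that unfolding D_def arc_rel_def by simp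
      have "ocm (arc_rel D) V" using V ocm_cong[of V "arc_rel D" E] eq by simp
      then have D: "D \<in> oriented_complete_multipartite_graphs"
        unfolding oriented_complete_multipartite_iff using False by (auto simp: D_def)
      have "\<not> contains_induced D H" using ne ci[OF D] embeds_cong[of V "arc_rel D" E "arc_rel H" "pverts H"] eq by simp
      then have "col (arc_rel D) V c" using c[OF D] dn[OF D] by simp
      then show ?thesis using col_cong[of V "arc_rel D" E] eq by simp
    qed simp
    then show "\<exists>c. \<forall>(E :: nat \<Rightarrow> nat \<Rightarrow> bool) V. ocm E V \<longrightarrow>
      \<not> embeds (arc_rel H) (pverts H) E V \<longrightarrow> col E V c" by blast
  next
    assume "\<exists>c. \<forall>(E :: nat \<Rightarrow> nat \<Rightarrow> bool) V. ocm E V \<longrightarrow>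
      \<not> embeds (arc_rel H) (pverts H) E V \<longrightarrow> col E V c"
    then obtain c where c: "\<And>(E :: nat \<Rightarrow> nat \<Rightarrow> bool) V. ocm E V \<Longrightarrow>
      \<not> embeds (arc_rel H) (pverts H) E V \<Longrightarrow> col E V c" by blast
    have "dichromatic_number (with_proj D) \<le> c"
      if D: "D \<in> oriented_complete_multipartite_graphs" and "\<not> contains_induced D H" for D
    proof -
      have "ocm (arc_rel D) (pverts D)" using D unfolding oriented_complete_multipartite_iff by blast
      then show ?thesis using c[of "arc_rel D" "pverts D"] dn[OF D] ci[OF D] that(2) by blast
    qed
    then show "hero H" using H unfolding hero_in_def by blast
  qed
qed

text \<open>The class is fixed to vertices of type \<open>nat\<close>; finite digraphs on other
  types are copied along an injection. This is what makes triples and lists available as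
  vertices.\<close>

lemma hero_bound:
  assumes "hero H"
  shows "\<exists>c. \<forall>(E :: 'v \<Rightarrow> 'v \<Rightarrow> bool) V. ocm E V \<longrightarrow> \<not> embeds (arc_rel H) (pverts H) E V \<longrightarrow> col E V c"
proof -
  have "nonnull_digraph H" using assms unfolding hero_in_def by blast
  then obtain c where c: "\<And>(E :: nat \<Rightarrow> nat \<Rightarrow> bool) V. ocm E V \<Longrightarrow>
      \<not> embeds (arc_rel H) (pverts H) E V \<Longrightarrow> col E V c" using assms hero_nat_iff[of H] by blast
  have "col E V c" if V: "ocm E V" and ne: "\<not> embeds (arc_rel H) (pverts H) E V" for E :: "'v \<Rightarrow> 'v \<Rightarrow> bool" and V
  proof -
    obtain h :: "'v \<Rightarrow> nat" where h: "inj_on h V"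
      using finite_imp_inj_to_nat_seg[OF ocm_finite[OF V]] by blast
    define F where "F a b = E (the_inv_into V h a) (the_inv_into V h b)" for a b
    have F: "F (h x) (h y) \<longleftrightarrow> E x y" if "x \<in> V" "y \<in> V" for x y
      using that the_inv_into_f_f[OF h] unfolding F_def by simp
    have "ocm F (h ` V)"
      unfolding ocm_def
    proof (intro conjI)
      show "finite (h ` V)" using ocm_finite[OF V] by simp
      show "\<forall>x\<in>h ` V. \<forall>y\<in>h ` V. F x y \<longrightarrow> \<not> F y x" using F ocm_asym[OF V] by auto
      have n: "nadj F (h x) (h y) \<longleftrightarrow> nadj E x y" if "x \<in> V" "y \<in> V" for x y
        using F that unfolding nadj_def by simp
      show "\<forall>x\<in>h ` V. \<forall>y\<in>h ` V. \<forall>z\<in>h ` V. nadj F x y \<longrightarrow> nadj F y z \<longrightarrow> nadj F x z"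
      proof (intro ballI impI)
        fix x y z assume h: "x \<in> h ` V" "y \<in> h ` V" "z \<in> h ` V" and "nadj F x y" "nadj F y z"
        obtain a b d where abd: "a \<in> V" "b \<in> V" "d \<in> V" "x = h a" "y = h b" "z = h d" using h by blast
        have "nadj E a b" "nadj E b d" using n abd \<open>nadj F x y\<close> \<open>nadj F y z\<close> by auto
        then have "nadj E a d" using ocm_trans[OF V abd(1-3)] by blast
        then show "nadj F x z" using n abd by simp
      qed
    qed
    moreover have "embeds F (h ` V) E V"
      unfolding embeds_def
      by (rule exI[of _ "the_inv_into V h"]) (use h in \<open>auto simp: F_def the_inv_into_f_f inj_on_the_inv_into\<close>)
    then have "\<not> embeds (arc_rel H) (pverts H) F (h ` V)" using ne embeds_trans by blast
    ultimately have "col F (h ` V) c" by (rule c)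
    then show ?thesis by (rule col_image[OF h, rotated]) (simp add: F)
  qed
  then show ?thesis by blast
qed

lemma heroI:
  assumes "nonnull_digraph H"
    and "\<And>(E :: nat \<Rightarrow> nat \<Rightarrow> bool) V. ocm E V \<Longrightarrow> \<not> embeds (arc_rel H) (pverts H) E V \<Longrightarrow> col E V c"
  shows "hero H"
  using assms(2) hero_nat_iff[OF assms(1)] by blast

lemma hero_subdigraph:
  assumes H: "hero H" and A: "nonnull_digraph A" and e: "embeds (arc_rel A) (pverts A) (arc_rel H) (pverts H)"
  shows "hero A"
proof -
  obtain c where c: "\<And>(E :: nat \<Rightarrow> nat \<Rightarrow> bool) V. ocm E V \<Longrightarrow>
      \<not> embeds (arc_rel H) (pverts H) E V \<Longrightarrow> col E V c" using hero_bound[OF H] by blast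
  show ?thesis
  proof (rule heroI[OF A, of c])
    show "col E V c" if "ocm E V" "\<not> embeds (arc_rel A) (pverts A) E V" for E and V :: "nat set"
      using c[OF that(1)] embeds_trans[OF e] that(2) by blast
  qed
qed

lemma digraph_iso_embeds:
  assumes "digraph_iso (with_proj A) (with_proj B)"
  shows "embeds (arc_rel A) (pverts A) (arc_rel B) (pverts B)"
proof -
  obtain f where f: "pre_digraph.digraph_isomorphism (with_proj A) f" "with_proj B = app_iso f (with_proj A)"
    using assms unfolding digraph_iso_def by blast
  then show ?thesis
    using digraph_isomorphism_arc[OF f] unfolding embeds_def bij_betw_def by (intro exI[of _ "iso_verts f"]) auto
qed

section \<open>Heroes obtained from smaller heroes\<close>

lemma hero_K1:
  assumes H: "nonnull_digraph H" and iso: "digraph_iso (with_proj H) (with_proj K1)"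
  shows "hero H"
proof (rule heroI[OF H, of 0])
  fix E and V :: "nat set" assume V: "ocm E V" and ne: "\<not> embeds (arc_rel H) (pverts H) E V"
  have "V = {}"
  proof (rule ccontr)
    assume "V \<noteq> {}"
    then obtain v where v: "v \<in> V" by blast
    have "embeds (arc_rel K1) (pverts K1) E V"
      unfolding embeds_def by (rule exI[of _ "\<lambda>_. v"]) (use v ocm_irrefl[OF V] in \<open>auto simp: K1_def arc_rel_def\<close>)
    then show False using ne embeds_trans digraph_iso_embeds[OF iso] by blast
  qed
  then show "col E V 0" by simp
qed

text \<open>The slack in \<open>c \<le> d\<close> and in \<open>h\<close> lets both sides of a
  dijoin share their constants.\<close>

lemma hero_supplies:
  assumes "\<And>(E :: 'v \<Rightarrow> 'v \<Rightarrow> bool) V. ocm E V \<Longrightarrow> \<not> embeds (arc_rel H) (pverts H) E V \<Longrightarrow> col E V c"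
    and V: "ocm E (V :: 'v set)" and fin: "finite (pverts H)" "card (pverts H) \<le> h" and "c \<le> d"
  shows "supplies E V (\<lambda>Y. \<exists>g. inj_on g (pverts H) \<and> Y = g ` pverts H \<and>
    (\<forall>x\<in>pverts H. \<forall>y\<in>pverts H. arc_rel H x y \<longleftrightarrow> E (g x) (g y))) d h"
  unfolding supplies_def
proof (intro allI impI)
  fix U assume U: "U \<subseteq> V" "\<not> col E U d"
  then have "\<not> col E U c" using col_mono[of E U c U d] assms(5) by blast
  then have "embeds (arc_rel H) (pverts H) E U" using assms(1) ocm_subset[OF V U(1)] by blast
  then obtain g where g: "inj_on g (pverts H)" "g ` pverts H \<subseteq> U"
    "\<forall>x\<in>pverts H. \<forall>y\<in>pverts H. arc_rel H x y \<longleftrightarrow> E (g x) (g y)" unfolding embeds_def by blast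
  have "card (g ` pverts H) \<le> h" using card_image_le[OF fin(1), of g] fin(2) by simp
  then show "\<exists>Y\<subseteq>U. (\<exists>g. inj_on g (pverts H) \<and> Y = g ` pverts H \<and>
      (\<forall>x\<in>pverts H. \<forall>y\<in>pverts H. arc_rel H x y \<longleftrightarrow> E (g x) (g y))) \<and> card Y \<le> h"
    using g by (intro exI[of _ "g ` pverts H"]) auto
qed

lemma dijoin_simps:
  "pverts (dijoin A B) = pverts A <+> pverts B"
  "arc_rel (dijoin A B) (Inl x) (Inl x') \<longleftrightarrow> arc_rel A x x'"
  "arc_rel (dijoin A B) (Inr y) (Inr y') \<longleftrightarrow> arc_rel B y y'"
  "arc_rel (dijoin A B) (Inl x) (Inr y) \<longleftrightarrow> x \<in> pverts A \<and> y \<in> pverts B"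
  "\<not> arc_rel (dijoin A B) (Inr y) (Inl x)"
  unfolding dijoin_def disjoint_union_def arc_rel_def by (force simp: map_prod_def image_iff)+

lemma C3_simps:
  "pverts (C3 A B C) = pverts A <+> pverts B <+> pverts C"
  "arc_rel (C3 A B C) (Inl x) (Inl x') \<longleftrightarrow> arc_rel A x x'"
  "arc_rel (C3 A B C) (Inr (Inl y)) (Inr (Inl y')) \<longleftrightarrow> arc_rel B y y'"
  "arc_rel (C3 A B C) (Inr (Inr z)) (Inr (Inr z')) \<longleftrightarrow> arc_rel C z z'"
  "arc_rel (C3 A B C) (Inl x) (Inr (Inl y)) \<longleftrightarrow> x \<in> pverts A \<and> y \<in> pverts B"
  "arc_rel (C3 A B C) (Inr (Inl y)) (Inr (Inr z)) \<longleftrightarrow> y \<in> pverts B \<and> z \<in> pverts C"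
  "arc_rel (C3 A B C) (Inr (Inr z)) (Inl x) \<longleftrightarrow> z \<in> pverts C \<and> x \<in> pverts A"
  "\<not> arc_rel (C3 A B C) (Inr (Inl y)) (Inl x)"
  "\<not> arc_rel (C3 A B C) (Inr (Inr z)) (Inr (Inl y))"
  "\<not> arc_rel (C3 A B C) (Inl x) (Inr (Inr z))"
  unfolding C3_def disjoint_union_def arc_rel_def Let_def by (force simp: map_prod_def image_iff)+

lemma hero_dijoin:
  assumes H: "nonnull_digraph H" and h1: "hero H1" and h2: "hero H2"
    and iso: "digraph_iso (with_proj H) (with_proj (dijoin H1 H2))"
  shows "hero H"
proof -
  obtain c1 where c1: "\<And>(E :: nat \<Rightarrow> nat \<Rightarrow> bool) V. ocm E V \<Longrightarrow>
      \<not> embeds (arc_rel H1) (pverts H1) E V \<Longrightarrow> col E V c1" using hero_bound[OF h1] by blast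
  obtain c2 where c2: "\<And>(E :: nat \<Rightarrow> nat \<Rightarrow> bool) V. ocm E V \<Longrightarrow>
      \<not> embeds (arc_rel H2) (pverts H2) E V \<Longrightarrow> col E V c2" using hero_bound[OF h2] by blast
  have fin: "finite (pverts H1)" "finite (pverts H2)"
    using h1 h2 unfolding hero_in_def nonnull_digraph_iff by auto
  define c where "c = max c1 c2"
  define h where "h = max (card (pverts H1)) (card (pverts H2))"
  obtain C where "\<forall>(E :: nat \<Rightarrow> nat \<Rightarrow> bool) V p q. dijoin_free E V p q c h \<longrightarrow> col E V C"
    using dijoin_free_col[of c h] by (rule exE)
  note C = this[rule_format]
  show ?thesis
  proof (rule heroI[OF H, of C])
    fix E and V :: "nat set" assume V: "ocm E V" and ne: "\<not> embeds (arc_rel H) (pverts H) E V"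
    let ?p = "\<lambda>Y. \<exists>g. inj_on g (pverts H1) \<and> Y = g ` pverts H1 \<and>
      (\<forall>x\<in>pverts H1. \<forall>y\<in>pverts H1. arc_rel H1 x y \<longleftrightarrow> E (g x) (g y))"
    let ?q = "\<lambda>Y. \<exists>g. inj_on g (pverts H2) \<and> Y = g ` pverts H2 \<and>
      (\<forall>x\<in>pverts H2. \<forall>y\<in>pverts H2. arc_rel H2 x y \<longleftrightarrow> E (g x) (g y))"
    show "col E V C"
    proof (rule C[of E V ?p ?q], unfold dijoin_free_def, intro conjI)
      show "supplies E V ?p c h" by (rule hero_supplies[OF c1 V fin(1)]) (auto simp: c_def h_def)
      show "supplies E V ?q c h" by (rule hero_supplies[OF c2 V fin(2)]) (auto simp: c_def h_def)
      show "\<not> (\<exists>Y Z. Y \<subseteq> V \<and> Z \<subseteq> V \<and> ?p Y \<and> ?q Z \<and> (\<forall>y\<in>Y. \<forall>z\<in>Z. E y z))"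
      proof (intro notI, elim exE conjE)
        fix Y Z g g'
        assume YZ: "Y \<subseteq> V" "Z \<subseteq> V" "\<forall>y\<in>Y. \<forall>z\<in>Z. E y z"
          and g: "inj_on g (pverts H1)" "Y = g ` pverts H1" "\<forall>x\<in>pverts H1. \<forall>y\<in>pverts H1. arc_rel H1 x y \<longleftrightarrow> E (g x) (g y)"
          and g': "inj_on g' (pverts H2)" "Z = g' ` pverts H2" "\<forall>x\<in>pverts H2. \<forall>y\<in>pverts H2. arc_rel H2 x y \<longleftrightarrow> E (g' x) (g' y)"
        have arc: "E (g x) (g' y)" "\<not> E (g' y) (g x)" "g x \<noteq> g' y" if "x \<in> pverts H1" "y \<in> pverts H2" for x y
        proof -
          have v: "g x \<in> V" "g' y \<in> V" using YZ g(2) g'(2) that by auto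
          show e: "E (g x) (g' y)" using YZ(3) g(2) g'(2) that by auto
          show "\<not> E (g' y) (g x)" using ocm_asym[OF V v] e by blast
          show "g x \<noteq> g' y" using ocm_irrefl[OF V v(1)] e by auto
        qed
        have "embeds (arc_rel (dijoin H1 H2)) (pverts (dijoin H1 H2)) E V"
          unfolding embeds_def dijoin_simps(1)
        proof (intro exI conjI)
          show "inj_on (case_sum g g') (pverts H1 <+> pverts H2)"
            unfolding inj_on_def using arc(3) g(1) g'(1) by (fastforce dest: inj_onD)
          show "case_sum g g' ` (pverts H1 <+> pverts H2) \<subseteq> V" using YZ g(2) g'(2) by auto
          show "\<forall>x\<in>pverts H1 <+> pverts H2. \<forall>y\<in>pverts H1 <+> pverts H2.
            arc_rel (dijoin H1 H2) x y \<longleftrightarrow> E (case_sum g g' x) (case_sum g g' y)"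
            using g(3) g'(3) arc by (auto simp: dijoin_simps)
        qed
        then show False using ne embeds_trans digraph_iso_embeds[OF iso] by blast
      qed
    qed (rule V)
  qed
qed

text \<open>A copy of \<open>H1\<close> in the return set of an arc \<open>uv\<close> forms a copy
  of \<open>H\<close> with \<open>u\<close> and \<open>v\<close>. So without \<open>H\<close> all
  arcs are light.\<close>

lemma hero_C3:
  assumes H: "nonnull_digraph H" and h1: "hero H1"
    and iso: "digraph_iso (with_proj H) (with_proj (C3 K1 K1 H1))"
  shows "hero H"
proof -
  obtain c where c: "\<And>(E :: nat \<Rightarrow> nat \<Rightarrow> bool) V. ocm E V \<Longrightarrow>
      \<not> embeds (arc_rel H1) (pverts H1) E V \<Longrightarrow> col E V c" using hero_bound[OF h1] by blast
  obtain C where C: "\<And>(E :: nat \<Rightarrow> nat \<Rightarrow> bool) V. light E V c \<Longrightarrow> col E V C" using light_bounded by blast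
  show ?thesis
  proof (rule heroI[OF H, of C])
    fix E and V :: "nat set" assume V: "ocm E V" and ne: "\<not> embeds (arc_rel H) (pverts H) E V"
    have "col E {w\<in>V. E v w \<and> E w u} c" if uv: "u \<in> V" "v \<in> V" "E u v" for u v
    proof (rule ccontr)
      let ?W = "{w\<in>V. E v w \<and> E w u}"
      assume "\<not> col E ?W c"
      moreover have "ocm E ?W" by (rule ocm_subset[OF V]) auto
      ultimately have "embeds (arc_rel H1) (pverts H1) E ?W" using c by blast
      then obtain g where g: "inj_on g (pverts H1)" "g ` pverts H1 \<subseteq> ?W"
        "\<forall>x\<in>pverts H1. \<forall>y\<in>pverts H1. arc_rel H1 x y \<longleftrightarrow> E (g x) (g y)" unfolding embeds_def by blast
      have arc: "g x \<in> V" "E v (g x)" "E (g x) u" "\<not> E (g x) v" "\<not> E u (g x)" "g x \<noteq> u" "g x \<noteq> v"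
        if "x \<in> pverts H1" for x
      proof -
        show w: "g x \<in> V" "E v (g x)" "E (g x) u" using g(2) that by auto
        show "\<not> E (g x) v" "\<not> E u (g x)" using ocm_asym[OF V] w uv by blast+
        show "g x \<noteq> u" "g x \<noteq> v" using w uv ocm_irrefl[OF V] by auto
      qed
      have irr: "\<not> E u u" "\<not> E v v" "\<not> E v u" "u \<noteq> v" using ocm_irrefl[OF V] ocm_asym[OF V] uv by auto
      have K: "pverts K1 = {()}" "\<not> arc_rel K1 a b" for a b unfolding K1_def arc_rel_def by auto
      let ?g = "case_sum (\<lambda>_. u) (case_sum (\<lambda>_. v) g)"
      have "embeds (arc_rel (C3 K1 K1 H1)) (pverts (C3 K1 K1 H1)) E V"
        unfolding embeds_def C3_simps(1)
      proof (intro exI conjI)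
        show "inj_on ?g (pverts K1 <+> pverts K1 <+> pverts H1)"
          unfolding inj_on_def using arc(6,7) irr(4) g(1) by (fastforce dest: inj_onD)
        show "?g ` (pverts K1 <+> pverts K1 <+> pverts H1) \<subseteq> V" using uv arc(1) by auto
        show "\<forall>x\<in>pverts K1 <+> pverts K1 <+> pverts H1. \<forall>y\<in>pverts K1 <+> pverts K1 <+> pverts H1.
          arc_rel (C3 K1 K1 H1) x y \<longleftrightarrow> E (?g x) (?g y)"
          using g(3) arc irr uv(3) K by (auto simp: C3_simps)
      qed
      then show False using ne embeds_trans digraph_iso_embeds[OF iso] by blast
    qed
    then have "light E V c" using V unfolding light_def by blast
    then show "col E V C" by (rule C)
  qed
qed

section \<open>The structure of heroes\<close>

text \<open>The vertices of length \<open>Suc n\<close> induce \<open>C3\<close> of three copies of the tournament on those of length \<open>n\<close>.\<close>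
fun tarc :: "nat list \<Rightarrow> nat list \<Rightarrow> bool" where
  "tarc (a # xs) (b # ys) \<longleftrightarrow> (if a = b then tarc xs ys else b = Suc a mod 3)"
| "tarc _ _ \<longleftrightarrow> False"

definition tverts :: "nat \<Rightarrow> nat list set" where
  "tverts n = {xs. set xs \<subseteq> {..<3} \<and> length xs = n}"

lemma less_3_cases:
  assumes "(a :: nat) < 3" obtains "a = 0" | "a = 1" | "a = 2"
  using assms by linarith

lemma mod3_cases: "(a :: nat) < 3 \<Longrightarrow> b < 3 \<Longrightarrow> a \<noteq> b \<Longrightarrow> (b = Suc a mod 3) \<noteq> (a = Suc b mod 3)"
  by (elim less_3_cases) simp_all

lemma tarc_tournament:
  "xs \<in> tverts n \<Longrightarrow> ys \<in> tverts n \<Longrightarrow> xs \<noteq> ys \<Longrightarrow> tarc xs ys \<noteq> tarc ys xs"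
proof (induction n arbitrary: xs ys)
  case (Suc n)
  then obtain a xs' b ys' where eq: "xs = a # xs'" "ys = b # ys'" unfolding tverts_def by (auto simp: length_Suc_conv)
  show ?case
  proof (cases "a = b")
    case True
    then show ?thesis using Suc.IH[of xs' ys'] Suc.prems eq unfolding tverts_def by auto
  next
    case False
    then show ?thesis using mod3_cases[of a b] Suc.prems eq unfolding tverts_def by auto
  qed
qed (simp add: tverts_def)

lemma tarc_irrefl: "\<not> tarc xs xs"
  by (induction xs) auto

lemma ocm_tverts: "ocm tarc (tverts n)"
proof -
  have "nadj tarc x y \<longleftrightarrow> x = y" if "x \<in> tverts n" "y \<in> tverts n" for x y
    using tarc_tournament[OF that] tarc_irrefl unfolding nadj_def by blast
  moreover have "finite (tverts n)" unfolding tverts_def by (rule finite_lists_length_eq) simp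
  moreover have "\<not> tarc y x" if "x \<in> tverts n" "y \<in> tverts n" "tarc x y" for x y
    using tarc_tournament[OF that(1,2)] tarc_irrefl that(3) by (cases "x = y") auto
  ultimately show ?thesis unfolding ocm_def by auto
qed

text \<open>Each of the three copies of the smaller tournament is not \<open>n\<close>-colourable,
  so it contains colour 0, and three such vertices form a triangle.\<close>

lemma tverts_not_col: "\<not> col tarc (tverts n) n"
proof (induction n)
  case (Suc n)
  show ?case
  proof
    assume "col tarc (tverts (Suc n)) (Suc n)"
    then obtain f where f: "is_colouring tarc (tverts (Suc n)) (Suc n) f" unfolding col_def by blast
    have ex: "\<exists>x\<in>tverts n. f (a # x) = 0" if a: "a < 3" for a
    proof -
      have sub: "(#) a ` tverts n \<subseteq> tverts (Suc n)" using a unfolding tverts_def by auto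
      have nc: "\<not> col tarc ((#) a ` tverts n) n"
      proof
        assume "col tarc ((#) a ` tverts n) n"
        then have "col tarc (tverts n) n" by (rule col_image[rotated 2]) auto
        then show False using Suc.IH by simp
      qed
      obtain z where "z \<in> (#) a ` tverts n" "f z = 0"
        using colour_used[OF is_colouring_subset[OF f sub] nc, of 0] by auto
      then show ?thesis by blast
    qed
    obtain x where x: "x \<in> tverts n" "f (0 # x) = 0" using ex[of 0] by auto
    obtain y where y: "y \<in> tverts n" "f (1 # y) = 0" using ex[of 1] by auto
    obtain z where z: "z \<in> tverts n" "f (2 # z) = 0" using ex[of 2] by auto
    show False
      by (rule is_colouring_no_triangle[OF f, of "0 # x" "1 # y" "2 # z"]) (use x y z in \<open>auto simp: tverts_def\<close>)
  qed
qed (simp add: tverts_def)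

lemma hero_in_tverts:
  assumes "hero H" shows "\<exists>n. embeds (arc_rel H) (pverts H) tarc (tverts n)"
proof -
  obtain c where "\<And>(E :: nat list \<Rightarrow> nat list \<Rightarrow> bool) V. ocm E V \<Longrightarrow>
      \<not> embeds (arc_rel H) (pverts H) E V \<Longrightarrow> col E V c" using hero_bound[OF assms] by blast
  then show ?thesis using ocm_tverts tverts_not_col by blast
qed

lemma hero_C122_free:
  assumes "hero H"
    and V: "x \<in> pverts H" "y \<in> pverts H" "y' \<in> pverts H" "z \<in> pverts H" "z' \<in> pverts H"
    and arcs: "arc_rel H x y" "arc_rel H x y'" "arc_rel H y y'" "arc_rel H y z" "arc_rel H y z'"
      "arc_rel H y' z" "arc_rel H y' z'" "arc_rel H z z'" "arc_rel H z x" "arc_rel H z' x"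
  shows False
proof -
  obtain c where c: "\<And>(E :: triple \<Rightarrow> triple \<Rightarrow> bool) V. ocm E V \<Longrightarrow>
      \<not> embeds (arc_rel H) (pverts H) E V \<Longrightarrow> col E V c" using hero_bound[OF assms(1)] by blast
  obtain n where "\<not> col shift_arc (triples n) c" using triples_not_col by blast
  then have "embeds (arc_rel H) (pverts H) shift_arc (triples n)" using c[OF ocm_triples] by blast
  then obtain g where g: "g ` pverts H \<subseteq> triples n"
    "\<And>x y. x \<in> pverts H \<Longrightarrow> y \<in> pverts H \<Longrightarrow> arc_rel H x y \<longleftrightarrow> shift_arc (g x) (g y)" unfolding embeds_def by blast
  show False
    by (rule triples_C122_free[of "g x" n "g y" "g y'" "g z" "g z'"]) (use g V arcs in auto)
qed

text \<open>Keeps the vertex type, as the final statement demands of \<open>H1\<close> and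
  \<open>H2\<close>.\<close>

definition restrict_digraph :: "'a pair_pre_digraph \<Rightarrow> 'a set \<Rightarrow> 'a pair_pre_digraph" where
  "restrict_digraph H A = \<lparr>pverts = A, parcs = parcs H \<inter> A \<times> A\<rparr>"

lemma restrict_digraph_simps [simp]:
  "pverts (restrict_digraph H A) = A"
  "parcs (restrict_digraph H A) = parcs H \<inter> A \<times> A"
  "arc_rel (restrict_digraph H A) x y \<longleftrightarrow> x \<in> A \<and> y \<in> A \<and> arc_rel H x y"
  unfolding restrict_digraph_def arc_rel_def by auto

lemma hero_restrict:
  assumes H: "hero H" and A: "A \<subseteq> pverts H" "A \<noteq> {}"
  shows "hero (restrict_digraph H A)"
proof (rule hero_subdigraph[OF H])
  have "nonnull_digraph H" using H unfolding hero_in_def by blast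
  then show "nonnull_digraph (restrict_digraph H A)"
    using A finite_subset unfolding nonnull_digraph_iff by auto
  show "embeds (arc_rel (restrict_digraph H A)) (pverts (restrict_digraph H A)) (arc_rel H) (pverts H)"
    unfolding embeds_def by (rule exI[of _ id]) (use A in auto)
qed

text \<open>Opposite arcs are excluded explicitly because \<open>H\<close> is a general digraph,
  whereas \<open>dijoin\<close> and \<open>C3\<close> add arcs in one direction only.\<close>

definition beats :: "'a pair_pre_digraph \<Rightarrow> 'a set \<Rightarrow> 'a set \<Rightarrow> bool" where
  "beats H A B \<longleftrightarrow> (\<forall>x\<in>A. \<forall>y\<in>B. arc_rel H x y \<and> \<not> arc_rel H y x)"

lemma parcs_dijoin: "parcs (dijoin (restrict_digraph H A) (restrict_digraph H B)) \<subseteq>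
    pverts (dijoin (restrict_digraph H A) (restrict_digraph H B)) \<times> pverts (dijoin (restrict_digraph H A) (restrict_digraph H B))"
  unfolding dijoin_def disjoint_union_def restrict_digraph_def by auto

lemma parcs_C3: "parcs (C3 K1 K1 (restrict_digraph H A)) \<subseteq>
    pverts (C3 K1 K1 (restrict_digraph H A)) \<times> pverts (C3 K1 K1 (restrict_digraph H A))"
  unfolding C3_def Let_def disjoint_union_def restrict_digraph_def K1_def by auto

lemma digraph_iso_dijoin:
  assumes H: "parcs H \<subseteq> pverts H \<times> pverts H" and AB: "pverts H = A \<union> B" "A \<inter> B = {}" and b: "beats H A B"
  shows "digraph_iso (with_proj H) (with_proj (dijoin (restrict_digraph H A) (restrict_digraph H B)))"
  unfolding digraph_iso_iff[OF H parcs_dijoin]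
proof (intro exI conjI ballI)
  let ?g = "\<lambda>x. if x \<in> A then Inl x else Inr x"
  show "bij_betw ?g (pverts H) (pverts (dijoin (restrict_digraph H A) (restrict_digraph H B)))"
    unfolding bij_betw_def AB(1) dijoin_simps(1) using AB(2) by (auto simp: inj_on_def)
  fix x y assume "x \<in> pverts H" "y \<in> pverts H"
  then show "arc_rel H x y \<longleftrightarrow> arc_rel (dijoin (restrict_digraph H A) (restrict_digraph H B)) (?g x) (?g y)"
    using AB b unfolding beats_def by (auto simp: dijoin_simps)
qed

lemma digraph_iso_C3:
  assumes H: "nonnull_digraph H" and V: "pverts H = {u} \<union> {v} \<union> A" "u \<noteq> v" "u \<notin> A" "v \<notin> A"
    and b: "beats H {u} {v}" "beats H {v} A" "beats H A {u}"
  shows "digraph_iso (with_proj H) (with_proj (C3 K1 K1 (restrict_digraph H A)))"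
proof -
  have wf: "parcs H \<subseteq> pverts H \<times> pverts H" and irr: "\<not> arc_rel H x x" for x
    using H unfolding nonnull_digraph_iff by auto
  have K: "pverts K1 = {()}" "\<not> arc_rel K1 a b" for a b unfolding K1_def arc_rel_def by auto
  show ?thesis
    unfolding digraph_iso_iff[OF wf parcs_C3]
  proof (intro exI conjI ballI)
    let ?g = "\<lambda>x. if x = u then Inl () else if x = v then Inr (Inl ()) else Inr (Inr x)"
    show "bij_betw ?g (pverts H) (pverts (C3 K1 K1 (restrict_digraph H A)))"
      unfolding bij_betw_def V(1) C3_simps(1) K(1) using V(2-4) by (auto simp: inj_on_def)
    fix x y assume "x \<in> pverts H" "y \<in> pverts H"
    then show "arc_rel H x y \<longleftrightarrow> arc_rel (C3 K1 K1 (restrict_digraph H A)) (?g x) (?g y)"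
      using V b irr K unfolding beats_def by (auto simp: C3_simps)
  qed
qed

section \<open>Decomposing a hero along a cyclic split\<close>

definition decomposable :: "'a pair_pre_digraph \<Rightarrow> bool" where
  "decomposable H \<longleftrightarrow> digraph_iso (with_proj H) (with_proj K1) \<or>
    (\<exists>A B. A \<subseteq> pverts H \<and> A \<noteq> {} \<and> B \<subseteq> pverts H \<and> B \<noteq> {} \<and>
      digraph_iso (with_proj H) (with_proj (dijoin (restrict_digraph H A) (restrict_digraph H B)))) \<or>
    (\<exists>A. A \<subseteq> pverts H \<and> A \<noteq> {} \<and> digraph_iso (with_proj H) (with_proj (C3 K1 K1 (restrict_digraph H A))))"

definition cyclic_split :: "'a pair_pre_digraph \<Rightarrow> 'a set \<Rightarrow> 'a set \<Rightarrow> 'a set \<Rightarrow> bool" where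
  "cyclic_split H X Y Z \<longleftrightarrow> pverts H = X \<union> Y \<union> Z \<and> X \<inter> Y = {} \<and> Y \<inter> Z = {} \<and> Z \<inter> X = {} \<and>
    beats H X Y \<and> beats H Y Z \<and> beats H Z X"

lemma cyclic_split_rotate: "cyclic_split H X Y Z \<Longrightarrow> cyclic_split H Y Z X"
  unfolding cyclic_split_def by blast

text \<open>An empty class leaves a dijoin. Otherwise two consecutive classes cannot both have two
  vertices, since with a vertex of the third they would contain \<open>C3 1 2 2\<close>. Applied to
  all three rotations, this makes two of the classes singletons.\<close>

lemma cyclic_split_decomposable:
  assumes H: "hero H" and s: "cyclic_split H X Y Z"
    and total: "\<And>x y. x \<in> pverts H \<Longrightarrow> y \<in> pverts H \<Longrightarrow> x \<noteq> y \<Longrightarrow> arc_rel H x y \<or> arc_rel H y x"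
    and proper: "X \<noteq> pverts H" "Y \<noteq> pverts H" "Z \<noteq> pverts H"
  shows "decomposable H"
proof -
  have nn: "nonnull_digraph H" using H unfolding hero_in_def by blast
  have wf: "parcs H \<subseteq> pverts H \<times> pverts H" using nn unfolding nonnull_digraph_iff by blast
  have two: "decomposable H" if s: "cyclic_split H X Y Z" and e: "Z = {}" and p: "X \<noteq> pverts H" "Y \<noteq> pverts H" for X Y Z
  proof -
    have V: "pverts H = X \<union> Y" "X \<inter> Y = {}" "beats H X Y" using s e unfolding cyclic_split_def by auto
    then have "X \<noteq> {}" "Y \<noteq> {}" using p by auto
    then show ?thesis using digraph_iso_dijoin[OF wf V] V(1) unfolding decomposable_def by blast
  qed
  have no_two: "\<exists>v. Y = {v} \<or> Z = {v}"
    if s: "cyclic_split H X Y Z" and ne: "X \<noteq> {}" "Y \<noteq> {}" "Z \<noteq> {}" for X Y Z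
  proof (rule ccontr)
    have pair: "\<exists>a b. a \<in> S \<and> b \<in> S \<and> arc_rel H a b" if S: "S \<subseteq> pverts H" "S \<noteq> {}" "\<nexists>v. S = {v}" for S
    proof -
      from S(2) obtain a where a: "a \<in> S" by blast
      with S(3) obtain b where "b \<in> S" "b \<noteq> a" by blast
      then show ?thesis using total[of a b] a S(1) by blast
    qed
    assume n: "\<not> ?thesis"
    have V: "X \<subseteq> pverts H" "Y \<subseteq> pverts H" "Z \<subseteq> pverts H" using s unfolding cyclic_split_def by auto
    obtain x where x: "x \<in> X" using ne(1) by blast
    obtain y y' where y: "y \<in> Y" "y' \<in> Y" "arc_rel H y y'" using pair[OF V(2) ne(2)] n by blast
    obtain z z' where z: "z \<in> Z" "z' \<in> Z" "arc_rel H z z'" using pair[OF V(3) ne(3)] n by blast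
    have XY: "arc_rel H a b" if "a \<in> X" "b \<in> Y" for a b using s that unfolding cyclic_split_def beats_def by blast
    have YZ: "arc_rel H a b" if "a \<in> Y" "b \<in> Z" for a b using s that unfolding cyclic_split_def beats_def by blast
    have ZX: "arc_rel H a b" if "a \<in> Z" "b \<in> X" for a b using s that unfolding cyclic_split_def beats_def by blast
    have v: "x \<in> pverts H" "y \<in> pverts H" "y' \<in> pverts H" "z \<in> pverts H" "z' \<in> pverts H"
      using x y z V by auto
    show False
      by (rule hero_C122_free[OF H v]) (use XY YZ ZX x y z in simp_all)
  qed
  have single: "decomposable H" if s: "cyclic_split H {u} {v} A" and A: "A \<noteq> {}" for u v A
  proof -
    have "digraph_iso (with_proj H) (with_proj (C3 K1 K1 (restrict_digraph H A)))"
      by (rule digraph_iso_C3[OF nn, of u v]) (use s in \<open>auto simp: cyclic_split_def\<close>)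
    moreover have "A \<subseteq> pverts H" using s unfolding cyclic_split_def by blast
    ultimately show ?thesis using A unfolding decomposable_def by blast
  qed
  note s' = cyclic_split_rotate[OF s] and s'' = cyclic_split_rotate[OF cyclic_split_rotate[OF s]]
  show ?thesis
  proof (cases "X = {} \<or> Y = {} \<or> Z = {}")
    case True
    then show ?thesis using two[OF s] two[OF s'] two[OF s''] proper by blast
  next
    case False
    have "(\<exists>u. Y = {u} \<or> Z = {u}) \<and> (\<exists>u. Z = {u} \<or> X = {u}) \<and> (\<exists>u. X = {u} \<or> Y = {u})"
      using no_two[OF s] no_two[OF s'] no_two[OF s''] False by blast
    then consider u v where "Y = {u}" "Z = {v}" | u v where "X = {u}" "Y = {v}" | u v where "Z = {u}" "X = {v}"
      by metis
    then show ?thesis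
    proof cases
      case (1 u v) then show ?thesis using single[of u v X] s' False by blast
    next
      case (2 u v) then show ?thesis using single[of u v Z] s False by blast
    next
      case (3 u v) then show ?thesis using single[of u v Y] s'' False by blast
    qed
  qed
qed

text \<open>First letters split \<open>H\<close> cyclically. If they are all equal, dropping them
  embeds the same \<open>H\<close> into a smaller tournament.\<close>

lemma hero_decomposable:
  assumes H: "hero H" and "embeds (arc_rel H) (pverts H) tarc (tverts n)"
  shows "decomposable H"
  using assms(2)
proof (induction n)
  case 0
  have nn: "nonnull_digraph H" using H unfolding hero_in_def by blast
  then have wf: "parcs H \<subseteq> pverts H \<times> pverts H" "pverts H \<noteq> {}" "\<And>x. \<not> arc_rel H x x"
    unfolding nonnull_digraph_iff by auto
  have "tverts 0 = {[]}" unfolding tverts_def by auto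
  then obtain g where g: "inj_on g (pverts H)" "g ` pverts H \<subseteq> {[] :: nat list}" using 0 unfolding embeds_def by auto
  from wf(2) obtain h where h: "h \<in> pverts H" by blast
  have "x = h" if "x \<in> pverts H" for x
  proof -
    have "g x = []" "g h = []" using g(2) that h by blast+
    then show ?thesis using inj_onD[OF g(1), of x h] that h by simp
  qed
  then have V: "pverts H = {h}" using h by blast
  have "parcs K1 \<subseteq> pverts K1 \<times> pverts K1" unfolding K1_def by simp
  then have "digraph_iso (with_proj H) (with_proj K1)"
    unfolding digraph_iso_iff[OF wf(1) \<open>parcs K1 \<subseteq> pverts K1 \<times> pverts K1\<close>]
    using wf(3) by (intro exI[of _ "\<lambda>_. ()"]) (auto simp: V bij_betw_def K1_def arc_rel_def)
  then show ?case unfolding decomposable_def by blast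
next
  case (Suc n)
  obtain g where g: "inj_on g (pverts H)" "g ` pverts H \<subseteq> tverts (Suc n)"
    "\<And>x y. x \<in> pverts H \<Longrightarrow> y \<in> pverts H \<Longrightarrow> arc_rel H x y \<longleftrightarrow> tarc (g x) (g y)"
    using Suc.prems unfolding embeds_def by blast
  define X where "X a = {x\<in>pverts H. hd (g x) = a}" for a
  have gx: "g x = hd (g x) # tl (g x)" "hd (g x) < 3" "tl (g x) \<in> tverts n" if "x \<in> pverts H" for x
  proof -
    have "g x \<in> tverts (Suc n)" using g(2) that by blast
    then obtain a xs where "g x = a # xs" "a < 3" "xs \<in> tverts n" unfolding tverts_def by (auto simp: length_Suc_conv)
    then show "g x = hd (g x) # tl (g x)" "hd (g x) < 3" "tl (g x) \<in> tverts n" by auto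
  qed
  have tarc_g: "tarc (g x) (g y) \<longleftrightarrow> (if hd (g x) = hd (g y) then tarc (tl (g x)) (tl (g y)) else hd (g y) = Suc (hd (g x)) mod 3)"
    if "x \<in> pverts H" "y \<in> pverts H" for x y
    using gx(1)[OF that(1)] gx(1)[OF that(2)] tarc.simps(1)[of "hd (g x)" "tl (g x)" "hd (g y)" "tl (g y)"] by metis
  have beats: "beats H (X a) (X b)" if "b = Suc a mod 3" "a < 3" for a b
  proof -
    have "a \<noteq> b \<and> a \<noteq> Suc b mod 3" using that by (elim less_3_cases) simp_all
    then show ?thesis unfolding beats_def X_def using g(3) tarc_g that(1) by auto
  qed
  have split: "cyclic_split H (X 0) (X 1) (X 2)"
    unfolding cyclic_split_def
  proof (intro conjI)
    show "pverts H = X 0 \<union> X 1 \<union> X 2" unfolding X_def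
    proof (intro equalityI subsetI)
      fix x assume x: "x \<in> pverts H"
      have "hd (g x) = 0 \<or> hd (g x) = 1 \<or> hd (g x) = 2" using gx(2)[OF x] by (elim less_3_cases) simp_all
      then show "x \<in> {x\<in>pverts H. hd (g x) = 0} \<union> {x\<in>pverts H. hd (g x) = 1} \<union> {x\<in>pverts H. hd (g x) = 2}" using x by simp
    qed auto
    show "beats H (X 0) (X 1)" "beats H (X 1) (X 2)" "beats H (X 2) (X 0)" by (rule beats; simp)+
  qed (auto simp: X_def)
  show ?case
  proof (cases "\<exists>a. X a = pverts H")
    case True
    then obtain a where a: "\<And>x. x \<in> pverts H \<Longrightarrow> hd (g x) = a" unfolding X_def by blast
    have "embeds (arc_rel H) (pverts H) tarc (tverts n)"
      unfolding embeds_def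
    proof (intro exI conjI ballI)
      show "inj_on (tl \<circ> g) (pverts H)"
      proof (rule inj_onI)
        fix x y assume xy: "x \<in> pverts H" "y \<in> pverts H" "(tl \<circ> g) x = (tl \<circ> g) y"
        then have "g x = g y" using gx(1)[OF xy(1)] gx(1)[OF xy(2)] a by (metis comp_apply)
        then show "x = y" using inj_onD[OF g(1)] xy by blast
      qed
      show "(tl \<circ> g) ` pverts H \<subseteq> tverts n" using gx(3) by auto
      show "arc_rel H x y \<longleftrightarrow> tarc ((tl \<circ> g) x) ((tl \<circ> g) y)" if "x \<in> pverts H" "y \<in> pverts H" for x y
        using g(3)[OF that] tarc_g[OF that] a that by simp
    qed
    then show ?thesis by (rule Suc.IH)
  next
    case False
    show ?thesis
    proof (rule cyclic_split_decomposable[OF H split])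
      fix x y assume xy: "x \<in> pverts H" "y \<in> pverts H" "x \<noteq> y"
      then have "g x \<noteq> g y" using inj_onD[OF g(1)] by blast
      then have "tarc (g x) (g y) \<or> tarc (g y) (g x)" using tarc_tournament[of "g x" "Suc n" "g y"] g(2) xy by blast
      then show "arc_rel H x y \<or> arc_rel H y x" using g(3) xy by blast
    qed (use False in auto)
  qed
qed

theorem theorem7p1p2:
  fixes H :: "'a pair_pre_digraph"
  assumes "nonnull_digraph H"
  shows "hero_in oriented_complete_multipartite_graphs H \<longleftrightarrow>
    digraph_iso (with_proj H) (with_proj K1) \<or>
    (\<exists>(H1 :: 'a pair_pre_digraph) (H2 :: 'a pair_pre_digraph).
       hero_in oriented_complete_multipartite_graphs H1 \<and>
       hero_in oriented_complete_multipartite_graphs H2 \<and>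
       digraph_iso (with_proj H) (with_proj (dijoin H1 H2))) \<or>
    (\<exists>H1 :: 'a pair_pre_digraph.
       hero_in oriented_complete_multipartite_graphs H1 \<and>
       digraph_iso (with_proj H) (with_proj (C3 K1 K1 H1)))"
proof
  assume hero: "hero_in oriented_complete_multipartite_graphs H"
  then obtain n where "embeds (arc_rel H) (pverts H) tarc (tverts n)" using hero_in_tverts by blast
  then have "decomposable H" by (rule hero_decomposable[OF hero])
  then show "digraph_iso (with_proj H) (with_proj K1) \<or>
    (\<exists>(H1 :: 'a pair_pre_digraph) (H2 :: 'a pair_pre_digraph).
       hero_in oriented_complete_multipartite_graphs H1 \<and>
       hero_in oriented_complete_multipartite_graphs H2 \<and>
       digraph_iso (with_proj H) (with_proj (dijoin H1 H2))) \<or>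
    (\<exists>H1 :: 'a pair_pre_digraph.
       hero_in oriented_complete_multipartite_graphs H1 \<and>
       digraph_iso (with_proj H) (with_proj (C3 K1 K1 H1)))"
    unfolding decomposable_def using hero_restrict[OF hero] by blast
qed (use assms hero_K1 hero_dijoin hero_C3 in blast)

end
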